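(* (PAGE+ATC-GT, offline scenario.) Assume (A1)–(A3) of the context, that $W$ is symmetric, doubly stochastic, primitive and positive semidefinite, and that the local sample sizes are $N_k\equiv N$. Run DAMA with the ATC-GT matrices $\mathcal A_x=(W\otimes I_{d_1})^2$, $\mathcal B_x=I-W\otimes I_{d_1}$, $\mathcal C_x=I$ (and the same with $d_2$ for $y$), with $B=N$, $b=b_0=\sqrt{N/K}$, $p=\frac1{\sqrt{KN}}$, $\beta_x=\beta_y=0$, $\mu_x=\Theta\big(\frac{(1-\lambda)^2}{\kappa^2}\big)$ and $\mu_y=\Theta((1-\lambda)^2)$. Then for large $N$ and a sparsely connected network ($\lambda$ close to $1$), $$\frac1T\sum_{i=0}^{T-1}\big(\mathbb E\|\nabla_xJ(x_{c,i},y_{c,i})\|^2+\mathbb E\|\nabla_yJ(x_{c,i},y_{c,i})\|^2\big)\le\mathcal O\Big(\frac{\kappa^2\mathbb EG_{p,0}}{T(1-\lambda)^2}+\frac{\kappa^2\mathbb E\Delta_{c,0}}{T(1-\lambda)^2}+\frac{\kappa^2\zeta_0^2(1-\lambda)}T+\frac{\kappa^2\sigma^2}T+\frac{\kappa^2\lambda^4\sqrt K\sigma^2}{\sqrt NT}+\frac{\kappa^2\lambda^4(1-\lambda)^2\sqrt K\zeta_0^2}{\sqrt NT}\Big).$$ The communication complexity and sample complexity for achieving an $\varepsilon$-stationary point are $$T=\mathcal O\Big(\frac{\kappa^2\varepsilon^{-2}}{(1-\lambda)^2}+\kappa^2\varepsilon^{-2}+\kappa^2\varepsilon^{-2}(1-\lambda)\Big)=\mathcal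 O\Big(\frac{\kappa^2\varepsilon^{-2}}{(1-\lambda)^2}\Big)\quad\text{and}\quad\mathcal O\Big(\frac{\kappa^2\sqrt N\varepsilon^{-2}}{\sqrt K(1-\lambda)^2}\Big).$$
   Context: Problem. $K$ agents solve $\min_{x\in\mathbb R^{d_1}}\max_{y\in\mathbb R^{d_2}}J(x,y)$, $J=\frac1K\sum_{k=1}^KJ_k$, with $J_k(x,y)=\frac1{N_k}\sum_{s=1}^{N_k}Q_k(x,y;\zeta_k(s))$ (offline scenario). $P(x)=\max_yJ(x,y)$. Assumptions. (A1) For each $x$ the maximum is attained, $\|\nabla_yJ(x,y)\|^2\ge2\nu(P(x)-J(x,y))$ for all $x,y$ ($\nu>0$), and $P^\star=\inf_xP(x)>-\infty$. (A2) For each $k$ and $w\in\{x,y\}$, $\mathbb E\|\nabla_wQ_k(x_1,y_1;\xi)-\nabla_wQ_k(x_2,y_2;\xi)\|^2\le L_f^2(\|x_1-x_2\|^2+\|y_1-y_2\|^2)$ with $\xi$ uniform over the local data set. (A3) Samples are i.i.d. (uniform over the local data set), independent over agents and iterations; conditionally on the past, sample gradients $\nabla_wQ_k$ at the current iterate are unbiased for $\nabla_wJ_k$ with variance at most $\sigma^2$. Algorithm DAMA. Stack $\mathcal X_i=\mathrm{col}\{x_{1,i},\dots,x_{K,i}\}$, $\mathcal Y_i=\mathrm{col}\{y_{k,i}\}$, gradient estimates $\mathcal G_{x,i}=\mathrm{col}\{g^x_{k,i}\}$, $\mathcal G_{y,i}=\mathrm{col}\{g^y_{k,i}\}$. For $i\ge0$: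 $\mathcal X_{i+1}=\mathcal A_x(\mathcal C_x\mathcal X_i-\mu_x\mathcal G_{x,i})-\mathcal B_x\mathcal D_{x,i}$, $\mathcal Y_{i+1}=\mathcal A_y(\mathcal C_y\mathcal Y_i+\mu_y\mathcal G_{y,i})-\mathcal B_y\mathcal D_{y,i}$, $\mathcal D_{x,i+1}=\mathcal D_{x,i}+\mathcal B_x\mathcal X_{i+1}$, $\mathcal D_{y,i+1}=\mathcal D_{y,i}+\mathcal B_y\mathcal Y_{i+1}$; all agents start from identical $x_{k,0}=x_0$, $y_{k,0}=y_0$ and identical dual blocks. Estimator (GRACE): $g^w_{k,0}$ is a minibatch gradient with $b_0$ i.i.d. samples; for $i\ge1$, with $\pi_i\sim\mathrm{Bernoulli}(p)$ independent of everything else and shared by all agents: if $\pi_i=1$, $g^w_{k,i}=\nabla_wJ_k(x_{k,i},y_{k,i})$ (full local batch, $B=N$ samples); if $\pi_i=0$, with $b$ i.i.d. samples $\mathcal E'_{k,i}$, $g^w_{k,i}=(1-\beta_w)\big(g^w_{k,i-1}-\frac1b\sum_{\xi\in\mathcal E'_{k,i}}\nabla_wQ_k(x_{k,i-1},y_{k,i-1};\xi)\big)+\frac1b\sum_{\xi\in\mathcal E'_{k,i}}\nabla_wQ_k(x_{k,i},y_{k,i};\xi)$. Notation. $x_{c,i}=\frac1K\sum_kx_{k,i}$, $y_{c,i}=\frac1K\sum_ky_{k,i}$; $\kappa=L_f/\nu$; $G_{p,0}=P(x_{c,0})-P^\star$; $\Delta_{c,0}=P(x_{c,0})-J(x_{c,0},y_{c,0})$;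 $\zeta_0^2=\frac1K\mathbb E\|(\mathcal A_x-\frac1K\mathbf 1\mathbf 1^\top\otimes I)\mathcal G_{x,0}\|^2+\frac1K\mathbb E\|(\mathcal A_y-\frac1K\mathbf 1\mathbf 1^\top\otimes I)\mathcal G_{y,0}\|^2$; $\lambda$ is the largest eigenvalue of $W$ other than the simple eigenvalue $1$. Order conventions. $\Theta$-prescribed step sizes are suitable constant multiples of the given expressions; batch sizes are rounded to integers. Constants in $\mathcal O,\Theta$ may depend on $L_f$, but not on $T,K,N,\lambda,\kappa,\sigma,\zeta_0,\varepsilon$. "$\lambda$ close to $1$" may depend on $\kappa$ and these constants, and "large $N$" on all problem parameters including $\lambda$. An $\varepsilon$-stationary point is reached when the left-hand average is at most $\varepsilon^2$; communication complexity is the number $T$ of rounds needed and sample complexity the corresponding expected number of samples per agent, of order $T(1-p)b+TpN+b_0$ (the initial batch $b_0$ being of lower order for small $\varepsilon$); here $\mathbb EG_{p,0},\mathbb E\Delta_{c,0},\sigma^2,\zeta_0^2$ are treated as constants and $N$ is large. *)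

theory Defs
  imports "HOL-Probability.Probability" "Jordan_Normal_Form.Char_Poly"
begin

definition grad :: "('v::real_inner \<Rightarrow> real) \<Rightarrow> 'v \<Rightarrow> 'v" where
  "grad f x = (THE D. GDERIV f x :> D)"

text \<open>Mixing matrices.\<close>

definition doubly_stochastic :: "nat \<Rightarrow> real mat \<Rightarrow> bool" where
  "doubly_stochastic K W \<longleftrightarrow>
     (\<forall>k<K. \<forall>l<K. 0 \<le> W $$ (k, l)) \<and>
     (\<forall>k<K. (\<Sum>l<K. W $$ (k, l)) = 1) \<and> (\<forall>l<K. (\<Sum>k<K. W $$ (k, l)) = 1)"

definition primitive_mat :: "nat \<Rightarrow> real mat \<Rightarrow> bool" where
  "primitive_mat K W \<longleftrightarrow> (\<exists>m>0. \<forall>k<K. \<forall>l<K. 0 < (W ^\<^sub>m m) $$ (k, l))"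

definition pos_semidef_mat :: "nat \<Rightarrow> real mat \<Rightarrow> bool" where
  "pos_semidef_mat K W \<longleftrightarrow> (\<forall>v\<in>carrier_vec K. 0 \<le> scalar_prod v (W *\<^sub>v v))"

text \<open>
  A stacked vector with \<open>K\<close> blocks is a function on block indices, of which only the indices
  below \<open>K\<close> matter.  The operator \<open>kron_id M\<close> is the action of the Kronecker product of
  \<open>M\<close> with the identity on such a vector.
\<close>

definition kron_id :: "real mat \<Rightarrow> (nat \<Rightarrow> 'v::real_vector) \<Rightarrow> nat \<Rightarrow> 'v" where
  "kron_id M X = (\<lambda>k. \<Sum>l<dim_col M. (M $$ (k, l)) *\<^sub>R X l)"

definition averaging_mat :: "nat \<Rightarrow> real mat" where
  "averaging_mat K = Matrix.mat K K (\<lambda>_. 1 / real K)"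

definition stack_norm_sq :: "nat \<Rightarrow> (nat \<Rightarrow> 'v::real_normed_vector) \<Rightarrow> real" where
  "stack_norm_sq K X = (\<Sum>k<K. (norm (X k))\<^sup>2)"

text \<open>
  The general recursion for one of the two variables; \<open>\<eta>\<close> is the signed step size, negative
  for the minimising and positive for the maximising variable.
\<close>

definition dama_recursion ::
  "nat \<Rightarrow> ((nat \<Rightarrow> 'v) \<Rightarrow> nat \<Rightarrow> 'v) \<Rightarrow> ((nat \<Rightarrow> 'v) \<Rightarrow> nat \<Rightarrow> 'v) \<Rightarrow> ((nat \<Rightarrow> 'v) \<Rightarrow> nat \<Rightarrow> 'v) \<Rightarrow> real \<Rightarrow>
   (nat \<Rightarrow> nat \<Rightarrow> 'v::real_vector) \<Rightarrow> (nat \<Rightarrow> nat \<Rightarrow> 'v) \<Rightarrow> (nat \<Rightarrow> nat \<Rightarrow> 'v) \<Rightarrow> bool" where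
  "dama_recursion K \<A> \<B> \<C> \<eta> X G D \<longleftrightarrow>
     (\<forall>i. \<forall>k<K.
        X (Suc i) k = \<A> (\<lambda>l. \<C> (X i) l + \<eta> *\<^sub>R G i l) k - \<B> (D i) k \<and>
        D (Suc i) k = D i k + \<B> (X (Suc i)) k)"

definition atc_gt_A :: "real mat \<Rightarrow> (nat \<Rightarrow> 'v::real_vector) \<Rightarrow> nat \<Rightarrow> 'v" where
  "atc_gt_A W X = kron_id W (kron_id W X)"

definition atc_gt_B :: "real mat \<Rightarrow> (nat \<Rightarrow> 'v::real_vector) \<Rightarrow> nat \<Rightarrow> 'v" where
  "atc_gt_B W X = (\<lambda>k. X k - kron_id W X k)"

definition atc_gt_C :: "(nat \<Rightarrow> 'v::real_vector) \<Rightarrow> nat \<Rightarrow> 'v" where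
  "atc_gt_C X = X"

text \<open>
  The gradient estimator for one variable, along one trajectory.  Here \<open>full k x y\<close> is the
  gradient of the local objective of agent \<open>k\<close>, \<open>q k x y z\<close> its stochastic gradient for the
  sample \<open>z\<close>, \<open>\<xi> i k j\<close> the \<open>j\<close>-th sample drawn by agent \<open>k\<close> in iteration \<open>i\<close>, and
  \<open>c i\<close> the coin shared by all agents.
\<close>

definition grace_recursion ::
  "nat \<Rightarrow> nat \<Rightarrow> nat \<Rightarrow> real \<Rightarrow> (nat \<Rightarrow> 'x \<Rightarrow> 'y \<Rightarrow> 'v) \<Rightarrow> (nat \<Rightarrow> 'x \<Rightarrow> 'y \<Rightarrow> 'z \<Rightarrow> 'v) \<Rightarrow>
   (nat \<Rightarrow> nat \<Rightarrow> nat \<Rightarrow> 'z) \<Rightarrow> (nat \<Rightarrow> bool) \<Rightarrow>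
   (nat \<Rightarrow> nat \<Rightarrow> 'x) \<Rightarrow> (nat \<Rightarrow> nat \<Rightarrow> 'y) \<Rightarrow> (nat \<Rightarrow> nat \<Rightarrow> 'v::real_vector) \<Rightarrow> bool" where
  "grace_recursion K b0 b \<beta> full q \<xi> c X Y g \<longleftrightarrow>
     (\<forall>k<K. g 0 k = (1 / real b0) *\<^sub>R (\<Sum>j<b0. q k (X 0 k) (Y 0 k) (\<xi> 0 k j))) \<and>
     (\<forall>i. \<forall>k<K. g (Suc i) k =
        (if c (Suc i) then full k (X (Suc i) k) (Y (Suc i) k)
         else (1 - \<beta>) *\<^sub>R
                (g i k - (1 / real b) *\<^sub>R (\<Sum>j<b. q k (X i k) (Y i k) (\<xi> (Suc i) k j)))
              + (1 / real b) *\<^sub>R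
                (\<Sum>j<b. q k (X (Suc i) k) (Y (Suc i) k) (\<xi> (Suc i) k j))))"

text \<open>
  Batch sizes that are prescribed as real numbers may be rounded up or down.
\<close>

definition rounded :: "nat \<Rightarrow> real \<Rightarrow> bool" where
  "rounded n r \<longleftrightarrow> int n = \<lfloor>r\<rfloor> \<or> int n = \<lceil>r\<rceil>"

text \<open>The sources of randomness: initial point, coins, samples (iteration, agent, position).\<close>

datatype source = Init | Coin nat | Sample nat nat nat

locale minimax_problem =
  fixes K N :: nat
    and Q :: "nat \<Rightarrow> 'x::euclidean_space \<Rightarrow> 'y::euclidean_space \<Rightarrow> 'z \<Rightarrow> real"
    and \<zeta> :: "nat \<Rightarrow> nat \<Rightarrow> 'z"
begin

definition Jloc :: "nat \<Rightarrow> 'x \<Rightarrow> 'y \<Rightarrow> real" where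
  "Jloc k x y = (1 / real N) * (\<Sum>s<N. Q k x y (\<zeta> k s))"

definition J :: "'x \<Rightarrow> 'y \<Rightarrow> real" where
  "J x y = (1 / real K) * (\<Sum>k<K. Jloc k x y)"

definition P :: "'x \<Rightarrow> real" where
  "P x = (SUP y. J x y)"

definition Pstar :: real where
  "Pstar = (INF x. P x)"

definition gradQx :: "nat \<Rightarrow> 'x \<Rightarrow> 'y \<Rightarrow> 'z \<Rightarrow> 'x" where
  "gradQx k x y z = grad (\<lambda>x'. Q k x' y z) x"

definition gradQy :: "nat \<Rightarrow> 'x \<Rightarrow> 'y \<Rightarrow> 'z \<Rightarrow> 'y" where
  "gradQy k x y z = grad (\<lambda>y'. Q k x y' z) y"

definition gradJlocx :: "nat \<Rightarrow> 'x \<Rightarrow> 'y \<Rightarrow> 'x" where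
  "gradJlocx k x y = grad (\<lambda>x'. Jloc k x' y) x"

definition gradJlocy :: "nat \<Rightarrow> 'x \<Rightarrow> 'y \<Rightarrow> 'y" where
  "gradJlocy k x y = grad (\<lambda>y'. Jloc k x y') y"

definition gradJx :: "'x \<Rightarrow> 'y \<Rightarrow> 'x" where
  "gradJx x y = grad (\<lambda>x'. J x' y) x"

definition gradJy :: "'x \<Rightarrow> 'y \<Rightarrow> 'y" where
  "gradJy x y = grad (\<lambda>y'. J x y') y"

text \<open>The uniform distribution over the local data set (repeated data count repeatedly).\<close>

definition local_law :: "nat \<Rightarrow> 'z pmf" where
  "local_law k = map_pmf (\<zeta> k) (pmf_of_set {..<N})"

definition differentiable_losses :: bool where
  "differentiable_losses \<longleftrightarrow>
     (\<forall>k<K. \<forall>s<N. \<forall>x y.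
        (\<lambda>x'. Q k x' y (\<zeta> k s)) differentiable (at x) \<and>
        (\<lambda>y'. Q k x y' (\<zeta> k s)) differentiable (at y))"

definition PL_condition :: "real \<Rightarrow> bool" where
  "PL_condition \<nu> \<longleftrightarrow>
     0 < \<nu> \<and> (\<forall>x. \<exists>y. \<forall>y'. J x y' \<le> J x y) \<and>
     (\<forall>x y. (norm (gradJy x y))\<^sup>2 \<ge> 2 * \<nu> * (P x - J x y)) \<and>
     bdd_below (range P)"

definition mean_square_smooth :: "real \<Rightarrow> bool" where
  "mean_square_smooth Lf \<longleftrightarrow>
     (\<forall>k<K. \<forall>x1 x2 y1 y2.
        measure_pmf.expectation (local_law k)
          (\<lambda>z. (norm (gradQx k x1 y1 z - gradQx k x2 y2 z))\<^sup>2)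
          \<le> Lf\<^sup>2 * ((norm (x1 - x2))\<^sup>2 + (norm (y1 - y2))\<^sup>2) \<and>
        measure_pmf.expectation (local_law k)
          (\<lambda>z. (norm (gradQy k x1 y1 z - gradQy k x2 y2 z))\<^sup>2)
          \<le> Lf\<^sup>2 * ((norm (x1 - x2))\<^sup>2 + (norm (y1 - y2))\<^sup>2))"

end

text \<open>
  A run of the algorithm on a probability space \<open>M\<close>.  \<open>X i k \<omega>\<close> and \<open>Y i k \<omega>\<close> are the
  primal blocks of agent \<open>k\<close>, \<open>U\<close> and \<open>V\<close> the dual blocks, \<open>gx\<close> and \<open>gy\<close> the gradient
  estimates.  The common starting point may be random.  There are at least two agents, as
  otherwise \<open>W\<close> has no eigenvalue other than \<open>1\<close>.  The full-batch branch of the estimator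
  uses all \<open>N\<close> local samples, and the parameter \<open>\<beta>\<close> of the estimator is zero.

  A fresh sample is independent of the past and distributed according to \<open>local_law k\<close>, so that
  its conditional expectations given the past are expectations under \<open>local_law k\<close> with the
  iterate held fixed.  Unbiasedness of the sample gradients is thus automatic, and
  \<open>variance_bound\<close> bounds their conditional variance at the current iterate.
\<close>

locale page_atc_gt =
  minimax_problem K N Q \<zeta> + prob_space M
  for K N :: nat
    and Q :: "nat \<Rightarrow> 'x::euclidean_space \<Rightarrow> 'y::euclidean_space \<Rightarrow> 'z \<Rightarrow> real"
    and \<zeta> :: "nat \<Rightarrow> nat \<Rightarrow> 'z"
    and M :: "'w measure" +
  fixes W :: "real mat" and lam Lf \<nu> \<sigma> :: real
    and b0 b :: nat and p \<mu>x \<mu>y :: real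
    and x0 u0 :: "'w \<Rightarrow> 'x" and y0 v0 :: "'w \<Rightarrow> 'y"
    and \<xi> :: "nat \<Rightarrow> nat \<Rightarrow> nat \<Rightarrow> 'w \<Rightarrow> 'z" and \<pi> :: "nat \<Rightarrow> 'w \<Rightarrow> bool"
    and X U gx :: "nat \<Rightarrow> nat \<Rightarrow> 'w \<Rightarrow> 'x" and Y V gy :: "nat \<Rightarrow> nat \<Rightarrow> 'w \<Rightarrow> 'y"
  assumes agents: "2 \<le> K"
    and data: "1 \<le> N"
    and W_dim: "W \<in> carrier_mat K K"
    and W_symmetric: "transpose_mat W = W"
    and W_stochastic: "doubly_stochastic K W"
    and W_primitive: "primitive_mat K W"
    and W_psd: "pos_semidef_mat K W"
    and lambda: "lam = Max {e. eigenvalue W e \<and> e \<noteq> 1}"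
    and differentiable: "differentiable_losses"
    and PL: "PL_condition \<nu>"
    and smooth: "mean_square_smooth Lf"
    and batch_init: "rounded b0 (sqrt (real N / real K))"
    and batch: "rounded b (sqrt (real N / real K))"
    and prob_reset: "p = 1 / sqrt (real K * real N)"
    and init_measurable: "(\<lambda>\<omega>. (x0 \<omega>, y0 \<omega>, u0 \<omega>, v0 \<omega>)) \<in> borel_measurable M"
    and coin_measurable: "\<And>i. 1 \<le> i \<Longrightarrow> \<pi> i \<in> M \<rightarrow>\<^sub>M count_space UNIV"
    and coin_law: "\<And>i. 1 \<le> i \<Longrightarrow> distr M (count_space UNIV) (\<pi> i) = measure_pmf (bernoulli_pmf p)"
    and sample_measurable: "\<And>i k j. k < K \<Longrightarrow> j < (if i = 0 then b0 else b) \<Longrightarrow>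
          \<xi> i k j \<in> M \<rightarrow>\<^sub>M count_space UNIV"
    and sample_range: "\<And>i k j \<omega>. k < K \<Longrightarrow> j < (if i = 0 then b0 else b) \<Longrightarrow> \<omega> \<in> space M \<Longrightarrow>
          \<xi> i k j \<omega> \<in> \<zeta> k ` {..<N}"
    and sample_law: "\<And>i k j. k < K \<Longrightarrow> j < (if i = 0 then b0 else b) \<Longrightarrow>
          distr M (count_space UNIV) (\<xi> i k j) = measure_pmf (local_law k)"
    and independent: "indep_sets
          (\<lambda>r. case r of
               Init \<Rightarrow> sets (vimage_algebra (space M) (\<lambda>\<omega>. (x0 \<omega>, y0 \<omega>, u0 \<omega>, v0 \<omega>)) borel)
             | Coin i \<Rightarrow> sets (vimage_algebra (space M) (\<pi> i) (count_space UNIV))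
             | Sample i k j \<Rightarrow> sets (vimage_algebra (space M) (\<xi> i k j) (count_space UNIV)))
          ({Init} \<union> {Coin i | i. 1 \<le> i} \<union>
           {Sample i k j | i k j. k < K \<and> j < (if i = 0 then b0 else b)})"
    and start: "\<And>k \<omega>. k < K \<Longrightarrow> \<omega> \<in> space M \<Longrightarrow>
          X 0 k \<omega> = x0 \<omega> \<and> Y 0 k \<omega> = y0 \<omega> \<and> U 0 k \<omega> = u0 \<omega> \<and> V 0 k \<omega> = v0 \<omega>"
    and dama_x: "\<And>\<omega>. \<omega> \<in> space M \<Longrightarrow>
          dama_recursion K (atc_gt_A W) (atc_gt_B W) atc_gt_C (- \<mu>x)
            (\<lambda>i k. X i k \<omega>) (\<lambda>i k. gx i k \<omega>) (\<lambda>i k. U i k \<omega>)"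
    and dama_y: "\<And>\<omega>. \<omega> \<in> space M \<Longrightarrow>
          dama_recursion K (atc_gt_A W) (atc_gt_B W) atc_gt_C \<mu>y
            (\<lambda>i k. Y i k \<omega>) (\<lambda>i k. gy i k \<omega>) (\<lambda>i k. V i k \<omega>)"
    and page_x: "\<And>\<omega>. \<omega> \<in> space M \<Longrightarrow>
          grace_recursion K b0 b 0 gradJlocx gradQx (\<lambda>i k j. \<xi> i k j \<omega>) (\<lambda>i. \<pi> i \<omega>)
            (\<lambda>i k. X i k \<omega>) (\<lambda>i k. Y i k \<omega>) (\<lambda>i k. gx i k \<omega>)"
    and page_y: "\<And>\<omega>. \<omega> \<in> space M \<Longrightarrow>
          grace_recursion K b0 b 0 gradJlocy gradQy (\<lambda>i k j. \<xi> i k j \<omega>) (\<lambda>i. \<pi> i \<omega>)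
            (\<lambda>i k. X i k \<omega>) (\<lambda>i k. Y i k \<omega>) (\<lambda>i k. gy i k \<omega>)"
    and noise_level: "0 \<le> \<sigma>"
    and variance_bound: "\<And>i k. k < K \<Longrightarrow> AE \<omega> in M.
          measure_pmf.expectation (local_law k)
            (\<lambda>z. (norm (gradQx k (X i k \<omega>) (Y i k \<omega>) z - gradJlocx k (X i k \<omega>) (Y i k \<omega>)))\<^sup>2)
            \<le> \<sigma>\<^sup>2 \<and>
          measure_pmf.expectation (local_law k)
            (\<lambda>z. (norm (gradQy k (X i k \<omega>) (Y i k \<omega>) z - gradJlocy k (X i k \<omega>) (Y i k \<omega>)))\<^sup>2)
            \<le> \<sigma>\<^sup>2"
begin

definition xc :: "nat \<Rightarrow> 'w \<Rightarrow> 'x" where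
  "xc i \<omega> = (1 / real K) *\<^sub>R (\<Sum>k<K. X i k \<omega>)"

definition yc :: "nat \<Rightarrow> 'w \<Rightarrow> 'y" where
  "yc i \<omega> = (1 / real K) *\<^sub>R (\<Sum>k<K. Y i k \<omega>)"

definition Gp0 :: "'w \<Rightarrow> real" where
  "Gp0 \<omega> = P (xc 0 \<omega>) - Pstar"

definition Deltac0 :: "'w \<Rightarrow> real" where
  "Deltac0 \<omega> = P (xc 0 \<omega>) - J (xc 0 \<omega>) (yc 0 \<omega>)"

definition devx0 :: "'w \<Rightarrow> real" where
  "devx0 \<omega> = stack_norm_sq K (\<lambda>k. atc_gt_A W (\<lambda>l. gx 0 l \<omega>) k
                                     - kron_id (averaging_mat K) (\<lambda>l. gx 0 l \<omega>) k)"

definition devy0 :: "'w \<Rightarrow> real" where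
  "devy0 \<omega> = stack_norm_sq K (\<lambda>k. atc_gt_A W (\<lambda>l. gy 0 l \<omega>) k
                                     - kron_id (averaging_mat K) (\<lambda>l. gy 0 l \<omega>) k)"

definition zeta0_sq :: real where
  "zeta0_sq = (1 / real K) * expectation devx0 + (1 / real K) * expectation devy0"

text \<open>
  The right-hand side of the bound involves these four expectations, which are finite when the
  starting point is deterministic.
\<close>

definition finite_initial_quantities :: bool where
  "finite_initial_quantities \<longleftrightarrow>
     integrable M Gp0 \<and> integrable M Deltac0 \<and> integrable M devx0 \<and> integrable M devy0"

definition square_integrable_gradients :: bool where
  "square_integrable_gradients \<longleftrightarrow>
     (\<forall>i. integrable M (\<lambda>\<omega>. (norm (gradJx (xc i \<omega>) (yc i \<omega>)))\<^sup>2) \<and>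
          integrable M (\<lambda>\<omega>. (norm (gradJy (xc i \<omega>) (yc i \<omega>)))\<^sup>2))"

definition stationarity_average :: "nat \<Rightarrow> real" where
  "stationarity_average T =
     (1 / real T) * (\<Sum>i<T. expectation (\<lambda>\<omega>. (norm (gradJx (xc i \<omega>) (yc i \<omega>)))\<^sup>2)
                           + expectation (\<lambda>\<omega>. (norm (gradJy (xc i \<omega>) (yc i \<omega>)))\<^sup>2))"

text \<open>Samples drawn by one agent for the initial estimate and in \<open>T\<close> rounds;
  the expectation is \<open>T (1 - p) b + T p N + b0\<close>.\<close>

definition samples_used :: "nat \<Rightarrow> 'w \<Rightarrow> nat" where
  "samples_used T \<omega> = b0 + (\<Sum>i=1..T. if \<pi> i \<omega> then N else b)"

definition sample_complexity :: "nat \<Rightarrow> real" where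
  "sample_complexity T = expectation (\<lambda>\<omega>. real (samples_used T \<omega>))"

end

end

(*
  With Phi = (P - inf P) + (P - J) at the centroid, one round of the algorithm decreases Phi by a
  multiple of mu_x |g_x|^2 + mu_y |g_y|^2, up to the squared error E of the averaged gradient
  estimate.  That P is smooth is only needed as an upper bound, which follows from the
  Polyak-Lojasiewicz inequality at a maximiser.  E consists of a consensus error and a sampling
  error.  The sampling error is a martingale that is killed by each reset, so p times its summed
  second moment is at most its initial value plus the summed increments, which are Lipschitz in
  the displacement of the iterates.  The consensus error is driven by Z = X(i+1) - W X(i), for
  which the ATC-GT recursion becomes a cascade of two contractions with factor lambda; its gain
  from gradient increments is mu^2 / (1 - lambda)^4, a small constant for mu of order
  (1 - lambda)^2.  All feedback terms are then absorbed.

  The pair (x, y) is treated as one variable in the product space.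
*)
theory Submission
  imports Defs
begin

section \<open>Gradients and the Polyak--Lojasiewicz inequality\<close>

text \<open>Two balances of parameters carry the proof. (1) \<open>P\<close> is smooth from above
  with a constant of order L \<kappa>, and x follows the gradient at y instead of at a maximiser, an
  error of order \<mu>x L \<kappa> (P - J). With \<mu>y = 256 \<kappa>^2 \<mu>x it is a small
  fraction of the amount \<mu>y \<nu> (P - J) by which the y-step shrinks the gap. (2) Up to
  rounding, K b p = 1. The error of the averaged estimator is fed with variance of order 1 / (K b)
  and survives about 1 / p rounds, so its total is controlled by the displacement with a constant
  free of K and N. The error of a single agent lacks the gain 1 / K, but it reaches the consensus
  error only when a reset makes the estimator jump, hence with weight p. Only four initial
  quantities are given as integrable, so square integrability of the whole run is an induction of
  its own. Conditional expectations are avoided: the local data sets are finite, so a fresh sample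
  is expanded over its values and independence is applied to each term.\<close>

lemma grad_eqI:
  assumes "GDERIV f x :> D"
  shows "grad f x = D"
  unfolding grad_def
proof (rule the_equality)
  show "GDERIV f x :> D" by fact
  fix D' assume "GDERIV f x :> D'"
  with assms have "(\<lambda>h. h \<bullet> D') = (\<lambda>h. h \<bullet> D)"
    unfolding gderiv_def by (metis has_derivative_unique)
  then have "h \<bullet> D' = h \<bullet> D" for h by metis
  then show "D' = D" using vector_eq_ldot by blast
qed

text \<open>Riesz representation, with the representing vector written in the orthonormal
  basis.\<close>

lemma differentiable_imp_GDERIV_grad:
  fixes f :: "'v::euclidean_space \<Rightarrow> real"
  assumes "f differentiable (at x)"
  shows "GDERIV f x :> grad f x"
proof -
  obtain f' where f': "(f has_derivative f') (at x)"
    using assms unfolding differentiable_def by auto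
  interpret f': bounded_linear f' by (rule has_derivative_bounded_linear[OF f'])
  have "f' h = h \<bullet> (\<Sum>b\<in>Basis. f' b *\<^sub>R b)" for h
  proof -
    have "f' h = f' (\<Sum>b\<in>Basis. (h \<bullet> b) *\<^sub>R b)" by (simp add: euclidean_representation)
    also have "\<dots> = (\<Sum>b\<in>Basis. (h \<bullet> b) * f' b)" by (simp add: f'.sum f'.scaleR)
    also have "\<dots> = h \<bullet> (\<Sum>b\<in>Basis. f' b *\<^sub>R b)"
      by (simp add: inner_sum_right mult.commute)
    finally show ?thesis .
  qed
  then have "f' = (\<lambda>h. h \<bullet> (\<Sum>b\<in>Basis. f' b *\<^sub>R b))" by (rule ext)
  then have "GDERIV f x :> (\<Sum>b\<in>Basis. f' b *\<^sub>R b)" using f' unfolding gderiv_def by simp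
  then show ?thesis using grad_eqI by fastforce
qed

lemma GDERIV_sum:
  assumes "\<And>s. s \<in> S \<Longrightarrow> GDERIV (f s) x :> D s"
  shows "GDERIV (\<lambda>x. \<Sum>s\<in>S. f s x) x :> (\<Sum>s\<in>S. D s)"
  using has_derivative_sum[of S f "\<lambda>s h. h \<bullet> D s" "at x"] assms
  by (simp add: gderiv_def inner_sum_right)

lemma GDERIV_cmult:
  assumes "GDERIV f x :> D"
  shows "GDERIV (\<lambda>x. c * f x) x :> c *\<^sub>R D"
  using has_derivative_mult_right[of f "\<lambda>h. h \<bullet> D" "at x" c] assms
  by (simp add: gderiv_def)

lemma GDERIV_along_line:
  assumes "GDERIV f (x + t *\<^sub>R v) :> D"
  shows "((\<lambda>t. f (x + t *\<^sub>R v)) has_real_derivative (v \<bullet> D)) (at t)"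
proof -
  have "((\<lambda>t. x + t *\<^sub>R v) has_derivative (\<lambda>h. h *\<^sub>R v)) (at t)"
    by (auto intro!: derivative_eq_intros)
  moreover have "(f has_derivative (\<lambda>h. h \<bullet> D)) (at (x + t *\<^sub>R v))"
    using assms by (simp add: gderiv_def)
  ultimately have "((\<lambda>t. f (x + t *\<^sub>R v)) has_derivative (\<lambda>h. (h *\<^sub>R v) \<bullet> D)) (at t)"
    by (rule has_derivative_compose)
  then show ?thesis
    by (rule has_derivative_imp_has_field_derivative) simp
qed

text \<open>The mean value theorem along the segment, at one intermediate point; this gives the
  constant L in place of the sharp L / 2.\<close>

lemma lipschitz_grad_quadratic_bound:
  fixes f :: "'v::real_inner \<Rightarrow> real"
  assumes g: "\<And>z. GDERIV f z :> g z"
    and lip: "\<And>z w. norm (g z - g w) \<le> L * norm (z - w)"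
  shows "\<bar>f (x + v) - f x - g x \<bullet> v\<bar> \<le> L * (norm v)\<^sup>2"
proof -
  have "\<exists>t>0. t < 1 \<and> f (x + 1 *\<^sub>R v) - f (x + 0 *\<^sub>R v) = (1 - 0) * (v \<bullet> g (x + t *\<^sub>R v))"
    by (rule MVT2) (auto intro: GDERIV_along_line g)
  then obtain t where
    t: "0 < t" "t < 1" "f (x + v) - f x = v \<bullet> g (x + t *\<^sub>R v)" by auto
  have L: "0 \<le> L * norm v"
    using lip[of "x + v" x] norm_ge_zero[of "g (x + v) - g x"] by (simp del: norm_ge_zero)
  have "\<bar>f (x + v) - f x - g x \<bullet> v\<bar> = \<bar>v \<bullet> (g (x + t *\<^sub>R v) - g x)\<bar>"
    by (simp add: t(3) inner_diff_right inner_commute)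
  also have "\<dots> \<le> norm v * norm (g (x + t *\<^sub>R v) - g x)" by (rule Cauchy_Schwarz_ineq2)
  also have "\<dots> \<le> norm v * (L * norm (t *\<^sub>R v))"
    using lip[of "x + t *\<^sub>R v" x] by (intro mult_left_mono) auto
  also have "\<dots> = t * ((L * norm v) * norm v)" using t by simp
  also have "\<dots> \<le> 1 * ((L * norm v) * norm v)"
    using t L by (intro mult_right_mono) auto
  finally show ?thesis by (simp add: power2_eq_square mult.assoc)
qed

text \<open>
  Minimise \<open>sqrt f + c dist(y, -)\<close> with \<open>c\<close> below the lower bound \<open>sqrt (\<nu> / 2)\<close> that the
  Polyak--Lojasiewicz inequality gives for the slope of \<open>sqrt f\<close>: the minimiser is a zero of \<open>f\<close>.
\<close>
lemma PL_imp_quadratic_growth: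
  fixes f :: "'v::euclidean_space \<Rightarrow> real"
  assumes g: "\<And>z. GDERIV f z :> g z"
    and nonneg: "\<And>z. 0 \<le> f z"
    and PL: "\<And>z. 2 * \<nu> * f z \<le> (norm (g z))\<^sup>2"
    and \<nu>: "0 < \<nu>"
  obtains z where "f z = 0" "(norm (y - z))\<^sup>2 \<le> 4 * f y / \<nu>"
proof -
  \<comment> \<open>This choice is strictly below sqrt (\<nu> / 2), and 4 c^2 = \<nu> is the source
    of the factor 4 in the conclusion.\<close>
  define c where "c = sqrt \<nu> / 2"
  have c: "0 < c" "4 * c\<^sup>2 = \<nu>" using \<nu> by (auto simp: c_def power_divide)
  define \<phi> where "\<phi> z = sqrt (f z) + c * norm (z - y)" for z
  have contf: "isCont f z" for z
    using g[of z] unfolding gderiv_def by (rule has_derivative_continuous)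
  have cont: "continuous_on S \<phi>" for S
    unfolding \<phi>_def by (intro continuous_intros continuous_at_imp_continuous_on ballI contf)
  \<comment> \<open>Outside this ball the distance term alone is at least \<open>\<phi> y\<close>,
    so a minimiser on the compact ball is a global one.\<close>
  define R where "R = sqrt (f y) / c"
  have R: "0 \<le> R" using c nonneg by (simp add: R_def)
  obtain z where z: "\<And>w. w \<in> cball y R \<Longrightarrow> \<phi> z \<le> \<phi> w"
    using continuous_attains_inf[OF compact_cball[of y R] _ cont] R by fastforce
  have min: "\<phi> z \<le> \<phi> w" for w
  proof (cases "w \<in> cball y R")
    case False
    then have "R \<le> norm (w - y)" by (simp add: dist_norm norm_minus_commute)
    then have "sqrt (f y) \<le> c * norm (w - y)"
      using c by (simp add: R_def divide_le_eq mult.commute)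
    then have "\<phi> y \<le> \<phi> w" using nonneg[of w] by (simp add: \<phi>_def add_increasing)
    then show ?thesis using z[of y] R by simp
  qed (use z in auto)
  \<comment> \<open>Where \<open>f\<close> is positive, \<open>sqrt f\<close> falls along the
    negative gradient at a rate a / (2 sqrt f) per unit length. This exceeds c, so a short step
    would lower \<open>\<phi>\<close>.\<close>
  have fz: "f z = 0"
  proof (rule ccontr)
    assume "f z \<noteq> 0"
    then have pos: "0 < f z" using nonneg[of z] by simp
    define a where "a = norm (g z)"
    have a2: "2 * \<nu> * f z \<le> a\<^sup>2" using PL by (simp add: a_def)
    then have "0 < a\<^sup>2" using pos \<nu> by (smt (verit) mult_pos_pos)
    then have a: "0 < a" by (auto simp: a_def)
    define h where "h t = sqrt (f (z + t *\<^sub>R (- g z))) + c * a * t" for t :: real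
    have "((\<lambda>t. f (z + t *\<^sub>R (- g z))) has_real_derivative ((- g z) \<bullet> g z)) (at 0)"
      by (rule GDERIV_along_line) (simp add: g)
    moreover have "(sqrt has_real_derivative (inverse (sqrt (f z)) / 2))
        (at (f (z + 0 *\<^sub>R (- g z))))" using DERIV_real_sqrt[OF pos] by simp
    ultimately have "((\<lambda>t. sqrt (f (z + t *\<^sub>R (- g z)))) has_real_derivative
        (inverse (sqrt (f z)) / 2 * ((- g z) \<bullet> g z))) (at 0)"
      by (rule DERIV_chain2[rotated])
    then have "((\<lambda>t. sqrt (f (z + t *\<^sub>R (- g z)))) has_real_derivative
        (inverse (sqrt (f z)) / 2 * (- a\<^sup>2))) (at 0)"
      by (simp add: a_def power2_norm_eq_inner)
    then have dh: "(h has_real_derivative (inverse (sqrt (f z)) / 2 * (- a\<^sup>2) + c * a)) (at 0)"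
      unfolding h_def by (rule DERIV_add) (auto intro!: derivative_eq_intros)
    have "inverse (sqrt (f z)) / 2 * (- a\<^sup>2) + c * a < 0"
    proof -
      have "(2 * c * sqrt (f z))\<^sup>2 = \<nu> * f z" using c nonneg by (simp add: power_mult_distrib)
      also have "\<dots> < a\<^sup>2" using a2 mult_pos_pos[OF \<nu> pos] by linarith
      finally have "2 * c * sqrt (f z) < a" using a by (simp add: power2_less_imp_less)
      then show ?thesis using a pos
        by (simp add: field_simps power2_eq_square)
    qed
    from DERIV_neg_dec_right[OF dh this] obtain d where d: "0 < d"
      "\<And>t. 0 < t \<Longrightarrow> t < d \<Longrightarrow> h t < h 0" by auto
    define t where "t = d / 2"
    have t: "0 < t" "t < d" using d by (auto simp: t_def)
    have "norm (z + t *\<^sub>R (- g z) - y) \<le> norm (z - y) + t * a"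
      using norm_triangle_ineq[of "z - y" "t *\<^sub>R (- g z)"] t by (simp add: a_def algebra_simps)
    then have "c * norm (z + t *\<^sub>R (- g z) - y) \<le> c * (norm (z - y) + t * a)"
      using c by (intro mult_left_mono) auto
    then have "c * norm (z + t *\<^sub>R (- g z) - y) \<le> c * norm (z - y) + c * a * t"
      by (simp add: algebra_simps)
    with min[of "z + t *\<^sub>R (- g z)"] d(2)[OF t] show False
      by (simp add: \<phi>_def h_def)
  qed
  \<comment> \<open>The minimum is compared with the value at \<open>y\<close>, where the distance
    term vanishes.\<close>
  have "c * norm (z - y) \<le> sqrt (f y)" using min[of y] fz by (simp add: \<phi>_def)
  then have "(c * norm (z - y))\<^sup>2 \<le> f y"
    using c nonneg[of y] by (metis mult_nonneg_nonneg less_imp_le norm_ge_zero power_mono real_sqrt_pow2)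
  then have "\<nu> * (norm (y - z))\<^sup>2 \<le> 4 * f y"
    by (simp add: c(2)[symmetric] power_mult_distrib norm_minus_commute)
  then show thesis using that[OF fz] \<nu> by (simp add: field_simps)
qed

section \<open>Elementary inequalities for squared norms\<close>

lemma norm_sum_sq_le:
  fixes f :: "'i \<Rightarrow> 'v::real_normed_vector"
  assumes "finite S"
  shows "(norm (\<Sum>s\<in>S. f s))\<^sup>2 \<le> real (card S) * (\<Sum>s\<in>S. (norm (f s))\<^sup>2)"
proof -
  have "(norm (\<Sum>s\<in>S. f s))\<^sup>2 \<le> (\<Sum>s\<in>S. norm (f s))\<^sup>2"
    by (intro power_mono norm_sum) auto
  also have "\<dots> = (\<Sum>s\<in>S. 1 * norm (f s))\<^sup>2" by simp
  also have "\<dots> \<le> (\<Sum>s\<in>S. 1\<^sup>2) * (\<Sum>s\<in>S. (norm (f s))\<^sup>2)" by (rule Cauchy_Schwarz_ineq_sum)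
  finally show ?thesis by simp
qed

lemma norm_average_sq_le:
  fixes f :: "nat \<Rightarrow> 'v::real_normed_vector"
  shows "(norm ((1 / real n) *\<^sub>R (\<Sum>s<n. f s)))\<^sup>2 \<le> (1 / real n) * (\<Sum>s<n. (norm (f s))\<^sup>2)"
proof (cases "n = 0")
  case False
  have "(norm ((1 / real n) *\<^sub>R (\<Sum>s<n. f s)))\<^sup>2 = (1 / real n)\<^sup>2 * (norm (\<Sum>s<n. f s))\<^sup>2"
    by (simp add: power_mult_distrib power_divide)
  also have "\<dots> \<le> (1 / real n)\<^sup>2 * (real n * (\<Sum>s<n. (norm (f s))\<^sup>2))"
    using norm_sum_sq_le[of "{..<n}" f] by (intro mult_left_mono) auto
  also have "\<dots> = (1 / real n) * (\<Sum>s<n. (norm (f s))\<^sup>2)"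
    using False by (simp add: power2_eq_square)
  finally show ?thesis .
qed simp

lemma norm_add_sq_le:
  fixes a b :: "'v::real_inner"
  shows "(norm (a + b))\<^sup>2 \<le> 2 * (norm a)\<^sup>2 + 2 * (norm b)\<^sup>2"
  using norm_sum_sq_le[of "{0, 1::nat}" "\<lambda>i. if i = 0 then a else b"] by simp

lemma norm_diff_sq_le:
  fixes a b :: "'v::real_inner"
  shows "(norm (a - b))\<^sup>2 \<le> 2 * (norm a)\<^sup>2 + 2 * (norm b)\<^sup>2"
  using norm_add_sq_le[of a "- b"] by simp

text \<open>Polarisation with the nonnegative square of \<open>a\<close> dropped. With
  \<open>a\<close> a true slope and \<open>b\<close> its estimate, it bounds the progress along
  \<open>b\<close> by the estimation error.\<close>

lemma minus_inner_le:
  fixes a b :: "'v::real_inner"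
  shows "- (a \<bullet> b) \<le> (norm (a - b))\<^sup>2 / 2 - (norm b)\<^sup>2 / 2"
proof -
  have "(norm (a - b))\<^sup>2 = (norm a)\<^sup>2 - 2 * (a \<bullet> b) + (norm b)\<^sup>2"
    by (simp add: power2_norm_eq_inner inner_diff_left inner_diff_right inner_commute)
  then show ?thesis using zero_le_power2[of "norm a"] by linarith
qed

section \<open>Gradients of the local and global objectives and their Lipschitz bounds\<close>

context minimax_problem
begin

lemma expectation_local_law:
  assumes "1 \<le> N"
  shows "measure_pmf.expectation (local_law k) f = (1 / real N) * (\<Sum>s<N. f (\<zeta> k s) :: real)"
proof -
  have "{..<N} \<noteq> {}" using assms by (auto simp: lessThan_empty_iff)
  then show ?thesis unfolding local_law_def
    by (simp add: integral_pmf_of_set)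
qed

lemma GDERIV_Q:
  assumes "differentiable_losses" "k < K" "s < N"
  shows "GDERIV (\<lambda>x'. Q k x' y (\<zeta> k s)) x :> gradQx k x y (\<zeta> k s)"
    and "GDERIV (\<lambda>y'. Q k x y' (\<zeta> k s)) y :> gradQy k x y (\<zeta> k s)"
  using assms unfolding differentiable_losses_def gradQx_def gradQy_def
  by (auto intro!: differentiable_imp_GDERIV_grad)

lemma GDERIV_Jloc:
  assumes "differentiable_losses" "k < K"
  shows "GDERIV (\<lambda>x'. Jloc k x' y) x :> (1 / real N) *\<^sub>R (\<Sum>s<N. gradQx k x y (\<zeta> k s))"
    and "GDERIV (\<lambda>y'. Jloc k x y') y :> (1 / real N) *\<^sub>R (\<Sum>s<N. gradQy k x y (\<zeta> k s))"
  unfolding Jloc_def using assms by (intro GDERIV_cmult GDERIV_sum GDERIV_Q; simp)+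

lemma gradJloc_eq:
  assumes "differentiable_losses" "k < K"
  shows "gradJlocx k x y = (1 / real N) *\<^sub>R (\<Sum>s<N. gradQx k x y (\<zeta> k s))"
    and "gradJlocy k x y = (1 / real N) *\<^sub>R (\<Sum>s<N. gradQy k x y (\<zeta> k s))"
  unfolding gradJlocx_def gradJlocy_def using GDERIV_Jloc[OF assms] by (auto intro!: grad_eqI)

lemma gradJ_sum:
  assumes "differentiable_losses"
  shows "GDERIV (\<lambda>x'. J x' y) x :> (1 / real K) *\<^sub>R (\<Sum>k<K. gradJlocx k x y)"
    and "GDERIV (\<lambda>y'. J x y') y :> (1 / real K) *\<^sub>R (\<Sum>k<K. gradJlocy k x y)"
  unfolding J_def using GDERIV_Jloc[OF assms] gradJloc_eq[OF assms]
  by (intro GDERIV_cmult GDERIV_sum; simp)+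

lemma gradJ_eq:
  assumes "differentiable_losses"
  shows "gradJx x y = (1 / real K) *\<^sub>R (\<Sum>k<K. gradJlocx k x y)"
    and "gradJy x y = (1 / real K) *\<^sub>R (\<Sum>k<K. gradJlocy k x y)"
  unfolding gradJx_def gradJy_def using gradJ_sum[OF assms] by (auto intro!: grad_eqI)

lemma GDERIV_J:
  assumes "differentiable_losses"
  shows "GDERIV (\<lambda>x'. J x' y) x :> gradJx x y"
    and "GDERIV (\<lambda>y'. J x y') y :> gradJy x y"
  using gradJ_sum[OF assms] gradJ_eq[OF assms] by simp_all

lemma gradQ_mean_square:
  assumes "mean_square_smooth Lf" "1 \<le> N" "k < K"
  shows "(1 / real N) * (\<Sum>s<N. (norm (gradQx k x1 y1 (\<zeta> k s) - gradQx k x2 y2 (\<zeta> k s)))\<^sup>2)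
      \<le> Lf\<^sup>2 * ((norm (x1 - x2))\<^sup>2 + (norm (y1 - y2))\<^sup>2)"
    and "(1 / real N) * (\<Sum>s<N. (norm (gradQy k x1 y1 (\<zeta> k s) - gradQy k x2 y2 (\<zeta> k s)))\<^sup>2)
      \<le> Lf\<^sup>2 * ((norm (x1 - x2))\<^sup>2 + (norm (y1 - y2))\<^sup>2)"
  using assms unfolding mean_square_smooth_def by (simp_all add: expectation_local_law)

lemma gradJloc_lipschitz:
  assumes "differentiable_losses" "mean_square_smooth Lf" "1 \<le> N" "k < K"
  shows "(norm (gradJlocx k x1 y1 - gradJlocx k x2 y2))\<^sup>2
      \<le> Lf\<^sup>2 * ((norm (x1 - x2))\<^sup>2 + (norm (y1 - y2))\<^sup>2)"
    and "(norm (gradJlocy k x1 y1 - gradJlocy k x2 y2))\<^sup>2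
      \<le> Lf\<^sup>2 * ((norm (x1 - x2))\<^sup>2 + (norm (y1 - y2))\<^sup>2)"
  using order_trans[OF norm_average_sq_le gradQ_mean_square(1)[OF assms(2-4)], of x1 y1 x2 y2]
    order_trans[OF norm_average_sq_le gradQ_mean_square(2)[OF assms(2-4)], of x1 y1 x2 y2]
  by (simp_all add: gradJloc_eq[OF assms(1,4)] sum_subtractf scaleR_diff_right)

lemma gradJ_lipschitz_sq:
  assumes "differentiable_losses" "mean_square_smooth Lf" "1 \<le> N" "1 \<le> K"
  shows "(norm (gradJx x1 y1 - gradJx x2 y2))\<^sup>2
      \<le> Lf\<^sup>2 * ((norm (x1 - x2))\<^sup>2 + (norm (y1 - y2))\<^sup>2)"
    and "(norm (gradJy x1 y1 - gradJy x2 y2))\<^sup>2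
      \<le> Lf\<^sup>2 * ((norm (x1 - x2))\<^sup>2 + (norm (y1 - y2))\<^sup>2)"
proof -
  let ?B = "Lf\<^sup>2 * ((norm (x1 - x2))\<^sup>2 + (norm (y1 - y2))\<^sup>2)"
  have avg: "(1 / real K) * (\<Sum>k<K. h k) \<le> ?B" if "\<And>k. k < K \<Longrightarrow> h k \<le> ?B" for h
  proof -
    have "(\<Sum>k<K. h k) \<le> real K * ?B"
      using sum_bounded_above[of "{..<K}" h ?B] that by simp
    then show ?thesis using assms(4) by (simp add: field_simps)
  qed
  have "(norm ((1 / real K) *\<^sub>R (\<Sum>k<K. gradJlocx k x1 y1 - gradJlocx k x2 y2)))\<^sup>2 \<le> ?B"
    by (rule order_trans[OF norm_average_sq_le avg]) (rule gradJloc_lipschitz[OF assms(1-3)])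
  then show "(norm (gradJx x1 y1 - gradJx x2 y2))\<^sup>2 \<le> ?B"
    by (simp add: gradJ_eq[OF assms(1)] sum_subtractf scaleR_diff_right)
  have "(norm ((1 / real K) *\<^sub>R (\<Sum>k<K. gradJlocy k x1 y1 - gradJlocy k x2 y2)))\<^sup>2 \<le> ?B"
    by (rule order_trans[OF norm_average_sq_le avg]) (rule gradJloc_lipschitz[OF assms(1-3)])
  then show "(norm (gradJy x1 y1 - gradJy x2 y2))\<^sup>2 \<le> ?B"
    by (simp add: gradJ_eq[OF assms(1)] sum_subtractf scaleR_diff_right)
qed

end

locale smooth_PL_problem = minimax_problem K N Q \<zeta>
  for K N :: nat
    and Q :: "nat \<Rightarrow> 'x::euclidean_space \<Rightarrow> 'y::euclidean_space \<Rightarrow> 'z \<Rightarrow> real"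
    and \<zeta> :: "nat \<Rightarrow> nat \<Rightarrow> 'z" +
  fixes L \<nu> :: real
  assumes K_pos: "1 \<le> K" and N_pos: "1 \<le> N"
    and diff: "differentiable_losses" and msmooth: "mean_square_smooth L"
    and PL_cond: "PL_condition \<nu>"
    and L_pos: "0 < L" and \<nu>_le: "\<nu> \<le> L"
begin

abbreviation \<kappa> :: real where "\<kappa> \<equiv> L / \<nu>"

lemma \<nu>_pos: "0 < \<nu>" using PL_cond by (simp add: PL_condition_def)

lemma \<kappa>_ge: "1 \<le> \<kappa>" using \<nu>_pos \<nu>_le by simp

lemma le_mult_norm:
  assumes "(norm v)\<^sup>2 \<le> L\<^sup>2 * t\<^sup>2" "0 \<le> t"
  shows "norm v \<le> L * t"
proof -
  have "(norm v)\<^sup>2 \<le> (L * t)\<^sup>2" using assms by (simp add: power_mult_distrib)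
  then show ?thesis using assms L_pos by (intro power2_le_imp_le[OF _ mult_nonneg_nonneg]) auto
qed

lemma gradJ_lipschitz:
  shows "norm (gradJx x1 y - gradJx x2 y) \<le> L * norm (x1 - x2)"
    and "norm (gradJx x y1 - gradJx x y2) \<le> L * norm (y1 - y2)"
    and "norm (gradJy x1 y - gradJy x2 y) \<le> L * norm (x1 - x2)"
    and "norm (gradJy x y1 - gradJy x y2) \<le> L * norm (y1 - y2)"
  using gradJ_lipschitz_sq(1)[OF diff msmooth N_pos K_pos, of x1 y x2 y]
    gradJ_lipschitz_sq(1)[OF diff msmooth N_pos K_pos, of x y1 x y2]
    gradJ_lipschitz_sq(2)[OF diff msmooth N_pos K_pos, of x1 y x2 y]
    gradJ_lipschitz_sq(2)[OF diff msmooth N_pos K_pos, of x y1 x y2]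
  by (auto intro!: le_mult_norm)

lemma J_quadratic_bound:
  shows "\<bar>J (x + v) y - J x y - gradJx x y \<bullet> v\<bar> \<le> L * (norm v)\<^sup>2"
    and "\<bar>J x (y + w) - J x y - gradJy x y \<bullet> w\<bar> \<le> L * (norm w)\<^sup>2"
  by (rule lipschitz_grad_quadratic_bound[OF GDERIV_J(1)[OF diff]], rule gradJ_lipschitz)
    (rule lipschitz_grad_quadratic_bound[OF GDERIV_J(2)[OF diff]], rule gradJ_lipschitz)

lemma J_le_P: "J x y \<le> P x"
proof -
  have "\<exists>y1. \<forall>y'. J x y' \<le> J x y1" using PL_cond by (simp add: PL_condition_def)
  then obtain y1 where "\<And>y'. J x y' \<le> J x y1" by blast
  then have "bdd_above (range (J x))" by (auto intro!: bdd_aboveI)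
  then show ?thesis unfolding P_def by (auto intro: cSUP_upper)
qed

lemma Pstar_le: "Pstar \<le> P x"
  using PL_cond unfolding Pstar_def PL_condition_def by (auto intro: cINF_lower)

lemma PL_ineq: "2 * \<nu> * (P x - J x y) \<le> (norm (gradJy x y))\<^sup>2"
  using PL_cond unfolding PL_condition_def by auto

text \<open>The converse of the Polyak--Lojasiewicz inequality: an ascent step of length 1 / (2 L)
  along the gradient raises \<open>J\<close> by |g|^2 / (4 L), and the result cannot exceed
  \<open>P x\<close>.\<close>

lemma gradJy_sq_le: "(norm (gradJy x y))\<^sup>2 \<le> 4 * L * (P x - J x y)"
proof -
  define g where "g = gradJy x y"
  define t where "t = 1 / (2 * L)"
  have "t * (norm g)\<^sup>2 - L * (norm (t *\<^sub>R g))\<^sup>2 = (norm g)\<^sup>2 / (4 * L)"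
    using L_pos by (simp add: t_def power_mult_distrib power2_eq_square field_simps)
  moreover have "g \<bullet> (t *\<^sub>R g) = t * (norm g)\<^sup>2" by (simp add: power2_norm_eq_inner)
  ultimately have "(norm g)\<^sup>2 / (4 * L) \<le> P x - J x y"
    using J_quadratic_bound(2)[of x y "t *\<^sub>R g"] J_le_P[of x "y + t *\<^sub>R g"]
    unfolding g_def[symmetric] by linarith
  then show ?thesis using L_pos by (simp add: g_def field_simps)
qed

text \<open>Quadratic growth applied to the gap \<open>P x - J x z\<close> as a function of
  \<open>z\<close>. The gradient vanishes at the point found because \<open>gradJy_sq_le\<close>
  bounds it by the gap.\<close>

lemma nearby_maximiser:
  obtains z where "J x z = P x" "gradJy x z = 0" "(norm (y - z))\<^sup>2 \<le> 4 * (P x - J x y) / \<nu>"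
proof -
  have "GDERIV (\<lambda>z. P x - J x z) z :> (- gradJy x z)" for z
    using GDERIV_diff[OF GDERIV_const[of "P x" z] GDERIV_J(2)[OF diff, where x = x and y = z]]
    by simp
  then obtain z where "P x - J x z = 0" "(norm (y - z))\<^sup>2 \<le> 4 * (P x - J x y) / \<nu>"
    by (rule PL_imp_quadratic_growth[where \<nu> = \<nu> and y = y]) (use J_le_P PL_ineq \<nu>_pos in auto)
  then have z: "J x z = P x" "(norm (y - z))\<^sup>2 \<le> 4 * (P x - J x y) / \<nu>" by simp_all
  have "(norm (gradJy x z))\<^sup>2 \<le> 0" using gradJy_sq_le[of x z] z(1) by simp
  with z that show thesis by simp
qed

text \<open>
  Applying the Polyak--Lojasiewicz inequality at a maximiser for \<open>x\<close> gives the one-sided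
  smoothness of \<open>P\<close> that the descent argument needs, without Danskin's theorem.
\<close>
lemma P_upper_bound:
  obtains d where "P (x + v) \<le> P x + d \<bullet> v + 2 * L * \<kappa> * (norm v)\<^sup>2"
    "(norm (d - gradJx x y))\<^sup>2 \<le> 4 * L * \<kappa> * (P x - J x y)"
proof -
  obtain z where z: "J x z = P x" "gradJy x z = 0" "(norm (y - z))\<^sup>2 \<le> 4 * (P x - J x y) / \<nu>"
    by (rule nearby_maximiser)
  \<comment> \<open>Moving x by \<open>v\<close> turns the zero gradient at the old maximiser
    \<open>z\<close> into one of norm at most L |v|; the Polyak--Lojasiewicz inequality then limits
    how far \<open>P (x + v)\<close> can lie above \<open>J (x + v) z\<close>.\<close>
  have "norm (gradJy (x + v) z) \<le> L * norm v"
    using gradJ_lipschitz(3)[of "x + v" z x] z(2) by simp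
  then have "(norm (gradJy (x + v) z))\<^sup>2 \<le> L\<^sup>2 * (norm v)\<^sup>2"
    by (metis norm_ge_zero power_mono power_mult_distrib)
  with PL_ineq[of "x + v" z] have "2 * \<nu> * (P (x + v) - J (x + v) z) \<le> L\<^sup>2 * (norm v)\<^sup>2"
    by linarith
  then have "P (x + v) - J (x + v) z \<le> L * \<kappa> / 2 * (norm v)\<^sup>2"
    using \<nu>_pos by (simp add: field_simps power2_eq_square)
  moreover have "J (x + v) z \<le> P x + gradJx x z \<bullet> v + L * (norm v)\<^sup>2"
    using J_quadratic_bound(1)[of x v z] z(1) by linarith
  moreover have "L * (norm v)\<^sup>2 \<le> L * \<kappa> * (norm v)\<^sup>2"
    using \<kappa>_ge L_pos mult_left_mono[of 1 \<kappa> L] by (intro mult_right_mono) simp_all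
  moreover have "0 \<le> L * \<kappa> * (norm v)\<^sup>2" using \<nu>_pos L_pos by simp
  ultimately have 1: "P (x + v) \<le> P x + gradJx x z \<bullet> v + 2 * L * \<kappa> * (norm v)\<^sup>2"
    by (simp add: algebra_simps)
  \<comment> \<open>The slope \<open>d\<close> is \<open>gradJx x z\<close>; its distance to the
    gradient at \<open>y\<close> is paid for by quadratic growth.\<close>
  have "(norm (gradJx x z - gradJx x y))\<^sup>2 \<le> (L * norm (y - z))\<^sup>2"
    using gradJ_lipschitz(2)[of x z y] by (simp add: norm_minus_commute power_mono)
  also have "\<dots> \<le> L\<^sup>2 * (4 * (P x - J x y) / \<nu>)"
    unfolding power_mult_distrib by (rule mult_left_mono[OF z(3)]) simp
  also have "\<dots> = 4 * L * \<kappa> * (P x - J x y)" by (simp add: power2_eq_square)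
  finally show thesis using that[OF 1] by simp
qed

end

section \<open>Decrease of the potential in one round\<close>

context smooth_PL_problem
begin

definition potential :: "'x \<Rightarrow> 'y \<Rightarrow> real" where
  "potential x y = (P x - Pstar) + (P x - J x y)"

lemma potential_nonneg: "0 \<le> potential x y"
  using J_le_P[of x y] Pstar_le[of x] by (simp add: potential_def)

text \<open>The two moves are analysed in turn: \<open>\<Delta>1\<close> is the gap after the x-step
  alone. The x-step lowers \<open>P\<close> but may widen the gap by a small multiple of a \<Delta>;
  the y-step contracts the gap by 1 - a with a = \<mu>y \<nu>, which outweighs this.\<close>

lemma descent_step:
  fixes gx :: 'x and gy :: 'y
  assumes \<mu>y: "0 < \<mu>y" "L * \<mu>y \<le> 1 / 64" and \<mu>x: "256 * \<kappa>\<^sup>2 * \<mu>x = \<mu>y"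
  shows "\<mu>x * (norm gx)\<^sup>2 + \<mu>y * (norm gy)\<^sup>2
    \<le> 8 * (potential x y - potential (x - \<mu>x *\<^sub>R gx) (y + \<mu>y *\<^sub>R gy))
      + 8 * (\<mu>x * (norm (gradJx x y - gx))\<^sup>2 + \<mu>y * (norm (gradJy x y - gy))\<^sup>2)"
proof -
  define v where "v = - \<mu>x *\<^sub>R gx"
  define x' where "x' = x + v"
  define y' where "y' = y + \<mu>y *\<^sub>R gy"
  define nx where "nx = (norm gx)\<^sup>2"
  define ny where "ny = (norm gy)\<^sup>2"
  define Ex where "Ex = (norm (gradJx x y - gx))\<^sup>2"
  define Ey where "Ey = (norm (gradJy x y - gy))\<^sup>2"
  define \<Delta> where "\<Delta> = P x - J x y"
  define \<Delta>1 where "\<Delta>1 = P x' - J x' y"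
  define \<Delta>2 where "\<Delta>2 = P x' - J x' y'"
  define G where "G = gradJy x' y"
  define a where "a = \<mu>y * \<nu>"
  have nonneg: "0 \<le> nx" "0 \<le> ny" "0 \<le> Ex" "0 \<le> Ey" "0 \<le> \<Delta>" "0 \<le> \<Delta>1"
    using J_le_P by (auto simp: nx_def ny_def Ex_def Ey_def \<Delta>_def \<Delta>1_def)
  have "0 < 256 * \<kappa>\<^sup>2 * \<mu>x" using \<mu>x \<mu>y by simp
  moreover have "0 < 256 * \<kappa>\<^sup>2" using one_le_power[OF \<kappa>_ge, of 2] by linarith
  ultimately have \<mu>x_pos: "0 < \<mu>x" by (rule zero_less_mult_pos)
  have pos_x: "0 \<le> \<mu>x * nx" and pos_y: "0 \<le> \<mu>y * ny" using \<mu>x_pos \<mu>y nonneg by simp_all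
  have \<kappa>2: "\<kappa> \<le> \<kappa>\<^sup>2" using self_le_power[of \<kappa> 2] \<kappa>_ge by simp
  have "\<kappa> * \<mu>x \<le> \<kappa>\<^sup>2 * \<mu>x" using \<kappa>2 \<mu>x_pos by (intro mult_right_mono) auto
  then have "L * (\<kappa> * \<mu>x) \<le> L * (\<kappa>\<^sup>2 * \<mu>x)" using L_pos by (intro mult_left_mono) auto
  moreover have "L * (\<kappa>\<^sup>2 * \<mu>x) = L * \<mu>y / 256" unfolding \<mu>x[symmetric] by simp
  ultimately have L\<kappa>\<mu>: "L * \<kappa> * \<mu>x \<le> 1 / 256" using \<mu>y by (simp add: mult.assoc)
  have "L * 1 * \<mu>x \<le> L * \<kappa> * \<mu>x"
    using \<kappa>_ge L_pos \<mu>x_pos by (intro mult_right_mono mult_left_mono) auto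
  then have L\<mu>x: "L * \<mu>x \<le> 1 / 256" using L\<kappa>\<mu> by linarith
  \<comment> \<open>The exact form of the step ratio: the tracking coefficient \<mu>x L \<kappa> is
    1/256 of the contraction rate \<open>a\<close>.\<close>
  have L\<kappa>a: "256 * (\<mu>x * (L * \<kappa>)) = a"
    unfolding a_def \<mu>x[symmetric] using \<nu>_pos by (simp add: power2_eq_square field_simps)
  have "\<nu> * \<mu>y \<le> L * \<mu>y" using \<nu>_le \<mu>y by (intro mult_right_mono) auto
  then have "a \<le> 1 / 64" using \<mu>y(2) unfolding a_def mult.commute[of \<mu>y] by linarith
  then have a: "0 < a" "a \<le> 1 / 64" using \<mu>y \<nu>_pos by (auto simp: a_def)
  have nv: "(norm v)\<^sup>2 = \<mu>x * (\<mu>x * nx)"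
    by (simp add: v_def nx_def power_mult_distrib power2_eq_square)
  have L\<kappa>v: "L * \<kappa> * (norm v)\<^sup>2 \<le> \<mu>x * nx / 256"
    using mult_right_mono[OF L\<kappa>\<mu>, of "\<mu>x * nx"] \<mu>x_pos nonneg by (simp add: nv mult.assoc)
  have Lv: "L * (norm v)\<^sup>2 \<le> \<mu>x * nx / 256"
    using mult_right_mono[OF L\<mu>x, of "\<mu>x * nx"] \<mu>x_pos nonneg by (simp add: nv mult.assoc)

  obtain d where d: "P x' \<le> P x + d \<bullet> v + 2 * L * \<kappa> * (norm v)\<^sup>2"
    "(norm (d - gradJx x y))\<^sup>2 \<le> 4 * L * \<kappa> * \<Delta>"
    unfolding x'_def \<Delta>_def by (rule P_upper_bound)
  have d1: "P x' \<le> P x + d \<bullet> v + 2 * (L * \<kappa> * (norm v)\<^sup>2)"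
    using d(1) by (simp only: mult.assoc)
  have "(norm (d - gx))\<^sup>2 \<le> 8 * (L * \<kappa> * \<Delta>) + 2 * Ex"
    using norm_add_sq_le[of "d - gradJx x y" "gradJx x y - gx"] d(2)
    by (simp add: Ex_def)
  then have "\<mu>x * - (d \<bullet> gx) \<le> \<mu>x * (4 * (L * \<kappa> * \<Delta>) + Ex - nx / 2)"
    using minus_inner_le[of d gx] \<mu>x_pos by (intro mult_left_mono) (auto simp: nx_def)
  then have "d \<bullet> v \<le> 4 * (\<mu>x * (L * \<kappa>) * \<Delta>) + \<mu>x * Ex - \<mu>x * nx / 2"
    by (simp add: v_def algebra_simps)
  moreover have "\<mu>x * (L * \<kappa>) * \<Delta> = a * \<Delta> / 256" unfolding L\<kappa>a[symmetric] by simp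
  ultimately have Pstep: "P x' \<le> P x + a * \<Delta> / 64 + \<mu>x * Ex - \<mu>x * nx * (63 / 128)"
    using d1 L\<kappa>v by linarith

  have amgm: "r * s \<le> (r\<^sup>2 + s\<^sup>2) / 2" for r s :: real
    using sum_squares_bound[of r s] by simp
  \<comment> \<open>In the gap after the x-step the linear terms of \<open>P\<close> and
    \<open>J\<close> cancel up to this difference. The weight 4 sqrt \<mu>x is chosen to leave only
    \<mu>x nx / 32 for the displacement.\<close>
  have "(d - gradJx x y) \<bullet> v \<le> norm (d - gradJx x y) * norm v" by (rule norm_cauchy_schwarz)
  also have "\<dots> = (4 * sqrt \<mu>x * norm (d - gradJx x y)) * (norm v / (4 * sqrt \<mu>x))"
    using \<mu>x_pos by simp
  also have "\<dots> \<le> ((4 * sqrt \<mu>x * norm (d - gradJx x y))\<^sup>2 + (norm v / (4 * sqrt \<mu>x))\<^sup>2) / 2"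
    by (rule amgm)
  also have "\<dots> = 8 * (\<mu>x * (norm (d - gradJx x y))\<^sup>2) + \<mu>x * nx / 32"
    using \<mu>x_pos by (simp add: power_mult_distrib power_divide nv)
  also have "\<mu>x * (norm (d - gradJx x y))\<^sup>2 \<le> \<mu>x * (4 * L * \<kappa> * \<Delta>)"
    using d(2) \<mu>x_pos by (intro mult_left_mono) auto
  also have "\<mu>x * (4 * L * \<kappa> * \<Delta>) = a * \<Delta> / 64" unfolding L\<kappa>a[symmetric] by simp
  finally have "(d - gradJx x y) \<bullet> v \<le> a * \<Delta> / 8 + \<mu>x * nx / 32"
    by (simp add: mult.commute)
  moreover have "J x' y \<ge> J x y + gradJx x y \<bullet> v - L * (norm v)\<^sup>2"
    using J_quadratic_bound(1)[of x v y] by (simp add: x'_def)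
  ultimately have \<Delta>1: "\<Delta>1 \<le> \<Delta> + a * \<Delta> / 8 + \<mu>x * nx / 16"
    using d1 L\<kappa>v Lv pos_x unfolding \<Delta>1_def \<Delta>_def inner_diff_left by linarith

  \<comment> \<open>The y-step is evaluated at the moved \<open>x'\<close>, while \<open>gy\<close>
    estimates the gradient at the old point; the mismatch costs L |v|.\<close>
  have "(norm (G - gradJy x y))\<^sup>2 \<le> (L * norm v)\<^sup>2"
    using gradJ_lipschitz(3)[of x' y x] by (intro power_mono) (auto simp: G_def x'_def)
  then have "(norm (G - gy))\<^sup>2 \<le> 2 * (L * (L * (norm v)\<^sup>2)) + 2 * Ey"
    using norm_add_sq_le[of "G - gradJy x y" "gradJy x y - gy"]
    by (simp add: Ey_def power_mult_distrib power2_eq_square[of L] mult.assoc)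
  also have "L * (L * (norm v)\<^sup>2) \<le> L * (\<mu>x * nx / 256)"
    using Lv L_pos by (intro mult_left_mono) auto
  finally have G1: "\<mu>y * (norm (G - gy))\<^sup>2 \<le> \<mu>y * (2 * (L * (\<mu>x * nx / 256)) + 2 * Ey)"
    using \<mu>y by (intro mult_left_mono) auto
  have G2: "(L * \<mu>y) * (\<mu>x * nx / 256) \<le> (1 / 64) * (\<mu>x * nx / 256)"
    using \<mu>y \<mu>x_pos nonneg by (intro mult_right_mono) auto
  have Gg: "\<mu>y * (norm (G - gy))\<^sup>2 \<le> \<mu>x * nx / 128 + 2 * (\<mu>y * Ey)"
  proof -
    have "\<mu>y * (2 * (L * (\<mu>x * nx / 256)) + 2 * Ey) = 2 * ((L * \<mu>y) * (\<mu>x * nx / 256)) + 2 * (\<mu>y * Ey)"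
      by (simp add: algebra_simps)
    with G1 G2 show ?thesis
      using pos_x by linarith
  qed
  have "J x' y' \<ge> J x' y + \<mu>y * (G \<bullet> gy) - L * (norm (\<mu>y *\<^sub>R gy))\<^sup>2"
    using J_quadratic_bound(2)[of x' y "\<mu>y *\<^sub>R gy"] by (simp add: y'_def G_def)
  moreover have "L * (norm (\<mu>y *\<^sub>R gy))\<^sup>2 \<le> \<mu>y * ny / 64"
    using mult_right_mono[OF \<mu>y(2), of "\<mu>y * ny"] \<mu>y nonneg
    by (simp add: ny_def power_mult_distrib power2_eq_square mult_ac)
  moreover have "\<mu>y * (G \<bullet> gy) = \<mu>y * (norm G)\<^sup>2 / 2 + \<mu>y * ny / 2 - \<mu>y * (norm (G - gy))\<^sup>2 / 2"
  proof -
    have Ggy: "G \<bullet> gy = ((norm G)\<^sup>2 + ny - (norm (G - gy))\<^sup>2) / 2"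
      by (simp add: ny_def power2_norm_eq_inner inner_diff_left inner_diff_right inner_commute)
    show ?thesis unfolding Ggy by (simp add: ring_distribs diff_divide_distrib add_divide_distrib)
  qed
  \<comment> \<open>Half of \<mu>y |G|^2 dominates a \<Delta>1: this is the contraction by 1 -
    a.\<close>
  moreover have "\<mu>y * (2 * \<nu> * \<Delta>1) \<le> \<mu>y * (norm G)\<^sup>2"
    using PL_ineq[of x' y] \<mu>y by (intro mult_left_mono) (auto simp: G_def \<Delta>1_def)
  ultimately have \<Delta>2: "\<Delta>2 \<le> (1 - a) * \<Delta>1 - \<mu>y * ny / 4 + \<mu>x * nx / 128 + \<mu>y * Ey"
    using Gg pos_x pos_y by (simp add: \<Delta>2_def \<Delta>1_def a_def algebra_simps)
  have "(1 - a) * \<Delta>1 \<le> (1 - a) * (\<Delta> + a * \<Delta> / 8 + \<mu>x * nx / 16)"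
    using \<Delta>1 a by (intro mult_left_mono) auto
  also have "\<dots> = \<Delta> - 7 / 8 * (a * \<Delta>) - a * (a * \<Delta>) / 8 + \<mu>x * nx / 16 - a * (\<mu>x * nx) / 16"
    by (simp add: field_simps)
  also have "\<dots> \<le> \<Delta> - 7 / 8 * (a * \<Delta>) + \<mu>x * nx / 16"
    using mult_nonneg_nonneg[OF less_imp_le[OF a(1)] mult_nonneg_nonneg[OF less_imp_le[OF a(1)] nonneg(5)]]
      mult_nonneg_nonneg[OF less_imp_le[OF a(1)] pos_x] by linarith
  finally have "\<Delta>2 \<le> \<Delta> - 7 / 8 * (a * \<Delta>) + \<mu>x * nx / 8 - \<mu>y * ny / 4 + \<mu>y * Ey"
    using \<Delta>2 pos_x by linarith
  \<comment> \<open>The gain 7/8 a \<Delta> covers the loss a \<Delta> / 64 in \<open>Pstep\<close>,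
    and the coefficients -63/128 + 1/8 of \<mu>x nx stay below -1/8.\<close>
  with Pstep have "potential x' y' \<le> potential x y + \<mu>x * Ex + \<mu>y * Ey - \<mu>x * nx / 8 - \<mu>y * ny / 8"
    using pos_x pos_y mult_nonneg_nonneg[OF less_imp_le[OF a(1)] nonneg(5)]
    unfolding potential_def \<Delta>2_def \<Delta>_def by linarith
  then show ?thesis
    by (simp add: x'_def y'_def v_def nx_def ny_def Ex_def Ey_def)
qed

text \<open>A step of length 1 / (8 L \<kappa>) against the gradient cannot bring \<open>P\<close>
  below \<open>Pstar\<close>. The bound serves to derive square integrability of the initial
  gradient from that of the initial gaps.\<close>

lemma gradJx_sq_le:
  "(norm (gradJx x y))\<^sup>2 \<le> 32 * L * \<kappa> * (P x - Pstar) + 8 * L * \<kappa> * (P x - J x y)"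
proof -
  define c where "c = L * \<kappa>"
  have c: "0 < c" using L_pos \<nu>_pos by (simp add: c_def)
  define g where "g = gradJx x y"
  define t where "t = 1 / (8 * c)"
  have t: "0 < t" using c by (simp add: t_def)
  obtain d where d: "P (x + (- t) *\<^sub>R g) \<le> P x + d \<bullet> ((- t) *\<^sub>R g) + 2 * L * \<kappa> * (norm ((- t) *\<^sub>R g))\<^sup>2"
    "(norm (d - g))\<^sup>2 \<le> 4 * L * \<kappa> * (P x - J x y)"
    unfolding g_def by (rule P_upper_bound)
  have "- (d \<bullet> g) \<le> (norm (d - g))\<^sup>2 / 2 - (norm g)\<^sup>2 / 2" by (rule minus_inner_le)
  then have "t * - (d \<bullet> g) \<le> t * (2 * c * (P x - J x y) - (norm g)\<^sup>2 / 2)"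
    using d(2) t by (intro mult_left_mono) (auto simp: c_def)
  moreover have "2 * L * \<kappa> * (norm ((- t) *\<^sub>R g))\<^sup>2 = t * ((norm g)\<^sup>2 / 4)"
  proof -
    have "2 * c * (t * t) = t / 4" using c by (simp add: t_def)
    moreover have "(norm ((- t) *\<^sub>R g))\<^sup>2 = (t * t) * (norm g)\<^sup>2"
      by (simp add: power_mult_distrib power2_eq_square)
    ultimately show ?thesis unfolding c_def by (metis mult.assoc times_divide_eq_left times_divide_eq_right)
  qed
  moreover have "Pstar \<le> P (x + (- t) *\<^sub>R g)" by (rule Pstar_le)
  ultimately have "Pstar - P x \<le> t * (2 * c * (P x - J x y) - (norm g)\<^sup>2 / 2) + t * ((norm g)\<^sup>2 / 4)"
    using d(1) by simp
  then have "t * ((norm g)\<^sup>2 / 4) \<le> (P x - Pstar) + t * (2 * c * (P x - J x y))"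
    by (simp add: algebra_simps)
  then have "32 * c * (t * ((norm g)\<^sup>2 / 4)) \<le> 32 * c * ((P x - Pstar) + t * (2 * c * (P x - J x y)))"
    using c by (intro mult_left_mono) auto
  moreover have t4: "32 * c * t = 4" using c by (simp add: t_def)
  have "32 * c * (t * ((norm g)\<^sup>2 / 4)) = (32 * c * t) * ((norm g)\<^sup>2 / 4)"
    by (simp only: mult.assoc)
  moreover have "32 * c * ((P x - Pstar) + t * (2 * c * (P x - J x y)))
      = 32 * c * (P x - Pstar) + (32 * c * t) * (2 * c * (P x - J x y))"
    by (simp only: mult.assoc distrib_left)
  ultimately have "(norm g)\<^sup>2 \<le> 32 * c * (P x - Pstar) + 8 * c * (P x - J x y)"
    unfolding t4 by linarith
  then show ?thesis by (simp add: g_def c_def mult.assoc)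
qed

end

section \<open>Mixing matrices\<close>

text \<open>The core of Cauchy--Schwarz for semidefinite forms, used for W itself and for e - W on
  zero-sum vectors.\<close>

lemma nonneg_quadratic_discriminant:
  fixes a b c :: real
  assumes "\<And>t. 0 \<le> a + 2 * b * t + c * t\<^sup>2" "0 \<le> c"
  shows "b\<^sup>2 \<le> a * c"
proof (cases "c = 0")
  case True
  have "b = 0"
  proof (rule ccontr)
    \<comment> \<open>With c = 0 the expression is affine in t, and the chosen t gives it the value
      -1.\<close>
    assume "b \<noteq> 0"
    then show False using assms(1)[of "- (a + 1) / (2 * b)"] True by simp
  qed
  then show ?thesis using True by simp
next
  case False
  then have "a + 2 * b * (- b / c) + c * (- b / c)\<^sup>2 = (a * c - b\<^sup>2) / c"
    by (simp add: power2_eq_square field_simps)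
  with assms(1)[of "- b / c"] assms(2) False show ?thesis by (simp add: zero_le_divide_iff)
qed

locale mixing_matrix =
  fixes K :: nat and W :: "real mat" and lam :: real
  assumes two_le_K: "2 \<le> K"
    and W_carrier: "W \<in> carrier_mat K K"
    and W_sym: "transpose_mat W = W"
    and W_stoch: "doubly_stochastic K W"
    and W_prim: "primitive_mat K W"
    and W_pos: "pos_semidef_mat K W"
    and lam_eq: "lam = Max {e. eigenvalue W e \<and> e \<noteq> 1}"
begin

text \<open>Vectors are functions on all naturals of which only the first K values count, as in
  \<open>kron_id\<close>; the product topology then supplies compactness.\<close>

definition mul :: "(nat \<Rightarrow> real) \<Rightarrow> nat \<Rightarrow> real" where
  "mul u k = (\<Sum>l<K. W $$ (k, l) * u l)"

definition ip :: "(nat \<Rightarrow> real) \<Rightarrow> (nat \<Rightarrow> real) \<Rightarrow> real" where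
  "ip u v = (\<Sum>k<K. u k * v k)"

lemma W_entry_sym: "k < K \<Longrightarrow> l < K \<Longrightarrow> W $$ (k, l) = W $$ (l, k)"
  using W_sym W_carrier by (metis carrier_matD index_transpose_mat(1))

lemma row_sum: "k < K \<Longrightarrow> (\<Sum>l<K. W $$ (k, l)) = 1"
  and col_sum: "l < K \<Longrightarrow> (\<Sum>k<K. W $$ (k, l)) = 1"
  using W_stoch by (auto simp: doubly_stochastic_def)

lemma sum_mul: "(\<Sum>k<K. mul u k) = (\<Sum>k<K. u k)"
proof -
  have "(\<Sum>k<K. mul u k) = (\<Sum>l<K. \<Sum>k<K. W $$ (k, l) * u l)"
    unfolding mul_def by (rule sum.swap)
  also have "\<dots> = (\<Sum>l<K. u l)" by (simp add: col_sum flip: sum_distrib_right)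
  finally show ?thesis .
qed

lemma ip_sym: "ip u v = ip v u" by (simp add: ip_def mult.commute)

lemma ip_nonneg: "0 \<le> ip u u" by (simp add: ip_def sum_nonneg)

lemma ip_mul_sym: "ip u (mul v) = ip (mul u) v"
proof -
  have "ip u (mul v) = (\<Sum>k<K. \<Sum>l<K. u k * (W $$ (k, l) * v l))"
    by (simp add: ip_def mul_def sum_distrib_left)
  also have "\<dots> = (\<Sum>l<K. \<Sum>k<K. u k * (W $$ (k, l) * v l))" by (rule sum.swap)
  also have "\<dots> = ip (mul u) v"
    by (auto simp: ip_def mul_def sum_distrib_right W_entry_sym intro!: sum.cong)
  finally show ?thesis .
qed

lemma ip_add_scaled:
  "ip (\<lambda>k. u k + t * w k) (\<lambda>k. v k + t * z k) = ip u v + t * (ip u z + ip w v) + t\<^sup>2 * ip w z"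
  by (simp add: ip_def algebra_simps sum.distrib sum_distrib_left power2_eq_square)

lemma mul_add_scaled: "mul (\<lambda>k. u k + t * w k) = (\<lambda>k. mul u k + t * mul w k)"
  by (simp add: mul_def algebra_simps sum.distrib sum_distrib_left fun_eq_iff)

lemma mult_mat_vec_index: "k < K \<Longrightarrow> (W *\<^sub>v vec K u) $ k = mul u k"
  using W_carrier by (auto simp: scalar_prod_def mul_def lessThan_atLeast0 intro!: sum.cong)

lemma mul_psd: "0 \<le> ip u (mul u)"
proof -
  have "scalar_prod (vec K u) (W *\<^sub>v vec K u) = ip u (mul u)"
    unfolding scalar_prod_def ip_def using W_carrier
    by (auto simp: lessThan_atLeast0 mult_mat_vec_index[simplified] simp del: index_mult_mat_vec
        intro!: sum.cong)
  then show ?thesis using W_pos by (auto simp: pos_semidef_mat_def dest: bspec[of _ _ "vec K u"])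
qed

lemma mul_cauchy_schwarz: "(ip u (mul v))\<^sup>2 \<le> ip u (mul u) * ip v (mul v)"
proof (rule nonneg_quadratic_discriminant)
  fix t
  have "0 \<le> ip (\<lambda>k. u k + t * v k) (mul (\<lambda>k. u k + t * v k))" by (rule mul_psd)
  also have "\<dots> = ip u (mul u) + 2 * ip u (mul v) * t + ip v (mul v) * t\<^sup>2"
    using ip_mul_sym[of v u] ip_sym[of "mul v" u] by (simp add: mul_add_scaled ip_add_scaled)
  finally show "0 \<le> ip u (mul u) + 2 * ip u (mul v) * t + ip v (mul v) * t\<^sup>2" .
qed (rule mul_psd)

text \<open>Compactness of the unit sphere among zero-sum vectors. Coordinates from K on are pinned
  to 0, so the sphere sits in a cube that is compact by Tychonoff; homogeneity extends the bound to
  all zero-sum vectors.\<close>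

lemma rayleigh_maximiser:
  obtains e v where "ip v v = 1" "(\<Sum>k<K. v k) = 0" "ip v (mul v) = e"
    "\<And>u. (\<Sum>k<K. u k) = 0 \<Longrightarrow> ip u (mul u) \<le> e * ip u u"
proof -
  define C where "C = PiE UNIV (\<lambda>k. if k < K then {-1..1::real} else {0})"
  define S where "S = C \<inter> {u. (\<Sum>k<K. u k) = 0} \<inter> {u. ip u u = 1}"
  have coord: "continuous_on UNIV (\<lambda>u::nat \<Rightarrow> real. u k)" for k
    by (rule continuous_on_product_coordinates)
  have "compactin (product_topology (\<lambda>k. euclidean) UNIV) C"
    unfolding C_def compactin_PiE by auto
  then have "compact C" by (simp add: euclidean_product_topology)
  moreover have "closed {u. (\<Sum>k<K. u k) = (0::real)}"
    by (intro closed_Collect_eq continuous_intros coord)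
  moreover have "closed {u. ip u u = 1}"
    unfolding ip_def by (intro closed_Collect_eq continuous_intros coord)
  ultimately have S: "compact S"
    unfolding S_def by (intro compact_Int_closed)
  \<comment> \<open>A unit zero-sum vector, which exists because there are at least two agents; it
    shows that the sphere is nonempty.\<close>
  define u0 where "u0 k = (if k = 0 then 1 / sqrt 2 else if k = 1 then - 1 / sqrt 2 else 0)" for k :: nat
  have K: "{..<K} = {0, 1} \<union> {2..<K}" "{0, 1} \<inter> {2..<K} = {}" using two_le_K by auto
  have "(\<Sum>k<K. u0 k) = 0" "ip u0 u0 = 1"
    unfolding ip_def K(1) by (subst sum.union_disjoint; use K in \<open>auto simp: u0_def\<close>)+
  moreover have "-1 \<le> 1 / sqrt 2" by (rule order_trans[of _ 0]) auto
  then have "u0 \<in> C" using two_le_K by (auto simp: C_def u0_def)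
  ultimately have ne: "S \<noteq> {}" by (auto simp: S_def)
  have "continuous_on S (\<lambda>u. ip u (mul u))"
    unfolding ip_def mul_def
    by (intro continuous_intros continuous_on_subset[OF coord]) auto
  from continuous_attains_sup[OF S ne this] obtain v where
    v: "v \<in> S" "\<And>u. u \<in> S \<Longrightarrow> ip u (mul u) \<le> ip v (mul v)" by auto
  have "ip u (mul u) \<le> ip v (mul v) * ip u u" if u: "(\<Sum>k<K. u k) = 0" for u
  proof (cases "ip u u = 0")
    case True
    then have "\<forall>k<K. u k = 0" by (simp add: ip_def sum_nonneg_eq_0_iff)
    then show ?thesis using True by (simp add: ip_def)
  next
    case False
    define r where "r = sqrt (ip u u)"
    have r: "0 < r" "r\<^sup>2 = ip u u" using False ip_nonneg[of u] by (auto simp: r_def)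
    define w where "w k = (if k < K then u k / r else 0)" for k
    have "(\<Sum>k<K. w k) = 0" using u by (simp add: w_def flip: sum_divide_distrib)
    moreover have w: "ip w w = 1"
    proof -
      have "ip w w = ip u u / r\<^sup>2"
        by (simp add: w_def ip_def power2_eq_square flip: sum_divide_distrib)
      then show ?thesis using r(2) False by simp
    qed
    moreover have "w \<in> C"
    proof -
      have "- 1 \<le> w k \<and> w k \<le> 1" if "k < K" for k
      proof -
        have "w k * w k \<le> ip w w" unfolding ip_def using that by (intro member_le_sum) auto
        then show ?thesis using w abs_le_square_iff[of "w k" 1] by (simp add: power2_eq_square abs_le_iff)
      qed
      then have "w k \<in> (if k < K then {-1..1} else {0})" for k by (simp add: w_def)
      then show ?thesis unfolding C_def PiE_UNIV_domain by (rule Pi_I)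
    qed
    ultimately have "ip w (mul w) \<le> ip v (mul v)" by (intro v) (simp add: S_def)
    moreover have "ip w (mul w) = ip u (mul u) / r\<^sup>2"
      using r by (simp add: w_def ip_def mul_def power2_eq_square flip: sum_divide_distrib)
    ultimately show ?thesis using False ip_nonneg[of u] by (simp add: r(2) divide_le_eq)
  qed
  with v(1) show thesis by (intro that[of v "ip v (mul v)"]) (auto simp: S_def)
qed

lemma eigenvalueI:
  assumes "\<And>k. k < K \<Longrightarrow> mul v k = e * v k" "ip v v = 1"
  shows "eigenvalue W e"
proof -
  have "W *\<^sub>v vec K v = e \<cdot>\<^sub>v vec K v"
    using W_carrier assms(1) mult_mat_vec_index by (intro eq_vecI) auto
  moreover have "vec K v \<noteq> 0\<^sub>v K"
  proof
    assume "vec K v = 0\<^sub>v K"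
    then have "\<forall>k<K. v k = 0" by (metis index_vec index_zero_vec(1))
    then show False using assms(2) by (simp add: ip_def)
  qed
  ultimately show ?thesis
    using W_carrier unfolding eigenvalue_def eigenvector_def by (intro exI[of _ "vec K v"]) auto
qed

lemma finite_eigenvalues: "finite {e. eigenvalue W e}"
proof -
  have "char_poly W \<noteq> 0" using degree_monic_char_poly[OF W_carrier] by auto
  then show ?thesis using eigenvalue_root_char_poly[OF W_carrier] poly_roots_finite by simp
qed

text \<open>A Perron--Frobenius argument: a positive power of W averages with positive weights, so a
  fixed vector equals its maximal coordinate everywhere.\<close>

lemma fixed_vector_zero:
  assumes fixed: "\<And>k. k < K \<Longrightarrow> mul v k = v k" and sum0: "(\<Sum>k<K. v k) = 0" and k: "k < K"
  shows "v k = 0"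
proof -
  obtain m where m: "\<forall>k<K. \<forall>l<K. 0 < (W ^\<^sub>m m) $$ (k, l)"
    using W_prim by (auto simp: primitive_mat_def)
  define A where "A = W ^\<^sub>m m"
  have A: "A \<in> carrier_mat K K" using W_carrier by (simp add: A_def pow_carrier_mat)
  have pow_fixed: "(W ^\<^sub>m m) *\<^sub>v vec K u = vec K u" if u: "\<And>k. k < K \<Longrightarrow> mul u k = u k" for m u
  proof (induction m)
    case (Suc m)
    have "W *\<^sub>v vec K u = vec K u"
      using W_carrier u mult_mat_vec_index by (intro eq_vecI) auto
    then show ?case using Suc W_carrier
      by (simp add: assoc_mult_mat_vec[OF pow_carrier_mat[OF W_carrier] W_carrier])
  qed (use W_carrier in auto)
  have Asum: "(\<Sum>l<K. A $$ (k, l) * u l) = u k"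
    if "\<And>k. k < K \<Longrightarrow> mul u k = u k" "k < K" for u k
  proof -
    have "(\<Sum>l<K. A $$ (k, l) * u l) = (A *\<^sub>v vec K u) $ k"
      using A that(2) by (auto simp: scalar_prod_def lessThan_atLeast0 intro!: sum.cong)
    also have "\<dots> = u k" using pow_fixed[OF that(1), of m] that(2) by (simp add: A_def)
    finally show ?thesis .
  qed
  have "finite (v ` {..<K})" "v ` {..<K} \<noteq> {}" using k by auto
  from Max_in[OF this] obtain j where j: "j < K" "v j = Max (v ` {..<K})" by auto
  have le: "v l \<le> v j" if "l < K" for l using that by (auto simp: j(2) intro!: Max_ge)
  \<comment> \<open>\<open>A\<close> fixes both \<open>v\<close> and the constant vector, so this
    weighted sum of nonnegative differences is zero, and positive weights make each difference
    zero.\<close>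
  have "(\<Sum>l<K. A $$ (j, l) * (v j - v l)) = v j * (\<Sum>l<K. A $$ (j, l) * 1) - (\<Sum>l<K. A $$ (j, l) * v l)"
    by (simp add: algebra_simps sum_subtractf sum_distrib_left)
  also have "\<dots> = 0"
    using Asum[of v j] Asum[of "\<lambda>_. 1" j] fixed j(1) by (simp add: mul_def row_sum)
  finally have "\<forall>l\<in>{..<K}. A $$ (j, l) * (v j - v l) = 0"
    using m le j(1) by (subst (asm) sum_nonneg_eq_0_iff) (auto simp: A_def less_imp_le)
  then have eq: "v l = v j" if "l < K" for l
    using m j(1) that by (force simp: A_def)
  then have "real K * v j = 0" using sum0 by simp
  then show ?thesis using eq[OF k] two_le_K by simp
qed

text \<open>The maximum \<open>e\<close> of the Rayleigh quotient over zero-sum vectors is an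
  eigenvalue, different from 1 by primitivity, hence at most \<open>lam\<close>; positive
  semidefiniteness makes it nonnegative and upgrades the bound on the form to one on the norm of W
  u.\<close>

lemma spectral_gap: "0 \<le> lam" "(\<Sum>k<K. u k) = 0 \<Longrightarrow> ip (mul u) (mul u) \<le> lam\<^sup>2 * ip u u"
proof -
  obtain e v where v: "ip v v = 1" "(\<Sum>k<K. v k) = 0" "ip v (mul v) = e"
    and e: "\<And>u. (\<Sum>k<K. u k) = 0 \<Longrightarrow> ip u (mul u) \<le> e * ip u u"
    by (rule rayleigh_maximiser) blast
  define w where "w = (\<lambda>k. mul v k + (- e) * v k)"
  have w0: "(\<Sum>k<K. w k) = 0"
    using v(2) sum_mul[of v] by (simp add: w_def sum_subtractf flip: sum_distrib_left)
  \<comment> \<open>Cauchy--Schwarz for e - W, whose form vanishes at \<open>v\<close>. It makes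
    \<open>v\<close> orthogonal to (e - W) w, and since e - W is symmetric, the residual w = W v - e
    v is orthogonal to itself.\<close>
  have "(e * ip v w - ip v (mul w))\<^sup>2 \<le> (e * ip v v - ip v (mul v)) * (e * ip w w - ip w (mul w))"
  proof (rule nonneg_quadratic_discriminant)
    fix t
    have "(\<Sum>k<K. v k + t * w k) = 0"
      using v(2) w0 by (simp add: sum.distrib flip: sum_distrib_left)
    from e[OF this] show "0 \<le> e * ip v v - ip v (mul v) + 2 * (e * ip v w - ip v (mul w)) * t
        + (e * ip w w - ip w (mul w)) * t\<^sup>2"
      using ip_mul_sym[of w v] ip_sym[of "mul w" v] ip_sym[of w v]
      by (simp add: mul_add_scaled ip_add_scaled algebra_simps)
  qed (use e[OF w0] in simp)
  then have "ip v (mul w) = e * ip v w" using v by simp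
  moreover have "ip w w = ip (mul v) w - e * ip v w"
    by (simp add: w_def ip_def algebra_simps sum_subtractf sum.distrib sum_distrib_left)
  ultimately have "ip w w = 0" by (simp add: ip_mul_sym)
  then have "\<forall>k<K. w k = 0" by (simp add: ip_def sum_nonneg_eq_0_iff)
  then have eig: "mul v k = e * v k" if "k < K" for k using that by (simp add: w_def)
  have "e \<noteq> 1"
  proof
    assume "e = 1"
    then have "\<forall>k<K. v k = 0" using fixed_vector_zero[of v] eig v(2) by simp
    then show False using v(1) by (simp add: ip_def)
  qed
  then have "e \<le> lam"
    unfolding lam_eq using eigenvalueI[OF eig v(1)] finite_eigenvalues by (intro Max_ge) auto
  moreover have e0: "0 \<le> e" using mul_psd[of v] v(3) by simp
  ultimately show lam: "0 \<le> lam" by simp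
  assume u: "(\<Sum>k<K. u k) = 0"
  define w where "w = mul u"
  have w0: "(\<Sum>k<K. w k) = 0" using u by (simp add: w_def sum_mul)
  \<comment> \<open>Cauchy--Schwarz for the form of W at \<open>u\<close> and
    \<open>w = W u\<close>, both of zero sum; one factor |w|^2 is cancelled below.\<close>
  have "(ip w w)\<^sup>2 = (ip u (mul w))\<^sup>2" by (simp add: ip_mul_sym w_def)
  also have "\<dots> \<le> ip u (mul u) * ip w (mul w)" by (rule mul_cauchy_schwarz)
  also have "\<dots> \<le> (e * ip u u) * (e * ip w w)"
    using e[OF u] e[OF w0] mul_psd e0 ip_nonneg by (intro mult_mono) auto
  finally have 1: "ip w w * ip w w \<le> (e\<^sup>2 * ip u u) * ip w w" by (simp add: power2_eq_square mult_ac)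
  have "ip w w \<le> e\<^sup>2 * ip u u"
  proof (cases "ip w w = 0")
    case False
    then show ?thesis using 1 ip_nonneg[of w] by (simp add: mult_le_cancel_right)
  qed (simp add: ip_nonneg)
  also have "\<dots> \<le> lam\<^sup>2 * ip u u"
    using \<open>e \<le> lam\<close> e0 ip_nonneg by (intro mult_right_mono power_mono) auto
  finally show "ip (mul u) (mul u) \<le> lam\<^sup>2 * ip u u" by (simp add: w_def)
qed

end

section \<open>Consensus dynamics\<close>

text \<open>Serves three recursions: the two consensus stages with q = lam and the sampling error
  with q = 1 - p.\<close>

lemma contraction_sum_bound:
  fixes a r :: "nat \<Rightarrow> real"
  assumes step: "\<And>i. i < n \<Longrightarrow> a (Suc i) \<le> q * a i + r i" and "0 \<le> q" "0 \<le> a n"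
  shows "(1 - q) * (\<Sum>i\<le>n. a i) \<le> a 0 + (\<Sum>i<n. r i)"
proof -
  \<comment> \<open>The induction keeps the last term -q a(m), to which the next recursion step is
    applied.\<close>
  have "(1 - q) * (\<Sum>i\<le>m. a i) \<le> a 0 + (\<Sum>i<m. r i) - q * a m" if "m \<le> n" for m
    using that
  proof (induction m)
    case (Suc m)
    then show ?case using step[of m] by (simp add: algebra_simps)
  qed (simp add: algebra_simps)
  from this[of n] show ?thesis using assms(2,3) mult_nonneg_nonneg[of q "a n"] by linarith
qed

definition block_avg :: "nat \<Rightarrow> (nat \<Rightarrow> 'v::real_vector) \<Rightarrow> 'v" where
  "block_avg K X = (1 / real K) *\<^sub>R (\<Sum>k<K. X k)"

definition dev :: "nat \<Rightarrow> (nat \<Rightarrow> 'v::real_vector) \<Rightarrow> nat \<Rightarrow> 'v" where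
  "dev K X k = X k - block_avg K X"

lemma block_avg_add: "block_avg K (\<lambda>k. X k + Y k) = block_avg K X + block_avg K Y"
  and block_avg_diff: "block_avg K (\<lambda>k. X k - Y k) = block_avg K X - block_avg K Y"
  by (simp_all add: block_avg_def sum.distrib sum_subtractf scaleR_add_right scaleR_diff_right
      mult.commute flip: scaleR_sum_right)

lemma block_avg_cong: "(\<And>k. k < K \<Longrightarrow> X k = Y k) \<Longrightarrow> block_avg K X = block_avg K Y"
  by (simp add: block_avg_def)

lemma block_avg_const: "0 < K \<Longrightarrow> block_avg K (\<lambda>_. x) = x"
  by (simp add: block_avg_def sum_constant_scaleR)

lemma sum_dev: "0 < K \<Longrightarrow> (\<Sum>k<K. dev K X k) = 0"
  by (simp add: dev_def sum_subtractf block_avg_def sum_constant_scaleR)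

lemma stack_norm_sq_nonneg: "0 \<le> stack_norm_sq K X"
  by (simp add: stack_norm_sq_def sum_nonneg)

lemma stack_norm_sq_cong: "(\<And>k. k < K \<Longrightarrow> X k = Y k) \<Longrightarrow> stack_norm_sq K X = stack_norm_sq K Y"
  by (simp add: stack_norm_sq_def)

text \<open>Pythagoras: deviations from the average are orthogonal to constant stacks.\<close>

lemma stack_norm_sq_dev_le:
  fixes X :: "nat \<Rightarrow> 'v::real_inner"
  shows "stack_norm_sq K (dev K X) \<le> stack_norm_sq K X"
proof (cases "K = 0")
  case False
  have "stack_norm_sq K X
      = (\<Sum>k<K. (norm (dev K X k))\<^sup>2 + 2 * (dev K X k \<bullet> block_avg K X) + (norm (block_avg K X))\<^sup>2)"
    by (simp add: stack_norm_sq_def dev_def power2_norm_eq_inner inner_diff_left inner_diff_right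
        inner_commute)
  also have "\<dots> = stack_norm_sq K (dev K X) + 2 * ((\<Sum>k<K. dev K X k) \<bullet> block_avg K X)
      + real K * (norm (block_avg K X))\<^sup>2"
    by (simp add: stack_norm_sq_def sum.distrib inner_sum_left sum_distrib_left)
  finally show ?thesis using False by (simp add: sum_dev)
qed (simp add: stack_norm_sq_def)

section \<open>Contraction of stacked vectors\<close>

context mixing_matrix
begin

lemma K_pos: "0 < K" using two_le_K by simp

lemma kron_id_W: "kron_id W X k = (\<Sum>l<K. (W $$ (k, l)) *\<^sub>R X l)"
  using W_carrier by (simp add: kron_id_def)

lemma kron_id_cong: "(\<And>l. l < K \<Longrightarrow> X l = Y l) \<Longrightarrow> kron_id W X k = kron_id W Y k"
  by (simp add: kron_id_W)

lemma kron_id_add: "kron_id W (\<lambda>l. X l + Y l) k = kron_id W X k + kron_id W Y k"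
  and kron_id_diff: "kron_id W (\<lambda>l. X l - Y l) k = kron_id W X k - kron_id W Y k"
  by (simp_all add: kron_id_W scaleR_add_right scaleR_diff_right sum.distrib sum_subtractf)

lemma kron_id_const: "k < K \<Longrightarrow> kron_id W (\<lambda>_. x) k = x"
  by (simp add: kron_id_W row_sum flip: scaleR_sum_left)

lemma block_avg_kron_id: "block_avg K (kron_id W X) = block_avg K X"
proof -
  have "(\<Sum>k<K. kron_id W X k) = (\<Sum>l<K. \<Sum>k<K. (W $$ (k, l)) *\<^sub>R X l)"
    unfolding kron_id_W by (rule sum.swap)
  also have "\<dots> = (\<Sum>l<K. X l)" by (simp add: col_sum flip: scaleR_sum_left)
  finally show ?thesis by (simp add: block_avg_def)
qed

lemma dev_kron_id: "k < K \<Longrightarrow> dev K (kron_id W X) k = kron_id W (dev K X) k"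
  by (simp add: dev_def[abs_def] block_avg_kron_id kron_id_diff kron_id_const)

lemma sum_kron_id: "(\<Sum>k<K. kron_id W X k) = (\<Sum>k<K. X k)"
  using block_avg_kron_id[of X] K_pos by (simp add: block_avg_def)

text \<open>Each coordinate of the blocks is a scalar vector over the agents, to which
  \<open>spectral_gap\<close> applies.\<close>

lemma stack_norm_sq_kron_id_le:
  fixes X :: "nat \<Rightarrow> 'v::euclidean_space"
  assumes "(\<Sum>k<K. X k) = 0"
  shows "stack_norm_sq K (kron_id W X) \<le> lam\<^sup>2 * stack_norm_sq K X"
proof -
  have coord: "stack_norm_sq K Y = (\<Sum>b\<in>Basis. ip (\<lambda>k. Y k \<bullet> b) (\<lambda>k. Y k \<bullet> b))"
    for Y :: "nat \<Rightarrow> 'v"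
    unfolding stack_norm_sq_def ip_def power2_norm_eq_inner
    by (subst euclidean_inner) (rule sum.swap)
  have mulb: "(\<lambda>k. kron_id W X k \<bullet> b) = mul (\<lambda>k. X k \<bullet> b)" for b
    by (simp add: fun_eq_iff kron_id_W mul_def inner_sum_left)
  have "(\<Sum>k<K. X k \<bullet> b) = 0" for b
    using assms by (simp flip: inner_sum_left)
  then show ?thesis
    unfolding coord mulb sum_distrib_left by (intro sum_mono spectral_gap(2))
qed

text \<open>Young's inequality with weights 1 / lam and 1 / (1 - lam), which turns the factor lam^2
  into lam. For lam = 0 the mixed term vanishes outright.\<close>

lemma stack_norm_sq_kron_id_add_le:
  fixes X Y :: "nat \<Rightarrow> 'v::euclidean_space"
  assumes X: "(\<Sum>k<K. X k) = 0" and lam: "lam < 1"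
  shows "stack_norm_sq K (\<lambda>k. kron_id W X k + Y k)
    \<le> lam * stack_norm_sq K X + stack_norm_sq K Y / (1 - lam)"
proof (cases "lam = 0")
  case True
  then have "stack_norm_sq K (kron_id W X) = 0"
    using stack_norm_sq_kron_id_le[OF X] stack_norm_sq_nonneg[of K "kron_id W X"] by simp
  then have "kron_id W X k = 0" if "k < K" for k
    using that by (simp add: stack_norm_sq_def sum_nonneg_eq_0_iff)
  then have "stack_norm_sq K (\<lambda>k. kron_id W X k + Y k) = stack_norm_sq K Y"
    by (intro stack_norm_sq_cong) simp
  with True show ?thesis by simp
next
  case False
  with spectral_gap(1) have l: "0 < lam" by simp
  have "(norm (u + v))\<^sup>2 \<le> (norm u)\<^sup>2 / lam + (norm v)\<^sup>2 / (1 - lam)" for u v :: 'v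
  proof -
    have "0 \<le> (norm ((1 - lam) *\<^sub>R u - lam *\<^sub>R v))\<^sup>2" by simp
    also have "(norm ((1 - lam) *\<^sub>R u - lam *\<^sub>R v))\<^sup>2
        = (1 - lam) * (norm u)\<^sup>2 + lam * (norm v)\<^sup>2 - lam * (1 - lam) * (norm (u + v))\<^sup>2"
      by (simp add: power2_norm_eq_inner inner_diff_left inner_diff_right inner_add_left
          inner_add_right inner_commute algebra_simps)
    finally have "lam * (1 - lam) * (norm (u + v))\<^sup>2 \<le> (1 - lam) * (norm u)\<^sup>2 + lam * (norm v)\<^sup>2"
      by simp
    then show ?thesis using l lam by (simp add: field_simps)
  qed
  then have "stack_norm_sq K (\<lambda>k. kron_id W X k + Y k)
      \<le> (\<Sum>k<K. (norm (kron_id W X k))\<^sup>2 / lam + (norm (Y k))\<^sup>2 / (1 - lam))"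
    unfolding stack_norm_sq_def by (intro sum_mono) auto
  also have "\<dots> = stack_norm_sq K (kron_id W X) / lam + stack_norm_sq K Y / (1 - lam)"
    by (simp add: stack_norm_sq_def sum.distrib sum_divide_distrib)
  also have "stack_norm_sq K (kron_id W X) / lam \<le> lam * stack_norm_sq K X"
    using stack_norm_sq_kron_id_le[OF X] l by (simp add: divide_le_eq power2_eq_square mult_ac)
  finally show ?thesis by simp
qed

end

text \<open>The signed step sizes are absorbed into \<open>G\<close>, so the step is 1; this lets a
  single instance treat the pair (x, y) although its two components move with different steps and
  signs.\<close>

locale atc_gt_dynamics = mixing_matrix +
  fixes X G D :: "nat \<Rightarrow> nat \<Rightarrow> 'v::euclidean_space" and x0 d0 :: 'v
  assumes recursion: "dama_recursion K (atc_gt_A W) (atc_gt_B W) atc_gt_C 1 X G D"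
    and init: "\<And>k. k < K \<Longrightarrow> X 0 k = x0" "\<And>k. k < K \<Longrightarrow> D 0 k = d0"
    and lam_less: "lam < 1"
begin

lemma X_Suc: "k < K \<Longrightarrow> X (Suc i) k = atc_gt_A W (\<lambda>l. X i l + G i l) k - atc_gt_B W (D i) k"
  and D_Suc: "k < K \<Longrightarrow> D (Suc i) k = D i k + atc_gt_B W (X (Suc i)) k"
  using recursion by (simp_all add: dama_recursion_def atc_gt_C_def)

text \<open>The dual term has average zero and averaging commutes with W, so the centroid follows a
  plain gradient step.\<close>

lemma block_avg_Suc: "block_avg K (X (Suc i)) = block_avg K (X i) + block_avg K (G i)"
proof -
  have "block_avg K (X (Suc i)) = block_avg K (\<lambda>k. atc_gt_A W (\<lambda>l. X i l + G i l) k - atc_gt_B W (D i) k)"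
    by (intro block_avg_cong X_Suc)
  then show ?thesis
    by (simp add: block_avg_diff atc_gt_A_def atc_gt_B_def block_avg_kron_id block_avg_add)
qed

text \<open>
  After elimination of the dual variable the primal recursion has the double characteristic
  root \<open>W\<close>.  With \<open>Z i = X (i + 1) - W X i\<close> it becomes a cascade of two first-order recursions.
\<close>
definition Z :: "nat \<Rightarrow> nat \<Rightarrow> 'v" where
  "Z i k = X (Suc i) k - kron_id W (X i) k"

definition H :: "nat \<Rightarrow> nat \<Rightarrow> 'v" where
  "H i k = G (Suc i) k - G i k"

lemma X_one: "k < K \<Longrightarrow> X 1 k = x0 + kron_id W (kron_id W (G 0)) k"
proof -
  assume k: "k < K"
  have "kron_id W (X 0) l = x0" if "l < K" for l
    using kron_id_cong[of "X 0" "\<lambda>_. x0" l] init(1) kron_id_const[OF that] by simp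
  then have "kron_id W (kron_id W (X 0)) k = x0"
    using kron_id_cong[of "kron_id W (X 0)" "\<lambda>_. x0" k] kron_id_const[OF k] by simp
  moreover have "kron_id W (D 0) k = d0"
    using kron_id_cong[of "D 0" "\<lambda>_. d0" k] init(2) kron_id_const[OF k] by simp
  moreover have "kron_id W (kron_id W (\<lambda>l. X 0 l + G 0 l)) k
      = kron_id W (kron_id W (X 0)) k + kron_id W (kron_id W (G 0)) k"
    unfolding kron_id_add[abs_def] ..
  ultimately show ?thesis
    using X_Suc[OF k, of 0] init(2)[OF k] by (simp add: atc_gt_A_def atc_gt_B_def)
qed

text \<open>Identical initial blocks are fixed by W, so the primal part reproduces \<open>x0\<close>
  and the dual part drops out. What remains is the vector whose deviation \<open>zeta0_sq\<close>
  measures.\<close>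

lemma Z_zero: "k < K \<Longrightarrow> Z 0 k = kron_id W (kron_id W (G 0)) k"
proof -
  assume k: "k < K"
  have "kron_id W (X 0) k = x0"
    using kron_id_cong[of "X 0" "\<lambda>_. x0" k] init(1) kron_id_const[OF k] by simp
  then show ?thesis using X_one[OF k] by (simp add: Z_def)
qed

text \<open>Subtracting consecutive updates removes the dual variable and gives X(i+2) = 2 W X(i+1)
  - W^2 X(i) + W^2 H(i), which factors through Z.\<close>

lemma Z_Suc: "k < K \<Longrightarrow> Z (Suc i) k = kron_id W (Z i) k + kron_id W (kron_id W (H i)) k"
proof -
  assume k: "k < K"
  have D: "atc_gt_B W (D (Suc i)) k = atc_gt_B W (D i) k + atc_gt_B W (atc_gt_B W (X (Suc i))) k"
  proof -
    have "kron_id W (D (Suc i)) k = kron_id W (\<lambda>l. D i l + atc_gt_B W (X (Suc i)) l) k"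
      by (intro kron_id_cong D_Suc)
    then show ?thesis using D_Suc[OF k, of i]
      by (simp add: atc_gt_B_def[of W "D (Suc i)"] atc_gt_B_def[of W "D i"] kron_id_add)
        (simp add: atc_gt_B_def)
  qed
  have "X (Suc (Suc i)) k - X (Suc i) k
      = atc_gt_A W (\<lambda>l. X (Suc i) l + G (Suc i) l) k - atc_gt_A W (\<lambda>l. X i l + G i l) k
        - atc_gt_B W (atc_gt_B W (X (Suc i))) k"
    using X_Suc[OF k, of "Suc i"] X_Suc[OF k, of i] D by simp
  then show ?thesis
    by (simp add: Z_def[abs_def] H_def[abs_def] atc_gt_A_def atc_gt_B_def
        kron_id_add[abs_def] kron_id_diff[abs_def] kron_id_add kron_id_diff algebra_simps)
qed

lemma dev_X_zero: "k < K \<Longrightarrow> dev K (X 0) k = 0"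
  using block_avg_cong[of K "X 0" "\<lambda>_. x0"] init(1) by (simp add: dev_def block_avg_const K_pos)

lemma dev_X_Suc: "k < K \<Longrightarrow> dev K (X (Suc i)) k = kron_id W (dev K (X i)) k + dev K (Z i) k"
proof -
  assume k: "k < K"
  have "block_avg K (Z i) = block_avg K (X (Suc i)) - block_avg K (X i)"
    by (simp add: Z_def[abs_def] block_avg_diff block_avg_kron_id)
  then show ?thesis
    by (simp add: dev_kron_id[OF k, symmetric] dev_def Z_def block_avg_kron_id)
qed

lemma dev_Z_Suc:
  "k < K \<Longrightarrow> dev K (Z (Suc i)) k = kron_id W (dev K (Z i)) k + kron_id W (kron_id W (dev K (H i))) k"
proof -
  assume k: "k < K"
  have "block_avg K (Z (Suc i)) = block_avg K (\<lambda>k. kron_id W (Z i) k + kron_id W (kron_id W (H i)) k)"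
    by (intro block_avg_cong Z_Suc)
  moreover have "kron_id W (kron_id W (dev K (H i))) k = dev K (kron_id W (kron_id W (H i))) k"
    using kron_id_cong[of "kron_id W (dev K (H i))" "dev K (kron_id W (H i))" k]
    by (simp add: dev_kron_id k)
  ultimately show ?thesis
    using dev_kron_id[OF k, of "Z i"] Z_Suc[OF k, of i]
    by (simp add: dev_def block_avg_add block_avg_kron_id)
qed

lemma stack_dev_X_Suc_le: "stack_norm_sq K (dev K (X (Suc i)))
    \<le> lam * stack_norm_sq K (dev K (X i)) + stack_norm_sq K (dev K (Z i)) / (1 - lam)"
proof -
  have "stack_norm_sq K (dev K (X (Suc i))) = stack_norm_sq K (\<lambda>k. kron_id W (dev K (X i)) k + dev K (Z i) k)"
    by (intro stack_norm_sq_cong dev_X_Suc)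
  also have "\<dots> \<le> lam * stack_norm_sq K (dev K (X i)) + stack_norm_sq K (dev K (Z i)) / (1 - lam)"
    by (intro stack_norm_sq_kron_id_add_le sum_dev K_pos lam_less)
  finally show ?thesis .
qed

lemma stack_dev_Z_Suc_le: "stack_norm_sq K (dev K (Z (Suc i)))
    \<le> lam * stack_norm_sq K (dev K (Z i)) + stack_norm_sq K (H i) / (1 - lam)"
proof -
  \<comment> \<open>The two mixings of \<open>H\<close> are estimated as plain
    nonexpansions.\<close>
  have lam1: "lam\<^sup>2 * t \<le> t" if "0 \<le> t" for t
    using that lam_less spectral_gap(1) by (simp add: mult_left_le_one_le power_le_one)
  have "stack_norm_sq K (kron_id W (kron_id W (dev K (H i)))) \<le> lam\<^sup>2 * stack_norm_sq K (kron_id W (dev K (H i)))"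
    by (intro stack_norm_sq_kron_id_le) (simp add: sum_kron_id sum_dev K_pos)
  also have "\<dots> \<le> stack_norm_sq K (kron_id W (dev K (H i)))" by (intro lam1 stack_norm_sq_nonneg)
  also have "\<dots> \<le> lam\<^sup>2 * stack_norm_sq K (dev K (H i))"
    by (intro stack_norm_sq_kron_id_le) (simp add: sum_dev K_pos)
  also have "\<dots> \<le> stack_norm_sq K (dev K (H i))" by (intro lam1 stack_norm_sq_nonneg)
  also have "\<dots> \<le> stack_norm_sq K (H i)" by (rule stack_norm_sq_dev_le)
  finally have "stack_norm_sq K (kron_id W (kron_id W (dev K (H i)))) / (1 - lam)
      \<le> stack_norm_sq K (H i) / (1 - lam)"
    using lam_less by (intro divide_right_mono) auto
  moreover have "stack_norm_sq K (dev K (Z (Suc i)))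
      = stack_norm_sq K (\<lambda>k. kron_id W (dev K (Z i)) k + kron_id W (kron_id W (dev K (H i))) k)"
    by (intro stack_norm_sq_cong dev_Z_Suc)
  moreover have "\<dots> \<le> lam * stack_norm_sq K (dev K (Z i))
      + stack_norm_sq K (kron_id W (kron_id W (dev K (H i)))) / (1 - lam)"
    by (intro stack_norm_sq_kron_id_add_le sum_dev K_pos lam_less)
  ultimately show ?thesis by linarith
qed

text \<open>Each stage costs 1 / (1 - lam) from Young and another from summation: H passes both
  stages, giving the fourth power, while Z(0) skips the first Young factor. The indices lag by one
  per stage, so X up to n + 1 needs H only below n.\<close>

lemma consensus_bound: "(\<Sum>i\<le>Suc n. stack_norm_sq K (dev K (X i)))
    \<le> stack_norm_sq K (dev K (Z 0)) / (1 - lam) ^ 3 + (\<Sum>i<n. stack_norm_sq K (H i)) / (1 - lam) ^ 4"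
proof -
  let ?l = "1 - lam"
  have l: "0 < ?l" using lam_less by simp
  let ?z = "stack_norm_sq K (dev K (Z 0))" and ?h = "\<Sum>i<n. stack_norm_sq K (H i)"
  let ?Sx = "\<Sum>i\<le>Suc n. stack_norm_sq K (dev K (X i))" and ?Sz = "\<Sum>i\<le>n. stack_norm_sq K (dev K (Z i))"
  have "?l * ?Sz \<le> ?z + (\<Sum>i<n. stack_norm_sq K (H i) / ?l)"
    using stack_dev_Z_Suc_le spectral_gap(1) stack_norm_sq_nonneg
    by (intro contraction_sum_bound) auto
  then have z: "?Sz \<le> (?z + ?h / ?l) / ?l"
    using l by (simp add: pos_le_divide_eq mult.commute flip: sum_divide_distrib)
  have X0: "stack_norm_sq K (dev K (X 0)) = 0"
    using dev_X_zero by (simp add: stack_norm_sq_def)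
  have "?l * ?Sx \<le> stack_norm_sq K (dev K (X 0)) + (\<Sum>i<Suc n. stack_norm_sq K (dev K (Z i)) / ?l)"
    by (rule contraction_sum_bound[where a = "\<lambda>i. stack_norm_sq K (dev K (X i))" and q = lam and n = "Suc n"
          and r = "\<lambda>i. stack_norm_sq K (dev K (Z i)) / ?l", OF stack_dev_X_Suc_le spectral_gap(1) stack_norm_sq_nonneg])
  also have "\<dots> = ?Sz / ?l"
    by (simp only: X0 add_0_left sum_divide_distrib lessThan_Suc_atMost)
  also have "\<dots> \<le> ((?z + ?h / ?l) / ?l) / ?l" using z l by (intro divide_right_mono) auto
  finally have "?Sx \<le> (((?z + ?h / ?l) / ?l) / ?l) / ?l"
    by (subst pos_le_divide_eq[OF l]) (simp only: mult.commute)
  also have "\<dots> = ?z / ?l ^ 3 + ?h / ?l ^ 4"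
    by (simp add: add_divide_distrib power3_eq_cube power4_eq_xxxx)
  finally show ?thesis .
qed

end

section \<open>Square-integrable random vectors and independence\<close>

context prob_space
begin

abbreviation nsq :: "('a \<Rightarrow> 'v::euclidean_space) \<Rightarrow> 'a \<Rightarrow> real" where
  "nsq f \<equiv> \<lambda>\<omega>. (norm (f \<omega>))\<^sup>2"

definition sqi :: "('a \<Rightarrow> 'v::euclidean_space) \<Rightarrow> bool" where
  "sqi f \<longleftrightarrow> f \<in> borel_measurable M \<and> integrable M (nsq f)"

lemma sqi_integrable: "sqi f \<Longrightarrow> integrable M (nsq f)"
  by (simp add: sqi_def)

lemma sqi_dominated:
  assumes f: "f \<in> borel_measurable M" and g: "integrable M g"
    and le: "AE \<omega> in M. (norm (f \<omega>))\<^sup>2 \<le> g \<omega>"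
  shows "sqi f"
  unfolding sqi_def
proof
  show "integrable M (nsq f)"
  proof (rule Bochner_Integration.integrable_bound[OF g])
    show "AE \<omega> in M. norm ((norm (f \<omega>))\<^sup>2) \<le> norm (g \<omega>)"
      using le by eventually_elim auto
  qed (use f in simp)
qed fact

lemma sqi_add: "sqi f \<Longrightarrow> sqi g \<Longrightarrow> sqi (\<lambda>\<omega>. f \<omega> + g \<omega>)"
  by (rule sqi_dominated[where g = "\<lambda>\<omega>. 2 * (norm (f \<omega>))\<^sup>2 + 2 * (norm (g \<omega>))\<^sup>2"])
    (auto simp: sqi_def norm_add_sq_le)

lemma sqi_scaleR: "sqi f \<Longrightarrow> sqi (\<lambda>\<omega>. c *\<^sub>R f \<omega>)"
  by (auto simp: sqi_def power_mult_distrib intro!: borel_measurable_scaleR)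

lemma sqi_diff: "sqi f \<Longrightarrow> sqi g \<Longrightarrow> sqi (\<lambda>\<omega>. f \<omega> - g \<omega>)"
  using sqi_add[of f "\<lambda>\<omega>. (- 1) *\<^sub>R g \<omega>"] sqi_scaleR[of g "- 1"] by simp

lemma sqi_zero: "sqi (\<lambda>\<omega>. 0)"
  by (simp add: sqi_def)

lemma sqi_sum: "(\<And>s. s \<in> S \<Longrightarrow> sqi (f s)) \<Longrightarrow> sqi (\<lambda>\<omega>. \<Sum>s\<in>S. f s \<omega>)"
  by (induction S rule: infinite_finite_induct) (auto simp: sqi_zero intro!: sqi_add)

lemma sqi_cong: "(\<And>\<omega>. \<omega> \<in> space M \<Longrightarrow> f \<omega> = g \<omega>) \<Longrightarrow> sqi f = sqi g"
  unfolding sqi_def by (intro arg_cong2[where f = "(\<and>)"] measurable_cong Bochner_Integration.integrable_cong) auto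

lemma sqi_inner_integrable:
  assumes "sqi f" "sqi g"
  shows "integrable M (\<lambda>\<omega>. inner (f \<omega>) (g \<omega>))"
proof (rule Bochner_Integration.integrable_bound[of _ "\<lambda>\<omega>. (norm (f \<omega>))\<^sup>2 + (norm (g \<omega>))\<^sup>2"])
  show "AE \<omega> in M. norm (inner (f \<omega>) (g \<omega>)) \<le> norm ((norm (f \<omega>))\<^sup>2 + (norm (g \<omega>))\<^sup>2)"
  proof (rule AE_I2)
    fix \<omega>
    have "\<bar>inner (f \<omega>) (g \<omega>)\<bar> \<le> norm (f \<omega>) * norm (g \<omega>)" by (rule Cauchy_Schwarz_ineq2)
    also have "\<dots> \<le> (norm (f \<omega>))\<^sup>2 + (norm (g \<omega>))\<^sup>2"
      using sum_squares_bound[of "norm (f \<omega>)" "norm (g \<omega>)"]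
        mult_nonneg_nonneg[OF norm_ge_zero[of "f \<omega>"] norm_ge_zero[of "g \<omega>"]] by linarith
    finally show "norm (inner (f \<omega>) (g \<omega>)) \<le> norm ((norm (f \<omega>))\<^sup>2 + (norm (g \<omega>))\<^sup>2)" by simp
  qed
qed (use assms in \<open>auto simp: sqi_def\<close>)

lemma expectation_norm_add_sq:
  assumes "sqi f" "sqi g"
  shows "expectation (\<lambda>\<omega>. (norm (f \<omega> + g \<omega>))\<^sup>2)
    = expectation (nsq f) + 2 * expectation (\<lambda>\<omega>. inner (f \<omega>) (g \<omega>))
      + expectation (nsq g)"
proof -
  have "(norm (f \<omega> + g \<omega>))\<^sup>2 = (norm (f \<omega>))\<^sup>2 + 2 * (inner (f \<omega>) (g \<omega>)) + (norm (g \<omega>))\<^sup>2" for \<omega>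
    by (simp add: power2_norm_eq_inner inner_add_left inner_add_right inner_commute)
  then show ?thesis using assms sqi_inner_integrable[OF assms] by (simp add: sqi_def)
qed

text \<open>The sigma-algebra is packaged as a measure space so that dependence on the sources in
  \<open>A\<close> is expressed by \<open>borel_measurable\<close>.\<close>

definition gen :: "('i \<Rightarrow> 'a set set) \<Rightarrow> 'i set \<Rightarrow> 'a measure" where
  "gen F A = sigma (space M) (\<Union>r\<in>A. F r)"

text \<open>Disjoint groups of independent sources generate independent sigma-algebras, so
  expectations of products factor. Every later use of independence goes through this.\<close>

lemma gen_independent:
  fixes f g :: "'a \<Rightarrow> real"
  assumes indep: "indep_sets F I" and stable: "\<And>r. r \<in> I \<Longrightarrow> Int_stable (F r)"
    and AB: "A \<subseteq> I" "B \<subseteq> I" "A \<inter> B = {}"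
    and f: "f \<in> borel_measurable (gen F A)" "integrable M f"
    and g: "g \<in> borel_measurable (gen F B)" "integrable M g"
  shows "integrable M (\<lambda>\<omega>. f \<omega> * g \<omega>)"
    and "expectation (\<lambda>\<omega>. f \<omega> * g \<omega>) = expectation f * expectation g"
proof -
  have ev: "(\<Union>r\<in>C. F r) \<subseteq> Pow (space M)" if "C \<subseteq> I" for C
  proof -
    have "F r \<subseteq> Pow (space M)" if "r \<in> C" for r
      using indep that \<open>C \<subseteq> I\<close> sets.space_closed[of M] unfolding indep_sets_def by fast
    then show ?thesis by (rule UN_least)
  qed
  have sets: "sets (gen F C) = sigma_sets (space M) (\<Union>r\<in>C. F r)" if "C \<subseteq> I" for C
    using ev[OF that] by (simp add: gen_def sets_measure_of)
  have "indep_sets (\<lambda>j. sigma_sets (space M) (\<Union>i\<in>case_bool A B j. F i)) UNIV"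
  proof (rule indep_sets_collect_sigma)
    show "indep_sets F (\<Union>j\<in>UNIV. case_bool A B j)"
      by (rule indep_sets_mono_index[OF _ indep]) (use AB in \<open>auto split: bool.splits\<close>)
    show "Int_stable (F i)" if "i \<in> case_bool A B j" for i j
      using that AB stable by (cases j) auto
    show "disjoint_family_on (case_bool A B) UNIV"
      using AB by (auto simp: disjoint_family_on_def split: bool.splits)
  qed
  then have ind: "indep_sets (case_bool (sets (gen F A)) (sets (gen F B))) UNIV"
    by (rule indep_sets_mono_sets) (use AB in \<open>auto simp: sets split: bool.splits\<close>)
  have space: "space (gen F C) = space M" for C by (simp add: gen_def space_measure_of_conv)
  have pre: "sigma_sets (space M) {h -` S \<inter> space M |S. S \<in> sets borel} \<subseteq> sets (gen F C)"
    if "h \<in> borel_measurable (gen F C)" for h :: "'a \<Rightarrow> real" and C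
    using sets.sigma_sets_subset[of "{h -` S \<inter> space M |S. S \<in> sets borel}" "gen F C"]
      measurable_sets[OF that] by (auto simp: space)
  have "indep_var borel f borel g"
    unfolding indep_var_eq indep_set_def
  proof (intro conjI)
    show "indep_sets (case_bool (sigma_sets (space M) {f -` A \<inter> space M |A. A \<in> sets borel})
        (sigma_sets (space M) {g -` A \<inter> space M |A. A \<in> sets borel})) UNIV"
      by (rule indep_sets_mono_sets[OF ind]) (use pre[OF f(1)] pre[OF g(1)] in \<open>auto split: bool.splits\<close>)
  qed (use f g in \<open>auto dest: borel_measurable_integrable\<close>)
  from indep_var_integrable[OF this f(2) g(2)] indep_var_lebesgue_integral[OF this f(2) g(2)]
  show "integrable M (\<lambda>\<omega>. f \<omega> * g \<omega>)" "expectation (\<lambda>\<omega>. f \<omega> * g \<omega>) = expectation f * expectation g"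
    by auto
qed

end

section \<open>A run of the algorithm\<close>

lemma norm_prod_sq: "(norm (v :: 'a::real_normed_vector \<times> 'b::real_normed_vector))\<^sup>2
    = (norm (fst v))\<^sup>2 + (norm (snd v))\<^sup>2"
  by (simp add: norm_prod_def)

lemma sum_Pair: "(\<Sum>i\<in>S. (f i, g i)) = (\<Sum>i\<in>S. f i, \<Sum>i\<in>S. g i)"
  by (simp add: prod_eq_iff fst_sum snd_sum)

lemma kron_id_Pair: "kron_id A (\<lambda>l. (f l, g l)) k = (kron_id A f k, kron_id A g k)"
  by (simp add: kron_id_def sum_Pair)

lemma atc_gt_A_Pair: "atc_gt_A A (\<lambda>l. (f l, g l)) k = (atc_gt_A A f k, atc_gt_A A g k)"
  by (simp add: atc_gt_A_def kron_id_Pair[abs_def])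

lemma atc_gt_B_Pair: "atc_gt_B A (\<lambda>l. (f l, g l)) k = (atc_gt_B A f k, atc_gt_B A g k)"
  by (simp add: atc_gt_B_def kron_id_Pair)

lemma block_avg_Pair: "block_avg K (\<lambda>l. (f l, g l)) = (block_avg K f, block_avg K g)"
  by (simp add: block_avg_def sum_Pair)

lemma kron_id_scaleR: "kron_id A (\<lambda>l. c *\<^sub>R f l) k = c *\<^sub>R kron_id A f k"
  by (simp add: kron_id_def scaleR_sum_right mult.commute)

text \<open>The constants hidden in the step sizes are fixed here: 64 gives
  \<open>L * \<mu>y \<le> 1 / 64\<close> for \<open>descent_step\<close> and consensus gain L^2
  \<mu>y^2 / (1 - lam)^4 = 1/4096; 256 is the ratio of the time scales. \<open>K_le_N\<close> makes
  the prescribed batch sizes at least 1.\<close>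

locale page_run = page_atc_gt K N Q \<zeta> M W lam Lf \<nu> \<sigma> b0 b p \<mu>x \<mu>y x0 u0 y0 v0 \<xi> \<pi> X U gx Y V gy
  for K N :: nat
    and Q :: "nat \<Rightarrow> 'x::euclidean_space \<Rightarrow> 'y::euclidean_space \<Rightarrow> 'z \<Rightarrow> real"
    and \<zeta> :: "nat \<Rightarrow> nat \<Rightarrow> 'z"
    and M :: "'w measure"
    and W :: "real mat" and lam Lf \<nu> \<sigma> :: real
    and b0 b :: nat and p \<mu>x \<mu>y :: real
    and x0 u0 :: "'w \<Rightarrow> 'x" and y0 v0 :: "'w \<Rightarrow> 'y"
    and \<xi> :: "nat \<Rightarrow> nat \<Rightarrow> nat \<Rightarrow> 'w \<Rightarrow> 'z" and \<pi> :: "nat \<Rightarrow> 'w \<Rightarrow> bool"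
    and X U gx :: "nat \<Rightarrow> nat \<Rightarrow> 'w \<Rightarrow> 'x" and Y V gy :: "nat \<Rightarrow> nat \<Rightarrow> 'w \<Rightarrow> 'y" +
  assumes Lf_pos: "0 < Lf" and nu_le: "\<nu> \<le> Lf" and lam_less: "lam < 1" and K_le_N: "K \<le> N"
    and step_y: "64 * Lf * \<mu>y = (1 - lam)\<^sup>2" and step_x: "256 * (Lf / \<nu>)\<^sup>2 * \<mu>x = \<mu>y"
    and finite_init: "finite_initial_quantities"

sublocale page_run \<subseteq> PL: smooth_PL_problem K N Q \<zeta> Lf \<nu>
  by unfold_locales (use agents data differentiable smooth PL Lf_pos nu_le in auto)

sublocale page_run \<subseteq> mix: mixing_matrix K W lam
  by unfold_locales (fact agents W_dim W_symmetric W_stochastic W_primitive W_psd lambda)+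

context page_run
begin

lemma step_y_pos: "0 < \<mu>y"
proof -
  have "0 < 64 * Lf * \<mu>y" using lam_less by (simp add: step_y)
  then show ?thesis by (rule zero_less_mult_pos) (use Lf_pos in simp)
qed

lemma step_x_pos: "0 < \<mu>x" and step_x_le: "\<mu>x \<le> \<mu>y"
proof -
  have k: "1 \<le> (Lf / \<nu>)\<^sup>2" by (rule one_le_power[OF PL.\<kappa>_ge])
  have "0 < 256 * (Lf / \<nu>)\<^sup>2 * \<mu>x" using step_y_pos by (simp only: step_x)
  then show p: "0 < \<mu>x" by (rule zero_less_mult_pos) (use k in linarith)
  have "1 * \<mu>x \<le> (256 * (Lf / \<nu>)\<^sup>2) * \<mu>x" using k p by (intro mult_right_mono) linarith+
  then show "\<mu>x \<le> \<mu>y" by (simp only: step_x mult_1_left)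
qed

lemma Lf_step_y: "Lf * \<mu>y \<le> 1 / 64"
proof -
  have "(1 - lam)\<^sup>2 \<le> 1" using lam_less mix.spectral_gap(1) by (intro power_le_one) auto
  then show ?thesis using step_y by linarith
qed

lemma K_pos': "0 < K" and N_pos': "0 < N"
  using agents data by auto

definition st :: "nat \<Rightarrow> nat \<Rightarrow> 'w \<Rightarrow> 'x \<times> 'y" where
  "st i k \<omega> = (X i k \<omega>, Y i k \<omega>)"

definition dl :: "nat \<Rightarrow> nat \<Rightarrow> 'w \<Rightarrow> 'x \<times> 'y" where
  "dl i k \<omega> = (U i k \<omega>, V i k \<omega>)"

definition gg :: "nat \<Rightarrow> nat \<Rightarrow> 'w \<Rightarrow> 'x \<times> 'y" where
  "gg i k \<omega> = (gx i k \<omega>, gy i k \<omega>)"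

definition fg :: "nat \<Rightarrow> 'x \<times> 'y \<Rightarrow> 'x \<times> 'y" where
  "fg k s = (gradJlocx k (fst s) (snd s), gradJlocy k (fst s) (snd s))"

definition qg :: "nat \<Rightarrow> 'x \<times> 'y \<Rightarrow> 'z \<Rightarrow> 'x \<times> 'y" where
  "qg k s z = (gradQx k (fst s) (snd s) z, gradQy k (fst s) (snd s) z)"

text \<open>Descent in x and ascent in y with their step sizes, as one linear map on the product
  space.\<close>

definition sc :: "'x \<times> 'y \<Rightarrow> 'x \<times> 'y" where
  "sc v = (- \<mu>x *\<^sub>R fst v, \<mu>y *\<^sub>R snd v)"

lemma norm_sc_le: "(norm (sc v))\<^sup>2 \<le> \<mu>y\<^sup>2 * (norm v)\<^sup>2"
proof -
  have "\<mu>x\<^sup>2 \<le> \<mu>y\<^sup>2" using step_x_le step_x_pos by (intro power_mono) auto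
  then have "\<mu>x\<^sup>2 * (norm (fst v))\<^sup>2 \<le> \<mu>y\<^sup>2 * (norm (fst v))\<^sup>2" by (intro mult_right_mono) auto
  then show ?thesis by (simp add: sc_def norm_prod_sq power_mult_distrib distrib_left)
qed

lemma sc_diff: "sc (v - w) = sc v - sc w"
  by (simp add: sc_def prod_eq_iff scaleR_diff_right)

lemma block_avg_sc: "block_avg K (\<lambda>k. sc (f k)) = sc (block_avg K f)"
  by (simp add: sc_def block_avg_def prod_eq_iff fst_sum snd_sum scaleR_sum_right mult.commute
      flip: sum_negf)

lemma fg_eq: "k < K \<Longrightarrow> fg k a = (1 / real N) *\<^sub>R (\<Sum>s<N. qg k a (\<zeta> k s))"
  by (simp add: fg_def qg_def gradJloc_eq[OF differentiable] sum_Pair)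

lemma qg_smooth: "k < K \<Longrightarrow> (1 / real N) * (\<Sum>s<N. (norm (qg k a (\<zeta> k s) - qg k c (\<zeta> k s)))\<^sup>2)
    \<le> 2 * Lf\<^sup>2 * (norm (a - c))\<^sup>2"
  using gradQ_mean_square[OF smooth data, of k "fst a" "snd a" "fst c" "snd c"]
  by (simp add: qg_def norm_prod_sq sum.distrib distrib_left)

lemma fg_smooth: "k < K \<Longrightarrow> (norm (fg k a - fg k c))\<^sup>2 \<le> 2 * Lf\<^sup>2 * (norm (a - c))\<^sup>2"
  using order_trans[OF norm_average_sq_le qg_smooth, of k a c]
  by (simp add: fg_eq sum_subtractf scaleR_diff_right)

text \<open>One summand is at most N times the mean. The factor N is harmless, as the bound serves
  only measurability and integrability.\<close>

lemma qg_lipschitz: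
  assumes "k < K" "s < N"
  shows "(norm (qg k a (\<zeta> k s) - qg k c (\<zeta> k s)))\<^sup>2 \<le> 2 * real N * Lf\<^sup>2 * (norm (a - c))\<^sup>2"
proof -
  have "(norm (qg k a (\<zeta> k s) - qg k c (\<zeta> k s)))\<^sup>2
      \<le> (\<Sum>s<N. (norm (qg k a (\<zeta> k s) - qg k c (\<zeta> k s)))\<^sup>2)"
    using assms by (intro member_le_sum) auto
  also have "\<dots> \<le> real N * (2 * Lf\<^sup>2 * (norm (a - c))\<^sup>2)"
    using qg_smooth[OF assms(1), of a c] N_pos' by (simp add: field_simps)
  finally show ?thesis by (simp add: mult_ac)
qed

lemma sq_lipschitz_continuous:
  fixes f :: "'u::real_normed_vector \<Rightarrow> 'v::real_normed_vector"
  assumes "\<And>a c. (norm (f a - f c))\<^sup>2 \<le> B * (norm (a - c))\<^sup>2" "0 \<le> B"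
  shows "continuous_on UNIV f"
proof (rule lipschitz_on_continuous_on[OF lipschitz_onI])
  fix a c
  have "sqrt ((norm (f a - f c))\<^sup>2) \<le> sqrt (B * (norm (a - c))\<^sup>2)"
    by (rule real_sqrt_le_mono[OF assms(1)])
  then show "dist (f a) (f c) \<le> sqrt B * dist a c"
    by (simp add: dist_norm real_sqrt_mult)
qed (use assms in simp)

lemma qg_measurable [measurable]:
  "k < K \<Longrightarrow> s < N \<Longrightarrow> (\<lambda>a. qg k a (\<zeta> k s)) \<in> borel_measurable borel"
  by (intro borel_measurable_continuous_onI sq_lipschitz_continuous[OF qg_lipschitz]) auto

lemma fg_measurable [measurable]: "k < K \<Longrightarrow> fg k \<in> borel_measurable borel"
  by (intro borel_measurable_continuous_onI sq_lipschitz_continuous[OF fg_smooth]) auto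

lemma block_avg_fg: "block_avg K (\<lambda>k. fg k (x, y)) = (gradJx x y, gradJy x y)"
  by (simp add: fg_def block_avg_Pair) (simp add: block_avg_def gradJ_eq[OF differentiable])

lemma gg_zero:
  "k < K \<Longrightarrow> \<omega> \<in> space M \<Longrightarrow>
    gg 0 k \<omega> = (1 / real b0) *\<^sub>R (\<Sum>j<b0. qg k (st 0 k \<omega>) (\<xi> 0 k j \<omega>))"
  using page_x[of \<omega>] page_y[of \<omega>]
  by (simp add: grace_recursion_def gg_def qg_def st_def sum_Pair)

lemma gg_Suc:
  "k < K \<Longrightarrow> \<omega> \<in> space M \<Longrightarrow> gg (Suc i) k \<omega> =
    (if \<pi> (Suc i) \<omega> then fg k (st (Suc i) k \<omega>)
     else gg i k \<omega> + (1 / real b) *\<^sub>R (\<Sum>j<b. qg k (st (Suc i) k \<omega>) (\<xi> (Suc i) k j \<omega>)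
        - qg k (st i k \<omega>) (\<xi> (Suc i) k j \<omega>)))"
  using page_x[of \<omega>] page_y[of \<omega>]
  by (simp add: grace_recursion_def gg_def qg_def fg_def st_def sum_Pair sum_subtractf scaleR_diff_right)

lemma dynamics:
  assumes "\<omega> \<in> space M"
  shows "atc_gt_dynamics K W lam (\<lambda>i k. st i k \<omega>) (\<lambda>i k. sc (gg i k \<omega>)) (\<lambda>i k. dl i k \<omega>)
    (x0 \<omega>, y0 \<omega>) (u0 \<omega>, v0 \<omega>)"
proof
  show "dama_recursion K (atc_gt_A W) (atc_gt_B W) atc_gt_C 1
      (\<lambda>i k. st i k \<omega>) (\<lambda>i k. sc (gg i k \<omega>)) (\<lambda>i k. dl i k \<omega>)"
    using dama_x[OF assms] dama_y[OF assms]
    by (simp add: dama_recursion_def st_def dl_def gg_def sc_def atc_gt_C_def atc_gt_A_Pair atc_gt_B_Pair)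
qed (use start assms lam_less in \<open>auto simp: st_def dl_def\<close>)

section \<open>The sources of randomness and measurability of the iterates\<close>

definition src :: "source \<Rightarrow> 'w set set" where
  "src r = (case r of
      Init \<Rightarrow> sets (vimage_algebra (space M) (\<lambda>\<omega>. (x0 \<omega>, y0 \<omega>, u0 \<omega>, v0 \<omega>)) borel)
    | Coin i \<Rightarrow> sets (vimage_algebra (space M) (\<pi> i) (count_space UNIV))
    | Sample i k j \<Rightarrow> sets (vimage_algebra (space M) (\<xi> i k j) (count_space UNIV)))"

definition batch_size :: "nat \<Rightarrow> nat" where
  "batch_size i = (if i = 0 then b0 else b)"

definition idx :: "source set" where
  "idx = {Init} \<union> {Coin i | i. 1 \<le> i} \<union> {Sample i k j | i k j. k < K \<and> j < batch_size i}"

text \<open>Everything drawn up to and including iteration \<open>n\<close>. The estimate of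
  iteration n and already the iterate n + 1 are functions of it.\<close>

definition past :: "nat \<Rightarrow> source set" where
  "past n = {Init} \<union> {Coin i | i. 1 \<le> i \<and> i \<le> n} \<union>
    {Sample i k j | i k j. i \<le> n \<and> k < K \<and> j < batch_size i}"

abbreviation Fl :: "source set \<Rightarrow> 'w measure" where
  "Fl A \<equiv> gen src A"

lemma past_idx: "past n \<subseteq> idx"
  by (auto simp: past_def idx_def)

lemma past_mono: "past n \<subseteq> past (Suc n)"
  by (auto simp: past_def)

lemma indep_src: "indep_sets src idx"
  using independent by (simp add: src_def[abs_def] idx_def batch_size_def)

lemma Int_stable_src: "Int_stable (src r)"
  by (cases r) (auto simp: src_def sets.Int_stable)

lemma src_events: "r \<in> idx \<Longrightarrow> src r \<subseteq> events"
  using indep_src by (auto simp: indep_sets_def)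

lemma space_Fl [simp]: "space (Fl A) = space M"
  by (simp add: gen_def space_measure_of_conv)

lemma sets_Fl: "A \<subseteq> idx \<Longrightarrow> sets (Fl A) = sigma_sets (space M) (\<Union>r\<in>A. src r)"
  unfolding gen_def using src_events sets.space_closed[of M]
  by (intro sets_measure_of) (meson UN_least order_trans subset_iff)

lemma measurable_Fl_mono:
  assumes "f \<in> Fl A \<rightarrow>\<^sub>M T" "A \<subseteq> B" "B \<subseteq> idx"
  shows "f \<in> Fl B \<rightarrow>\<^sub>M T"
proof -
  have "sets (Fl A) \<subseteq> sets (Fl B)"
    using assms sets_Fl[of A] sets_Fl[of B] by (auto intro!: sigma_sets_mono')
  then show ?thesis using assms(1) by (auto simp: measurable_def)
qed

lemma measurable_Fl:
  assumes "f \<in> Fl A \<rightarrow>\<^sub>M T" "A \<subseteq> idx"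
  shows "f \<in> M \<rightarrow>\<^sub>M T"
proof -
  have "(\<Union>r\<in>A. src r) \<subseteq> events" using assms(2) src_events by blast
  then have "sets (Fl A) \<subseteq> events"
    unfolding sets_Fl[OF assms(2)] by (rule sets.sigma_sets_subset)
  then show ?thesis using assms(1) by (auto simp: measurable_def)
qed

lemma measurable_Fl_vimage:
  assumes "f \<in> space M \<rightarrow> space T" "sets (vimage_algebra (space M) f T) \<subseteq> src r" "r \<in> A" "A \<subseteq> idx"
  shows "f \<in> Fl A \<rightarrow>\<^sub>M T"
proof (rule measurableI)
  show "f \<omega> \<in> space T" if "\<omega> \<in> space (Fl A)" for \<omega> using that assms(1) by auto
  show "f -` S \<inter> space (Fl A) \<in> sets (Fl A)" if "S \<in> sets T" for S
  proof -
    have "f -` S \<inter> space M \<in> src r" using in_vimage_algebra[OF that, of f "space M"] assms(2) by auto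
    then show ?thesis using assms(3) by (auto simp: sets_Fl[OF assms(4)])
  qed
qed

lemma init_measurable_Fl:
  assumes "Init \<in> A" "A \<subseteq> idx"
  shows "(\<lambda>\<omega>. (x0 \<omega>, y0 \<omega>)) \<in> borel_measurable (Fl A)" "(\<lambda>\<omega>. (u0 \<omega>, v0 \<omega>)) \<in> borel_measurable (Fl A)"
proof -
  have m: "(\<lambda>\<omega>. (x0 \<omega>, y0 \<omega>, u0 \<omega>, v0 \<omega>)) \<in> borel_measurable (Fl A)"
    by (rule measurable_Fl_vimage[OF _ _ assms]) (auto simp: src_def)
  have "(\<lambda>(a::'x, b::'y, c::'x, d::'y). (a, b)) \<in> borel_measurable borel"
    "(\<lambda>(a::'x, b::'y, c::'x, d::'y). (c, d)) \<in> borel_measurable borel"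
    by (auto simp: case_prod_unfold intro!: borel_measurable_continuous_onI continuous_intros)
  from measurable_compose[OF m this(1)] measurable_compose[OF m this(2)]
  show "(\<lambda>\<omega>. (x0 \<omega>, y0 \<omega>)) \<in> borel_measurable (Fl A)" "(\<lambda>\<omega>. (u0 \<omega>, v0 \<omega>)) \<in> borel_measurable (Fl A)"
    by simp_all
qed

lemma coin_measurable_Fl:
  assumes "Coin i \<in> A" "A \<subseteq> idx"
  shows "\<pi> i \<in> Fl A \<rightarrow>\<^sub>M count_space UNIV"
  by (rule measurable_Fl_vimage[OF _ _ assms]) (auto simp: src_def)

lemma sample_measurable_Fl:
  assumes "Sample i k j \<in> A" "A \<subseteq> idx"
  shows "\<xi> i k j \<in> Fl A \<rightarrow>\<^sub>M count_space UNIV"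
  by (rule measurable_Fl_vimage[OF _ _ assms]) (auto simp: src_def)

lemma sample_in:
  assumes "Sample i k j \<in> idx"
  shows "k < K" "j < batch_size i" "\<omega> \<in> space M \<Longrightarrow> \<xi> i k j \<omega> \<in> \<zeta> k ` {..<N}"
  using assms sample_range[of k j i \<omega>] by (auto simp: idx_def batch_size_def)

text \<open>Samples take values in the finite local data set, so measurability is checked for each
  fixed data point.\<close>

lemma sample_compose_measurable:
  assumes "Sample i k j \<in> A" "A \<subseteq> idx" "\<And>s. s < N \<Longrightarrow> f (\<zeta> k s) \<in> Fl A \<rightarrow>\<^sub>M T"
  shows "(\<lambda>\<omega>. f (\<xi> i k j \<omega>) \<omega>) \<in> Fl A \<rightarrow>\<^sub>M T"
proof (rule measurable_compose_countable'[where I = "\<zeta> k ` {..<N}" and f = f])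
  have "\<xi> i k j \<in> Fl A \<rightarrow>\<^sub>M restrict_space (count_space UNIV) (\<zeta> k ` {..<N})"
    using sample_in(3)[of i k j] assms
    by (intro measurable_restrict_space2 sample_measurable_Fl) auto
  then show "\<xi> i k j \<in> Fl A \<rightarrow>\<^sub>M count_space (\<zeta> k ` {..<N})"
    by (simp add: restrict_count_space)
qed (use assms in auto)

lemma st_zero: "k < K \<Longrightarrow> \<omega> \<in> space M \<Longrightarrow> st 0 k \<omega> = (x0 \<omega>, y0 \<omega>)"
  using start by (simp add: st_def)

lemma st_zero_measurable: "k < K \<Longrightarrow> st 0 k \<in> borel_measurable (Fl {Init})"
  using init_measurable_Fl(1)[of "{Init}"] st_zero
  by (subst measurable_cong[where g = "\<lambda>\<omega>. (x0 \<omega>, y0 \<omega>)"]) (auto simp: idx_def)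

lemma iterate_measurable_step:
  assumes st: "\<And>k. k < K \<Longrightarrow> st i k \<in> borel_measurable (Fl A)"
    and dl: "\<And>k. k < K \<Longrightarrow> dl i k \<in> borel_measurable (Fl A)"
    and gg: "\<And>k. k < K \<Longrightarrow> gg i k \<in> borel_measurable (Fl A)" and k: "k < K"
  shows "st (Suc i) k \<in> borel_measurable (Fl A)" "dl (Suc i) k \<in> borel_measurable (Fl A)"
proof -
  have kron: "(\<lambda>\<omega>. kron_id W (\<lambda>l. f l \<omega>) k) \<in> borel_measurable (Fl A)"
    if "\<And>l. l < K \<Longrightarrow> f l \<in> borel_measurable (Fl A)" for f :: "nat \<Rightarrow> 'w \<Rightarrow> 'x \<times> 'y" and k
    unfolding mix.kron_id_W using that
    by (intro borel_measurable_sum borel_measurable_scaleR) auto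
  have sc: "(\<lambda>\<omega>. sc (gg i l \<omega>)) \<in> borel_measurable (Fl A)" if "l < K" for l
  proof -
    have "sc \<in> borel_measurable borel"
      unfolding sc_def[abs_def] by (intro borel_measurable_continuous_onI continuous_intros)
    from measurable_compose[OF gg[OF that] this] show ?thesis .
  qed
  have S: "st (Suc i) k \<in> borel_measurable (Fl A)" if k: "k < K" for k
  proof -
    have "(\<lambda>\<omega>. kron_id W (\<lambda>m. kron_id W (\<lambda>l. st i l \<omega> + sc (gg i l \<omega>)) m) k
        - (dl i k \<omega> - kron_id W (\<lambda>l. dl i l \<omega>) k)) \<in> borel_measurable (Fl A)"
      using st dl sc k by (intro borel_measurable_diff borel_measurable_add kron) auto
    then show ?thesis
      using atc_gt_dynamics.X_Suc[OF dynamics k, of _ i]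
      by (subst measurable_cong[where g = "\<lambda>\<omega>. kron_id W (\<lambda>m. kron_id W (\<lambda>l. st i l \<omega> + sc (gg i l \<omega>)) m) k
        - (dl i k \<omega> - kron_id W (\<lambda>l. dl i l \<omega>) k)"]) (auto simp: atc_gt_A_def atc_gt_B_def)
  qed
  show "st (Suc i) k \<in> borel_measurable (Fl A)" by (rule S[OF k])
  have "(\<lambda>\<omega>. dl i k \<omega> + (st (Suc i) k \<omega> - kron_id W (\<lambda>l. st (Suc i) l \<omega>) k)) \<in> borel_measurable (Fl A)"
    using dl S k by (intro borel_measurable_diff borel_measurable_add kron) auto
  then show "dl (Suc i) k \<in> borel_measurable (Fl A)"
    using atc_gt_dynamics.D_Suc[OF dynamics k, of _ i]
    by (subst measurable_cong[where g = "\<lambda>\<omega>. dl i k \<omega> + (st (Suc i) k \<omega> - kron_id W (\<lambda>l. st (Suc i) l \<omega>) k)"])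
      (auto simp: atc_gt_B_def)
qed

text \<open>The third claim looks one step ahead: both iterates at which a new sample is evaluated
  are determined before it is drawn.\<close>

lemma iterates_measurable:
  assumes "k < K"
  shows "st i k \<in> borel_measurable (Fl (past i))" "gg i k \<in> borel_measurable (Fl (past i))"
    "st (Suc i) k \<in> borel_measurable (Fl (past i))"
proof -
  have q: "(\<lambda>\<omega>. qg k (f \<omega>) (\<xi> n k j \<omega>)) \<in> borel_measurable (Fl (past n))"
    if "k < K" "j < batch_size n" "f \<in> borel_measurable (Fl (past n))" for k j n f
  proof -
    have "Sample n k j \<in> past n" using that by (auto simp: past_def)
    moreover have "(\<lambda>\<omega>. qg k (f \<omega>) (\<zeta> k s)) \<in> borel_measurable (Fl (past n))" if "s < N" for s
      by (rule measurable_compose[OF \<open>f \<in> _\<close> qg_measurable[OF \<open>k < K\<close> that]])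
    ultimately show ?thesis
      using sample_compose_measurable[of n k j "past n" "\<lambda>z \<omega>. qg k (f \<omega>) z" borel] past_idx by auto
  qed
  have "\<forall>k<K. st i k \<in> borel_measurable (Fl (past i)) \<and> dl i k \<in> borel_measurable (Fl (past i))
      \<and> gg i k \<in> borel_measurable (Fl (past i))"
  proof (induction i)
    case 0
    show ?case
    proof (intro allI impI conjI)
      fix k assume k: "k < K"
      have I: "Init \<in> past 0" by (simp add: past_def)
      show S: "st 0 k \<in> borel_measurable (Fl (past 0))"
        using I past_idx by (intro measurable_Fl_mono[OF st_zero_measurable[OF k]]) auto
      show "dl 0 k \<in> borel_measurable (Fl (past 0))"
        using init_measurable_Fl(2)[OF I past_idx] start[OF k]
        by (subst measurable_cong[where g = "\<lambda>\<omega>. (u0 \<omega>, v0 \<omega>)"]) (auto simp: dl_def)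
      have "(\<lambda>\<omega>. (1 / real b0) *\<^sub>R (\<Sum>j<b0. qg k (st 0 k \<omega>) (\<xi> 0 k j \<omega>))) \<in> borel_measurable (Fl (past 0))"
        using k S by (intro borel_measurable_scaleR borel_measurable_sum q) (auto simp: batch_size_def)
      then show "gg 0 k \<in> borel_measurable (Fl (past 0))"
        using gg_zero[OF k] by (subst measurable_cong) auto
    qed
  next
    case (Suc n)
    show ?case
    proof (intro allI impI conjI)
      fix k assume k: "k < K"
      have up: "f \<in> borel_measurable (Fl (past (Suc n)))" if "f \<in> borel_measurable (Fl (past n))"
        for f :: "'w \<Rightarrow> 'x \<times> 'y"
        by (rule measurable_Fl_mono[OF that past_mono past_idx])
      show S: "st (Suc n) k \<in> borel_measurable (Fl (past (Suc n)))"
        using Suc k by (intro up iterate_measurable_step) auto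
      show "dl (Suc n) k \<in> borel_measurable (Fl (past (Suc n)))"
        using Suc k by (intro up iterate_measurable_step) auto
      let ?g = "\<lambda>\<omega>. if \<pi> (Suc n) \<omega> then fg k (st (Suc n) k \<omega>)
         else gg n k \<omega> + (1 / real b) *\<^sub>R (\<Sum>j<b. qg k (st (Suc n) k \<omega>) (\<xi> (Suc n) k j \<omega>)
            - qg k (st n k \<omega>) (\<xi> (Suc n) k j \<omega>))"
      have "\<pi> (Suc n) \<in> Fl (past (Suc n)) \<rightarrow>\<^sub>M count_space UNIV"
        by (rule coin_measurable_Fl[OF _ past_idx]) (simp add: past_def)
      then have "{\<omega> \<in> space (Fl (past (Suc n))). \<pi> (Suc n) \<omega>} \<in> sets (Fl (past (Suc n)))"
        unfolding pred_def .
      then have "?g \<in> borel_measurable (Fl (past (Suc n)))"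
        using k S up[of "st n k"] up[of "gg n k"] Suc
        by (intro measurable_If borel_measurable_add borel_measurable_scaleR
            borel_measurable_sum borel_measurable_diff q measurable_compose[OF S fg_measurable[OF k]])
          (auto simp: batch_size_def)
      then show "gg (Suc n) k \<in> borel_measurable (Fl (past (Suc n)))"
        using gg_Suc[OF k, of _ n] by (subst measurable_cong[where g = ?g]) auto
    qed
  qed
  then show "st i k \<in> borel_measurable (Fl (past i))" "gg i k \<in> borel_measurable (Fl (past i))"
    "st (Suc i) k \<in> borel_measurable (Fl (past i))"
    using assms iterate_measurable_step(1) by blast+
qed


text \<open>Takes the place of conditioning on the past. The integrand is a finite sum over data
  values z of the indicator of drawing z times a function of the past, and the two factors are
  independent.\<close>

lemma fresh_expectation:
  fixes \<phi> :: "'z \<Rightarrow> 'w \<Rightarrow> real"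
  assumes B: "B \<subseteq> idx" and fresh: "Sample i k j \<in> idx" "Sample i k j \<notin> B"
    and \<phi>: "\<And>s. s < N \<Longrightarrow> \<phi> (\<zeta> k s) \<in> borel_measurable (Fl B)" "\<And>s. s < N \<Longrightarrow> integrable M (\<phi> (\<zeta> k s))"
  shows "integrable M (\<lambda>\<omega>. \<phi> (\<xi> i k j \<omega>) \<omega>)"
    and "expectation (\<lambda>\<omega>. \<phi> (\<xi> i k j \<omega>) \<omega>) = (1 / real N) * (\<Sum>s<N. expectation (\<phi> (\<zeta> k s)))"
proof -
  define I where "I = \<zeta> k ` {..<N}"
  define A where "A = {Sample i k j}"
  define ind where "ind z \<omega> = (if \<xi> i k j \<omega> = z then 1 else 0 :: real)" for z \<omega>
  have fin: "finite I" by (simp add: I_def)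
  have A: "A \<subseteq> idx" "A \<inter> B = {}" using fresh by (auto simp: A_def)
  have \<xi>: "\<xi> i k j \<in> Fl A \<rightarrow>\<^sub>M count_space UNIV"
    by (rule sample_measurable_Fl[OF _ A(1)]) (simp add: A_def)
  have ind: "ind z \<in> borel_measurable (Fl A)" for z
    unfolding ind_def[abs_def] by (rule measurable_compose[OF \<xi>]) simp
  note indM = measurable_Fl[OF ind A(1)] and \<xi>M = measurable_Fl[OF \<xi> A(1)]
  have ind_int: "integrable M (ind z)" for z
    by (rule integrable_const_bound[where B = 1]) (use indM in \<open>auto simp: ind_def\<close>)
  have Eind: "expectation (ind z) = pmf (local_law k) z" for z
  proof -
    have "expectation (ind z) = expectation (indicator {\<omega> \<in> space M. \<xi> i k j \<omega> = z})"
      by (rule Bochner_Integration.integral_cong) (auto simp: ind_def)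
    also have "\<dots> = measure M ({\<omega> \<in> space M. \<xi> i k j \<omega> = z} \<inter> space M)"
      by (rule Bochner_Integration.integral_indicator)
    also have "\<dots> = measure (distr M (count_space UNIV) (\<xi> i k j)) {z}"
      by (subst measure_distr[OF \<xi>M]) (auto intro!: arg_cong[where f = "measure M"])
    also have "\<dots> = pmf (local_law k) z"
      using sample_law[of k j i] sample_in[OF fresh(1)]
      by (simp add: pmf.rep_eq batch_size_def)
    finally show ?thesis .
  qed
  have summand: "integrable M (\<lambda>\<omega>. ind z \<omega> * \<phi> z \<omega>)"
    "expectation (\<lambda>\<omega>. ind z \<omega> * \<phi> z \<omega>) = pmf (local_law k) z * expectation (\<phi> z)" if "z \<in> I" for z
    using gen_independent[OF indep_src Int_stable_src A(1) B A(2) ind ind_int, of "\<phi> z" z] \<phi> that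
    by (auto simp: I_def Eind)
  have eq: "\<phi> (\<xi> i k j \<omega>) \<omega> = (\<Sum>z\<in>I. ind z \<omega> * \<phi> z \<omega>)" if "\<omega> \<in> space M" for \<omega>
    using sample_in(3)[OF fresh(1) that] fin
    by (simp add: ind_def I_def[symmetric] if_distrib[of "\<lambda>t. t * _"] sum.delta' cong: if_cong)
  show "integrable M (\<lambda>\<omega>. \<phi> (\<xi> i k j \<omega>) \<omega>)"
    by (subst Bochner_Integration.integrable_cong[OF refl eq]) (auto intro: summand)
  have "expectation (\<lambda>\<omega>. \<phi> (\<xi> i k j \<omega>) \<omega>) = (\<Sum>z\<in>I. pmf (local_law k) z * expectation (\<phi> z))"
    by (subst Bochner_Integration.integral_cong[OF refl eq])
      (auto simp: summand intro!: Bochner_Integration.integral_sum[THEN trans] sum.cong)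
  \<comment> \<open>The sum over distinct data values is read as an expectation, so that repeated
    data points count with multiplicity in the average over N positions.\<close>
  also have "\<dots> = measure_pmf.expectation (local_law k) (\<lambda>z. expectation (\<phi> z))"
  proof (subst integral_measure_pmf_real[OF fin])
    have "{..<N} \<noteq> {}" using N_pos' by (auto simp: lessThan_empty_iff)
    then show "a \<in> I" if "a \<in> set_pmf (local_law k)" for a
      using that by (simp add: local_law_def I_def set_pmf_of_set)
  qed (simp add: mult.commute)
  also have "\<dots> = (1 / real N) * (\<Sum>s<N. expectation (\<phi> (\<zeta> k s)))"
    by (rule expectation_local_law[OF data])
  finally show "expectation (\<lambda>\<omega>. \<phi> (\<xi> i k j \<omega>) \<omega>) = (1 / real N) * (\<Sum>s<N. expectation (\<phi> (\<zeta> k s)))" .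
qed

lemma p_range: "0 < p" "p \<le> 1"
proof -
  have "1 \<le> real K * real N"
    using mult_mono[of 1 "real K" 1 "real N"] agents data by simp
  then show "0 < p" "p \<le> 1" by (auto simp: prob_reset)
qed

text \<open>The indicator of the coin is independent of \<open>f\<close>; it splits an expectation
  into the reset and the recursive branch.\<close>

lemma coin_expectation:
  fixes f :: "'w \<Rightarrow> real"
  assumes B: "B \<subseteq> idx" and i: "1 \<le> i" "Coin i \<notin> B"
    and f: "f \<in> borel_measurable (Fl B)" "integrable M f"
  shows "integrable M (\<lambda>\<omega>. if \<pi> i \<omega> then f \<omega> else 0)" "integrable M (\<lambda>\<omega>. if \<pi> i \<omega> then 0 else f \<omega>)"
    and "expectation (\<lambda>\<omega>. if \<pi> i \<omega> then f \<omega> else 0) = p * expectation f"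
    and "expectation (\<lambda>\<omega>. if \<pi> i \<omega> then 0 else f \<omega>) = (1 - p) * expectation f"
proof -
  define A where "A = {Coin i}"
  define ind where "ind \<omega> = (if \<pi> i \<omega> then 1 else 0 :: real)" for \<omega>
  have A: "A \<subseteq> idx" "A \<inter> B = {}" using i by (auto simp: A_def idx_def)
  have \<pi>: "\<pi> i \<in> Fl A \<rightarrow>\<^sub>M count_space UNIV"
    by (rule coin_measurable_Fl[OF _ A(1)]) (simp add: A_def)
  have ind: "ind \<in> borel_measurable (Fl A)"
    unfolding ind_def[abs_def] by (rule measurable_compose[OF \<pi>]) simp
  note indM = measurable_Fl[OF ind A(1)] and \<pi>M = measurable_Fl[OF \<pi> A(1)]
  have ind_int: "integrable M ind"
    by (rule integrable_const_bound[where B = 1]) (use indM in \<open>auto simp: ind_def\<close>)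
  have "expectation ind = expectation (indicator {\<omega> \<in> space M. \<pi> i \<omega>})"
    by (rule Bochner_Integration.integral_cong) (auto simp: ind_def)
  also have "\<dots> = measure M ({\<omega> \<in> space M. \<pi> i \<omega>} \<inter> space M)"
    by (rule Bochner_Integration.integral_indicator)
  also have "\<dots> = measure (distr M (count_space UNIV) (\<pi> i)) {True}"
    by (subst measure_distr[OF \<pi>M]) (auto intro!: arg_cong[where f = "measure M"])
  also have "\<dots> = pmf (bernoulli_pmf p) True"
    by (simp add: coin_law[OF i(1)] pmf.rep_eq)
  finally have Eind: "expectation ind = p" using p_range by simp
  note P = gen_independent[OF indep_src Int_stable_src A(1) B A(2) ind ind_int f]
  have 1: "(\<lambda>\<omega>. if \<pi> i \<omega> then f \<omega> else 0) = (\<lambda>\<omega>. ind \<omega> * f \<omega>)"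
    and 2: "(\<lambda>\<omega>. if \<pi> i \<omega> then 0 else f \<omega>) = (\<lambda>\<omega>. f \<omega> - ind \<omega> * f \<omega>)"
    by (auto simp: ind_def)
  show "integrable M (\<lambda>\<omega>. if \<pi> i \<omega> then f \<omega> else 0)" "integrable M (\<lambda>\<omega>. if \<pi> i \<omega> then 0 else f \<omega>)"
    unfolding 1 2 using P(1) f(2) by auto
  show "expectation (\<lambda>\<omega>. if \<pi> i \<omega> then f \<omega> else 0) = p * expectation f"
    "expectation (\<lambda>\<omega>. if \<pi> i \<omega> then 0 else f \<omega>) = (1 - p) * expectation f"
    unfolding 1 2 using P f(2) by (simp_all add: Eind algebra_simps)
qed

lemma fresh_sqi:
  fixes d :: "'z \<Rightarrow> 'w \<Rightarrow> 'v::euclidean_space"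
  assumes B: "B \<subseteq> idx" and fresh: "Sample i k j \<in> idx" "Sample i k j \<notin> B"
    and d: "\<And>s. s < N \<Longrightarrow> d (\<zeta> k s) \<in> borel_measurable (Fl B)" "\<And>s. s < N \<Longrightarrow> sqi (d (\<zeta> k s))"
  shows "(\<lambda>\<omega>. d (\<xi> i k j \<omega>) \<omega>) \<in> borel_measurable (Fl (insert (Sample i k j) B))"
    and "sqi (\<lambda>\<omega>. d (\<xi> i k j \<omega>) \<omega>)"
    and "expectation (\<lambda>\<omega>. (norm (d (\<xi> i k j \<omega>) \<omega>))\<^sup>2)
      = (1 / real N) * (\<Sum>s<N. expectation (nsq (d (\<zeta> k s))))"
proof -
  let ?B = "insert (Sample i k j) B"
  have B': "?B \<subseteq> idx" using B fresh by auto
  show m: "(\<lambda>\<omega>. d (\<xi> i k j \<omega>) \<omega>) \<in> borel_measurable (Fl ?B)"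
    by (rule sample_compose_measurable[OF _ B', of i k j d]) (auto intro: measurable_Fl_mono[OF d(1) _ B'])
  have sq: "(nsq (d (\<zeta> k s))) \<in> borel_measurable (Fl B)" if "s < N" for s
    using d(1)[OF that] by measurable
  note F = fresh_expectation[of B i k j "\<lambda>z \<omega>. (norm (d z \<omega>))\<^sup>2", OF B fresh sq sqi_integrable[OF d(2)]]
  show "sqi (\<lambda>\<omega>. d (\<xi> i k j \<omega>) \<omega>)"
    unfolding sqi_def using measurable_Fl[OF m B'] F(1) by simp
  show "expectation (\<lambda>\<omega>. (norm (d (\<xi> i k j \<omega>) \<omega>))\<^sup>2)
      = (1 / real N) * (\<Sum>s<N. expectation (nsq (d (\<zeta> k s))))"
    by (rule F(2))
qed

text \<open>Martingale orthogonality: averaging the inner product over the data set gives the inner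
  product with the zero mean of \<open>d\<close>, so the cross term vanishes.\<close>

lemma fresh_increment:
  fixes d :: "'z \<Rightarrow> 'w \<Rightarrow> 'v::euclidean_space"
  assumes B: "B \<subseteq> idx" and fresh: "Sample i k j \<in> idx" "Sample i k j \<notin> B"
    and e: "e \<in> borel_measurable (Fl B)" "sqi e"
    and d: "\<And>s. s < N \<Longrightarrow> d (\<zeta> k s) \<in> borel_measurable (Fl B)" "\<And>s. s < N \<Longrightarrow> sqi (d (\<zeta> k s))"
    and zero: "\<And>\<omega>. \<omega> \<in> space M \<Longrightarrow> (\<Sum>s<N. d (\<zeta> k s) \<omega>) = 0"
  shows "expectation (\<lambda>\<omega>. (norm (e \<omega> + d (\<xi> i k j \<omega>) \<omega>))\<^sup>2)
      = expectation (nsq e) + (1 / real N) * (\<Sum>s<N. expectation (nsq (d (\<zeta> k s))))"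
proof -
  note S = fresh_sqi[of B i k j d, OF B fresh d]
  have in_meas: "(\<lambda>\<omega>. inner (e \<omega>) (d (\<zeta> k s) \<omega>)) \<in> borel_measurable (Fl B)" if "s < N" for s
    using e(1) d(1)[OF that] by measurable
  have "expectation (\<lambda>\<omega>. inner (e \<omega>) (d (\<xi> i k j \<omega>) \<omega>))
      = (1 / real N) * (\<Sum>s<N. expectation (\<lambda>\<omega>. inner (e \<omega>) (d (\<zeta> k s) \<omega>)))"
    using fresh_expectation(2)[of B i k j "\<lambda>z \<omega>. inner (e \<omega>) (d z \<omega>)", OF B fresh in_meas sqi_inner_integrable[OF e(2) d(2)]]
    by simp
  also have "(\<Sum>s<N. expectation (\<lambda>\<omega>. inner (e \<omega>) (d (\<zeta> k s) \<omega>)))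
      = expectation (\<lambda>\<omega>. \<Sum>s<N. inner (e \<omega>) (d (\<zeta> k s) \<omega>))"
    using sqi_inner_integrable[OF e(2) d(2)] by (intro Bochner_Integration.integral_sum[symmetric]) auto
  also have "\<dots> = expectation (\<lambda>\<omega>. 0)"
    using zero by (intro Bochner_Integration.integral_cong) (auto simp flip: inner_sum_right)
  finally have "expectation (\<lambda>\<omega>. inner (e \<omega>) (d (\<xi> i k j \<omega>) \<omega>)) = 0" by simp
  then show ?thesis using expectation_norm_add_sq[OF e(2) S(2)] S(3) by simp
qed

text \<open>The samples of one iteration are added one at a time, each joining the sigma-algebra
  before the next. Thus variances add over samples and agents, which is where the factor 1 / (K b)
  comes from.\<close>

lemma fresh_increments:
  fixes d :: "nat \<Rightarrow> 'z \<Rightarrow> 'w \<Rightarrow> 'v::euclidean_space"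
  assumes R: "finite R" "R \<subseteq> {..<K} \<times> {..<batch_size i}"
    and B: "B \<subseteq> idx" and fresh: "\<And>k j. (k, j) \<in> R \<Longrightarrow> Sample i k j \<notin> B"
    and e: "e \<in> borel_measurable (Fl B)" "sqi e"
    and d: "\<And>k s. k < K \<Longrightarrow> s < N \<Longrightarrow> d k (\<zeta> k s) \<in> borel_measurable (Fl B)"
      "\<And>k s. k < K \<Longrightarrow> s < N \<Longrightarrow> sqi (d k (\<zeta> k s))"
    and zero: "\<And>k \<omega>. k < K \<Longrightarrow> \<omega> \<in> space M \<Longrightarrow> (\<Sum>s<N. d k (\<zeta> k s) \<omega>) = 0"
  shows "(\<lambda>\<omega>. e \<omega> + (\<Sum>(k, j)\<in>R. d k (\<xi> i k j \<omega>) \<omega>))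
        \<in> borel_measurable (Fl (B \<union> (\<lambda>(k, j). Sample i k j) ` R))"
    and "sqi (\<lambda>\<omega>. e \<omega> + (\<Sum>(k, j)\<in>R. d k (\<xi> i k j \<omega>) \<omega>))"
    and "expectation (\<lambda>\<omega>. (norm (e \<omega> + (\<Sum>(k, j)\<in>R. d k (\<xi> i k j \<omega>) \<omega>)))\<^sup>2)
      = expectation (nsq e)
        + (\<Sum>(k, j)\<in>R. (1 / real N) * (\<Sum>s<N. expectation (nsq (d k (\<zeta> k s)))))"
proof -
  let ?A = "\<lambda>R. B \<union> (\<lambda>(k, j). Sample i k j) ` R"
  let ?f = "\<lambda>R \<omega>. e \<omega> + (\<Sum>(k, j)\<in>R. d k (\<xi> i k j \<omega>) \<omega>)"
  let ?v = "\<lambda>k. (1 / real N) * (\<Sum>s<N. expectation (nsq (d k (\<zeta> k s))))"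
  have "?f R \<in> borel_measurable (Fl (?A R)) \<and> sqi (?f R) \<and>
      expectation (nsq (?f R)) = expectation (nsq e) + (\<Sum>(k, j)\<in>R. ?v k)"
    using R fresh
  proof (induction R rule: finite_induct)
    case empty
    then show ?case using e by simp
  next
    case (insert r R)
    obtain k j where r: "r = (k, j)" by (cases r)
    have kj: "k < K" "j < batch_size i" using insert.prems r by auto
    have IH: "?f R \<in> borel_measurable (Fl (?A R))" "sqi (?f R)"
      "expectation (nsq (?f R)) = expectation (nsq e) + (\<Sum>(k, j)\<in>R. ?v k)"
      using insert by auto
    have A: "?A R \<subseteq> idx" using B insert.prems by (auto simp: idx_def)
    have fr: "Sample i k j \<in> idx" "Sample i k j \<notin> ?A R"
      using kj insert.prems(2)[of k j] insert.hyps(2) by (auto simp: r idx_def)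
    have dm: "d k (\<zeta> k s) \<in> borel_measurable (Fl (?A R))" if "s < N" for s
      by (rule measurable_Fl_mono[OF d(1)[OF kj(1) that] _ A]) auto
    have eq: "?f (insert r R) \<omega> = ?f R \<omega> + d k (\<xi> i k j \<omega>) \<omega>" for \<omega>
      using insert.hyps by (simp add: r algebra_simps)
    note S = fresh_sqi[of "?A R" i k j "d k", OF A fr dm d(2)[OF kj(1)]]
    have ins: "?A (insert r R) = insert (Sample i k j) (?A R)" by (auto simp: r)
    have A': "insert (Sample i k j) (?A R) \<subseteq> idx" using A fr by auto
    have "(\<lambda>\<omega>. ?f R \<omega> + d k (\<xi> i k j \<omega>) \<omega>) \<in> borel_measurable (Fl (insert (Sample i k j) (?A R)))"
      by (intro borel_measurable_add S(1) measurable_Fl_mono[OF IH(1) _ A']) auto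
    moreover have "sqi (\<lambda>\<omega>. ?f R \<omega> + d k (\<xi> i k j \<omega>) \<omega>)" by (intro sqi_add IH S(2))
    moreover have "expectation (\<lambda>\<omega>. (norm (?f R \<omega> + d k (\<xi> i k j \<omega>) \<omega>))\<^sup>2)
        = expectation (nsq e) + (\<Sum>(k, j)\<in>insert r R. ?v k)"
      using fresh_increment[of "?A R" i k j "?f R" "d k", OF A fr IH(1,2) dm d(2)[OF kj(1)] zero[OF kj(1)]] IH(3) insert.hyps
      by (simp add: r algebra_simps)
    ultimately show ?case unfolding ins eq by blast
  qed
  then show "?f R \<in> borel_measurable (Fl (?A R))" "sqi (?f R)"
    "expectation (nsq (?f R)) = expectation (nsq e) + (\<Sum>(k, j)\<in>R. ?v k)"
    by auto
qed

end

section \<open>Second moments of the estimator\<close>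

lemma (in prob_space) sqi_average_integrable:
  assumes "\<And>s. s < n \<Longrightarrow> sqi (f s)"
  shows "integrable M (\<lambda>\<omega>. (1 / real n) * (\<Sum>s<n. (norm (f s \<omega>))\<^sup>2))"
  using sqi_integrable[OF assms]
  by (intro integrable_mult_right Bochner_Integration.integrable_sum) auto

context page_run
begin

definition err :: "nat \<Rightarrow> nat \<Rightarrow> 'w \<Rightarrow> 'x \<times> 'y" where
  "err i k \<omega> = gg i k \<omega> - fg k (st i k \<omega>)"

definition mv :: "nat \<Rightarrow> nat \<Rightarrow> 'w \<Rightarrow> 'x \<times> 'y" where
  "mv i k \<omega> = st (Suc i) k \<omega> - st i k \<omega>"

definition inc :: "nat \<Rightarrow> nat \<Rightarrow> 'w \<Rightarrow> 'x \<times> 'y" where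
  "inc i k \<omega> = gg (Suc i) k \<omega> - gg i k \<omega>"

text \<open>Weights 1 / K give the error of the averaged estimate, indicator weights that of a
  single agent; one recursion covers both.\<close>

definition werr :: "(nat \<Rightarrow> real) \<Rightarrow> nat \<Rightarrow> 'w \<Rightarrow> 'x \<times> 'y" where
  "werr w i \<omega> = (\<Sum>k<K. w k *\<^sub>R err i k \<omega>)"

lemma rounded_bounds:
  assumes "rounded n r" "1 \<le> r"
  shows "1 \<le> n" "r \<le> 2 * real n" "real n \<le> 2 * r"
proof -
  have "int n \<ge> 1 \<and> real n \<ge> r - 1 \<and> real n \<le> r + 1"
    using assms unfolding rounded_def
  proof (elim disjE)
    assume n: "int n = \<lfloor>r\<rfloor>"
    then have "real n = real_of_int \<lfloor>r\<rfloor>" by (metis of_int_of_nat_eq)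
    then show ?thesis using n assms(2) by (simp add: le_floor_iff) linarith
  next
    assume n: "int n = \<lceil>r\<rceil>"
    then have "real n = real_of_int \<lceil>r\<rceil>" by (metis of_int_of_nat_eq)
    then show ?thesis using n assms(2) by (simp add: one_le_ceiling) linarith
  qed
  then show "1 \<le> n" "r \<le> 2 * real n" "real n \<le> 2 * r"
    using assms(2) by auto
qed

lemma sqrt_ratio_ge: "1 \<le> sqrt (real N / real K)"
  using K_le_N agents by simp

lemma batch_bounds:
  shows "1 \<le> b0" "sqrt (real N / real K) \<le> 2 * real b0" "real b0 \<le> 2 * sqrt (real N / real K)"
    and "1 \<le> b" "sqrt (real N / real K) \<le> 2 * real b" "real b \<le> 2 * sqrt (real N / real K)"
  using rounded_bounds[OF batch_init sqrt_ratio_ge] rounded_bounds[OF batch sqrt_ratio_ge] by auto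

lemma p_sqrt: "real K * sqrt (real N / real K) * p = 1"
  using K_pos' N_pos' by (simp add: prob_reset real_sqrt_divide real_sqrt_mult field_simps)

text \<open>The balance behind the choice of batch size and reset probability: K b p is 1 before
  rounding, and rounding a number at least 1 costs at most a factor 2.\<close>

lemma effective_batch: "1 \<le> 2 * (real K * real b0 * p)" "1 \<le> 2 * (real K * real b * p)"
proof -
  have "1 \<le> 2 * (real K * real n * p)" if "sqrt (real N / real K) \<le> 2 * real n" for n
  proof -
    have "real K * sqrt (real N / real K) * p \<le> real K * (2 * real n) * p"
      using that p_range by (intro mult_right_mono mult_left_mono) auto
    then show ?thesis unfolding p_sqrt by (simp add: mult_ac)
  qed
  then show "1 \<le> 2 * (real K * real b0 * p)" "1 \<le> 2 * (real K * real b * p)"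
    using batch_bounds by blast+
qed

text \<open>The variance is at most the second moment: Pythagoras with the N data points as
  blocks.\<close>

lemma sum_centered_le:
  "(1 / real N) * (\<Sum>s<N. (norm (f (\<zeta> k s) - (1 / real N) *\<^sub>R (\<Sum>s<N. f (\<zeta> k s))))\<^sup>2)
    \<le> (1 / real N) * (\<Sum>s<N. (norm (f (\<zeta> k s) :: 'x \<times> 'y))\<^sup>2)"
  using stack_norm_sq_dev_le[of N "\<lambda>s. f (\<zeta> k s)"]
  by (intro mult_left_mono) (auto simp: stack_norm_sq_def dev_def block_avg_def)

lemma sum_centered_zero:
  "(\<Sum>s<N. f (\<zeta> k s) - (1 / real N) *\<^sub>R (\<Sum>s<N. f (\<zeta> k s) :: 'x \<times> 'y)) = 0"
  using sum_dev[OF N_pos', of "\<lambda>s. f (\<zeta> k s)"] by (simp add: dev_def block_avg_def)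

lemma st_M: "k < K \<Longrightarrow> st i k \<in> borel_measurable M"
  and gg_M: "k < K \<Longrightarrow> gg i k \<in> borel_measurable M"
  using iterates_measurable measurable_Fl past_idx by blast+

lemma fg_st_Fl: "k < K \<Longrightarrow> (\<lambda>\<omega>. fg k (st i k \<omega>)) \<in> borel_measurable (Fl (past i))"
  and fg_st_Suc_Fl: "k < K \<Longrightarrow> (\<lambda>\<omega>. fg k (st (Suc i) k \<omega>)) \<in> borel_measurable (Fl (past i))"
  using measurable_compose[OF iterates_measurable(1) fg_measurable]
    measurable_compose[OF iterates_measurable(3) fg_measurable] by auto

lemma qg_st_Fl: "k < K \<Longrightarrow> s < N \<Longrightarrow> (\<lambda>\<omega>. qg k (st i k \<omega>) (\<zeta> k s)) \<in> borel_measurable (Fl (past i))"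
  and qg_st_Suc_Fl:
    "k < K \<Longrightarrow> s < N \<Longrightarrow> (\<lambda>\<omega>. qg k (st (Suc i) k \<omega>) (\<zeta> k s)) \<in> borel_measurable (Fl (past i))"
  using measurable_compose[OF iterates_measurable(1) qg_measurable]
    measurable_compose[OF iterates_measurable(3) qg_measurable] by auto

lemma err_Fl: "k < K \<Longrightarrow> err i k \<in> borel_measurable (Fl (past i))"
  unfolding err_def[abs_def] by (intro borel_measurable_diff iterates_measurable fg_st_Fl)

lemma werr_Fl: "werr w i \<in> borel_measurable (Fl (past i))"
  unfolding werr_def[abs_def] by (intro borel_measurable_sum borel_measurable_scaleR err_Fl) auto

lemma sqi_werr: "(\<And>k. k < K \<Longrightarrow> sqi (err i k)) \<Longrightarrow> sqi (werr w i)"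
  unfolding werr_def[abs_def] by (intro sqi_sum sqi_scaleR) auto

lemma mv_Fl: "k < K \<Longrightarrow> mv i k \<in> borel_measurable (Fl (past i))"
  unfolding mv_def[abs_def] by (intro borel_measurable_diff iterates_measurable)

lemma inc_M: "k < K \<Longrightarrow> inc i k \<in> borel_measurable M"
  unfolding inc_def[abs_def] by (intro borel_measurable_diff gg_M)

definition noise :: "nat \<Rightarrow> 'z \<Rightarrow> 'w \<Rightarrow> 'x \<times> 'y" where
  "noise k z \<omega> = qg k (st 0 k \<omega>) z - fg k (st 0 k \<omega>)"

lemma noise_bound:
  assumes k: "k < K"
  shows "AE \<omega> in M. (1 / real N) * (\<Sum>s<N. (norm (noise k (\<zeta> k s) \<omega>))\<^sup>2) \<le> 2 * \<sigma>\<^sup>2"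
  using variance_bound[OF k, of 0]
proof eventually_elim
  case (elim \<omega>)
  then show ?case
    by (simp add: expectation_local_law[OF data] noise_def qg_def fg_def st_def norm_prod_sq
        sum.distrib distrib_left)
qed

lemma noise_sqi:
  assumes k: "k < K" and s: "s < N"
  shows "sqi (noise k (\<zeta> k s))"
proof (rule sqi_dominated[where g = "\<lambda>_. real N * (2 * \<sigma>\<^sup>2)"])
  show "noise k (\<zeta> k s) \<in> borel_measurable M"
    unfolding noise_def[abs_def] using qg_st_Fl[OF k s, of 0] fg_st_Fl[OF k, of 0]
    by (intro borel_measurable_diff measurable_Fl[OF _ past_idx]) auto
  show "AE \<omega> in M. (norm (noise k (\<zeta> k s) \<omega>))\<^sup>2 \<le> real N * (2 * \<sigma>\<^sup>2)"
    using noise_bound[OF k]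
  proof eventually_elim
    case (elim \<omega>)
    have "(norm (noise k (\<zeta> k s) \<omega>))\<^sup>2 \<le> (\<Sum>s<N. (norm (noise k (\<zeta> k s) \<omega>))\<^sup>2)"
      using s by (intro member_le_sum) auto
    also have "\<dots> \<le> real N * (2 * \<sigma>\<^sup>2)" using elim N_pos' by (simp add: field_simps)
    finally show ?case .
  qed
qed simp

lemma noise_expectation:
  assumes k: "k < K"
  shows "(1 / real N) * (\<Sum>s<N. expectation (nsq (noise k (\<zeta> k s)))) \<le> 2 * \<sigma>\<^sup>2"
proof -
  have "(1 / real N) * (\<Sum>s<N. expectation (nsq (noise k (\<zeta> k s))))
      = expectation (\<lambda>\<omega>. (1 / real N) * (\<Sum>s<N. (norm (noise k (\<zeta> k s) \<omega>))\<^sup>2))"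
    using sqi_integrable[OF noise_sqi[OF k]] by simp
  also have "\<dots> \<le> expectation (\<lambda>_. 2 * \<sigma>\<^sup>2)"
  proof (rule integral_mono_AE)
    show "integrable M (\<lambda>\<omega>. (1 / real N) * (\<Sum>s<N. (norm (noise k (\<zeta> k s) \<omega>))\<^sup>2))"
      by (rule sqi_average_integrable) (rule noise_sqi[OF k])
  qed (use noise_bound[OF k] in auto)
  finally show ?thesis by (simp add: prob_space)
qed

lemma err_zero_eq:
  assumes "k < K" "\<omega> \<in> space M"
  shows "err 0 k \<omega> = (\<Sum>j<b0. (1 / real b0) *\<^sub>R noise k (\<xi> 0 k j \<omega>) \<omega>)"
proof -
  have "(\<Sum>j<b0. (1 / real b0) *\<^sub>R fg k (st 0 k \<omega>)) = fg k (st 0 k \<omega>)"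
    using batch_bounds(1) by (simp add: sum_constant_scaleR)
  then show ?thesis
    by (simp add: err_def gg_zero[OF assms] noise_def scaleR_diff_right sum_subtractf scaleR_sum_right)
qed

text \<open>The initial samples are fresh relative to \<open>Init\<close> and their noise is
  centred, so the squared weights add up and the batch size divides.\<close>

lemma werr_zero:
  shows "sqi (werr w 0)"
    and "expectation (nsq (werr w 0)) \<le> (\<Sum>k<K. (w k)\<^sup>2) * (2 * \<sigma>\<^sup>2) / real b0"
proof -
  define R where "R = {..<K} \<times> {..<b0}"
  define d where "d k z \<omega> = (w k / real b0) *\<^sub>R noise k z \<omega>" for k z \<omega>
  define n where "n k = (1 / real N) * (\<Sum>s<N. expectation (nsq (noise k (\<zeta> k s))))" for k
  have I: "{Init} \<subseteq> idx" by (auto simp: idx_def)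
  have d: "d k (\<zeta> k s) \<in> borel_measurable (Fl {Init})" "sqi (d k (\<zeta> k s))" if "k < K" "s < N" for k s
  proof -
    show "d k (\<zeta> k s) \<in> borel_measurable (Fl {Init})"
      unfolding d_def[abs_def] noise_def[abs_def]
      by (intro borel_measurable_scaleR borel_measurable_diff borel_measurable_const
          measurable_compose[OF st_zero_measurable qg_measurable]
          measurable_compose[OF st_zero_measurable fg_measurable] that)
    show "sqi (d k (\<zeta> k s))" unfolding d_def[abs_def] by (intro sqi_scaleR noise_sqi that)
  qed
  have zero: "(\<Sum>s<N. d k (\<zeta> k s) \<omega>) = 0" if "k < K" for k \<omega>
    using sum_centered_zero[of "qg k (st 0 k \<omega>)"]
    by (simp add: d_def noise_def fg_eq[OF that] flip: scaleR_sum_right)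
  have z0: "(\<lambda>\<omega>. 0 :: 'x \<times> 'y) \<in> borel_measurable (Fl {Init})" by simp
  note F = fresh_increments[of R 0 "{Init}" "\<lambda>\<omega>. 0" d, OF _ _ I _ z0 sqi_zero d zero]
  have eq: "werr w 0 \<omega> = 0 + (\<Sum>(k, j)\<in>R. d k (\<xi> 0 k j \<omega>) \<omega>)" if "\<omega> \<in> space M" for \<omega>
    using that by (simp add: werr_def err_zero_eq d_def R_def scaleR_sum_right flip: sum.cartesian_product)
  have R: "finite R" "R \<subseteq> {..<K} \<times> {..<batch_size 0}" by (auto simp: R_def batch_size_def)
  show "sqi (werr w 0)"
    using F(2)[OF R] by (subst sqi_cong[OF eq]) auto
  have "expectation (nsq (werr w 0))
      = expectation (\<lambda>\<omega>. (norm (0 + (\<Sum>(k, j)\<in>R. d k (\<xi> 0 k j \<omega>) \<omega>)))\<^sup>2)"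
    by (intro Bochner_Integration.integral_cong) (simp_all only: eq)
  also have "\<dots> = (\<Sum>(k, j)\<in>R. (1 / real N) * (\<Sum>s<N. expectation (nsq (d k (\<zeta> k s)))))"
    using F(3)[OF R] by simp
  also have "\<dots> = (\<Sum>k<K. real b0 * ((w k / real b0)\<^sup>2 * n k))"
    unfolding R_def d_def n_def norm_scaleR power_mult_distrib
    by (subst sum.cartesian_product[symmetric]) (simp add: sum_distrib_left mult_ac power_divide)
  also have "\<dots> \<le> (\<Sum>k<K. real b0 * ((w k / real b0)\<^sup>2 * (2 * \<sigma>\<^sup>2)))"
    using noise_expectation unfolding n_def by (intro sum_mono mult_left_mono) auto
  also have "\<dots> = (\<Sum>k<K. (w k)\<^sup>2) * (2 * \<sigma>\<^sup>2) / real b0"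
    using batch_bounds(1)
    by (simp add: sum_distrib_right sum_divide_distrib power_divide power2_eq_square)
  finally show "expectation (nsq (werr w 0)) \<le> (\<Sum>k<K. (w k)\<^sup>2) * (2 * \<sigma>\<^sup>2) / real b0" .
qed

definition dq :: "nat \<Rightarrow> nat \<Rightarrow> 'z \<Rightarrow> 'w \<Rightarrow> 'x \<times> 'y" where
  "dq i k z \<omega> = qg k (st (Suc i) k \<omega>) z - qg k (st i k \<omega>) z"

definition df :: "nat \<Rightarrow> nat \<Rightarrow> 'w \<Rightarrow> 'x \<times> 'y" where
  "df i k \<omega> = fg k (st (Suc i) k \<omega>) - fg k (st i k \<omega>)"

lemma df_eq: "k < K \<Longrightarrow> df i k \<omega> = (1 / real N) *\<^sub>R (\<Sum>s<N. dq i k (\<zeta> k s) \<omega>)"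
  by (simp add: df_def dq_def fg_eq sum_subtractf scaleR_diff_right)

lemma dq_Fl: "k < K \<Longrightarrow> s < N \<Longrightarrow> dq i k (\<zeta> k s) \<in> borel_measurable (Fl (past i))"
  unfolding dq_def[abs_def] by (intro borel_measurable_diff qg_st_Fl qg_st_Suc_Fl)

lemma df_Fl: "k < K \<Longrightarrow> df i k \<in> borel_measurable (Fl (past i))"
  unfolding df_def[abs_def] by (intro borel_measurable_diff fg_st_Fl fg_st_Suc_Fl)

lemma df_le: "k < K \<Longrightarrow> (norm (df i k \<omega>))\<^sup>2 \<le> 2 * Lf\<^sup>2 * (norm (mv i k \<omega>))\<^sup>2"
  unfolding df_def mv_def by (rule fg_smooth)

lemma df_sqi: "k < K \<Longrightarrow> sqi (mv i k) \<Longrightarrow> sqi (df i k)"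
  using df_le by (intro sqi_dominated[where g = "\<lambda>\<omega>. 2 * Lf\<^sup>2 * (norm (mv i k \<omega>))\<^sup>2"])
    (auto intro: measurable_Fl[OF df_Fl past_idx] dest: sqi_integrable)

lemma dq_sqi: "k < K \<Longrightarrow> s < N \<Longrightarrow> sqi (mv i k) \<Longrightarrow> sqi (dq i k (\<zeta> k s))"
  using qg_lipschitz[of k s "st (Suc i) k _" "st i k _"]
  by (intro sqi_dominated[where g = "\<lambda>\<omega>. 2 * real N * Lf\<^sup>2 * (norm (mv i k \<omega>))\<^sup>2"])
    (auto intro: measurable_Fl[OF dq_Fl past_idx] dest: sqi_integrable simp: dq_def mv_def)

lemma dq_expectation:
  assumes k: "k < K" and mv: "sqi (mv i k)"
  shows "(1 / real N) * (\<Sum>s<N. expectation (nsq (dq i k (\<zeta> k s))))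
    \<le> 2 * Lf\<^sup>2 * expectation (nsq (mv i k))"
proof -
  have "(1 / real N) * (\<Sum>s<N. expectation (nsq (dq i k (\<zeta> k s))))
      = expectation (\<lambda>\<omega>. (1 / real N) * (\<Sum>s<N. (norm (dq i k (\<zeta> k s) \<omega>))\<^sup>2))"
    using sqi_integrable[OF dq_sqi[OF k _ mv]] by simp
  also have "\<dots> \<le> expectation (\<lambda>\<omega>. 2 * Lf\<^sup>2 * (norm (mv i k \<omega>))\<^sup>2)"
    using sqi_integrable[OF mv] qg_smooth[OF k]
    by (intro integral_mono sqi_average_integrable dq_sqi[OF k _ mv]) (auto simp: dq_def mv_def)
  finally show ?thesis by simp
qed

lemma err_Suc:
  assumes "k < K" "\<omega> \<in> space M"
  shows "err (Suc i) k \<omega> = (if \<pi> (Suc i) \<omega> then 0 else err i k \<omega>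
    + (\<Sum>j<b. (1 / real b) *\<^sub>R (dq i k (\<xi> (Suc i) k j \<omega>) \<omega> - df i k \<omega>)))"
proof -
  have "(\<Sum>j<b. (1 / real b) *\<^sub>R df i k \<omega>) = df i k \<omega>"
    using batch_bounds(4) by (simp add: sum_constant_scaleR)
  then show ?thesis
    by (simp add: err_def gg_Suc[OF assms] dq_def scaleR_diff_right sum_subtractf scaleR_sum_right)
      (simp add: df_def)
qed

text \<open>Without a reset the error grows by centred minibatch differences, orthogonal to the old
  error; a reset annihilates it, which contributes the factor 1 - p.\<close>

lemma werr_Suc:
  assumes e: "\<And>k. k < K \<Longrightarrow> sqi (err i k)" and mv: "\<And>k. k < K \<Longrightarrow> sqi (mv i k)"
  shows "sqi (werr w (Suc i))"
    and "expectation (nsq (werr w (Suc i)))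
      \<le> (1 - p) * expectation (nsq (werr w i))
        + (\<Sum>k<K. (w k)\<^sup>2 / real b * (2 * Lf\<^sup>2 * expectation (nsq (mv i k))))"
proof -
  define R where "R = {..<K} \<times> {..<b}"
  define d where "d k z \<omega> = (w k / real b) *\<^sub>R (dq i k z \<omega> - df i k \<omega>)" for k z \<omega>
  define n where "n k = (1 / real N) * (\<Sum>s<N. expectation (\<lambda>\<omega>. (norm (dq i k (\<zeta> k s) \<omega> - df i k \<omega>))\<^sup>2))" for k
  define f where "f \<omega> = werr w i \<omega> + (\<Sum>(k, j)\<in>R. d k (\<xi> (Suc i) k j \<omega>) \<omega>)" for \<omega>
  have d: "d k (\<zeta> k s) \<in> borel_measurable (Fl (past i))" "sqi (d k (\<zeta> k s))" if "k < K" "s < N" for k s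
    unfolding d_def[abs_def] using that
    by (auto intro!: borel_measurable_scaleR borel_measurable_diff dq_Fl df_Fl
        sqi_scaleR sqi_diff dq_sqi df_sqi mv)
  have zero: "(\<Sum>s<N. d k (\<zeta> k s) \<omega>) = 0" if "k < K" for k \<omega>
    using sum_centered_zero[of "\<lambda>z. dq i k z \<omega>"]
    by (simp add: d_def df_eq[OF that] flip: scaleR_sum_right)
  have R: "finite R" "R \<subseteq> {..<K} \<times> {..<batch_size (Suc i)}"
    "\<And>k j. (k, j) \<in> R \<Longrightarrow> Sample (Suc i) k j \<notin> past i"
    by (auto simp: R_def batch_size_def past_def)
  let ?B = "past i \<union> (\<lambda>(k, j). Sample (Suc i) k j) ` R"
  note F = fresh_increments[of R "Suc i" "past i" "werr w i" d,
      OF R(1,2) past_idx R(3) werr_Fl sqi_werr[OF e] d zero, folded f_def]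
  \<comment> \<open>The coin must be independent of the new samples too, so they are included in the
    sigma-algebra.\<close>
  have B: "?B \<subseteq> idx" "Coin (Suc i) \<notin> ?B"
    using past_idx R(2) by (auto simp: idx_def past_def)
  have f2: "(nsq f) \<in> borel_measurable (Fl ?B)"
    using F(1) by measurable
  have int: "integrable M (nsq f)" using F(2) by (rule sqi_integrable)
  have eq: "(norm (werr w (Suc i) \<omega>))\<^sup>2 = (if \<pi> (Suc i) \<omega> then 0 else (norm (f \<omega>))\<^sup>2)" if "\<omega> \<in> space M" for \<omega>
    using that by (simp add: werr_def err_Suc d_def R_def f_def scaleR_sum_right scaleR_add_right sum.distrib
        flip: sum.cartesian_product)
  note C = coin_expectation[OF B(1) _ B(2) f2 int]
  have "integrable M (nsq (werr w (Suc i)))"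
    using C(2) by (subst Bochner_Integration.integrable_cong[OF refl eq]) auto
  then show "sqi (werr w (Suc i))"
    unfolding sqi_def using measurable_Fl[OF werr_Fl past_idx] by blast
  have "expectation (nsq (werr w (Suc i))) = (1 - p) * expectation (nsq f)"
    using C(4) by (subst Bochner_Integration.integral_cong[OF refl eq]) auto
  also have "expectation (nsq f) = expectation (nsq (werr w i))
      + (\<Sum>(k, j)\<in>R. (1 / real N) * (\<Sum>s<N. expectation (nsq (d k (\<zeta> k s)))))"
    by (rule F(3))
  also have "(\<Sum>(k, j)\<in>R. (1 / real N) * (\<Sum>s<N. expectation (nsq (d k (\<zeta> k s)))))
      = (\<Sum>k<K. real b * ((w k / real b)\<^sup>2 * n k))"
    unfolding R_def d_def n_def norm_scaleR power_mult_distrib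
    by (subst sum.cartesian_product[symmetric]) (simp add: sum_distrib_left mult_ac power_divide)
  also have "\<dots> = (\<Sum>k<K. (w k)\<^sup>2 / real b * n k)"
    using batch_bounds(4) by (simp add: power_divide power2_eq_square)
  finally have 1: "expectation (nsq (werr w (Suc i)))
      = (1 - p) * (expectation (nsq (werr w i)) + (\<Sum>k<K. (w k)\<^sup>2 / real b * n k))" .
  have n: "n k \<le> 2 * Lf\<^sup>2 * expectation (nsq (mv i k))" if k: "k < K" for k
  proof -
    have "n k = expectation (\<lambda>\<omega>. (1 / real N) * (\<Sum>s<N. (norm (dq i k (\<zeta> k s) \<omega> - df i k \<omega>))\<^sup>2))"
      unfolding n_def using sqi_integrable[OF sqi_diff[OF dq_sqi[OF k _ mv[OF k]] df_sqi[OF k mv[OF k]]]] by simp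
    also have "\<dots> \<le> expectation (\<lambda>\<omega>. (1 / real N) * (\<Sum>s<N. (norm (dq i k (\<zeta> k s) \<omega>))\<^sup>2))"
    proof (rule integral_mono)
      show "(1 / real N) * (\<Sum>s<N. (norm (dq i k (\<zeta> k s) \<omega> - df i k \<omega>))\<^sup>2)
          \<le> (1 / real N) * (\<Sum>s<N. (norm (dq i k (\<zeta> k s) \<omega>))\<^sup>2)" for \<omega>
        unfolding df_eq[OF k] by (rule sum_centered_le)
    qed (intro sqi_average_integrable sqi_diff dq_sqi df_sqi k mv; assumption)+
    also have "\<dots> = (1 / real N) * (\<Sum>s<N. expectation (nsq (dq i k (\<zeta> k s))))"
      using sqi_integrable[OF dq_sqi[OF k _ mv[OF k]]] by simp
    also have "\<dots> \<le> 2 * Lf\<^sup>2 * expectation (nsq (mv i k))"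
      by (rule dq_expectation[OF k mv[OF k]])
    finally show ?thesis .
  qed
  let ?r = "\<Sum>k<K. (w k)\<^sup>2 / real b * (2 * Lf\<^sup>2 * expectation (nsq (mv i k)))"
  have r: "(\<Sum>k<K. (w k)\<^sup>2 / real b * n k) \<le> ?r"
    using n by (intro sum_mono mult_left_mono) auto
  have r0: "0 \<le> ?r" by (intro sum_nonneg mult_nonneg_nonneg) auto
  have "(1 - p) * (\<Sum>k<K. (w k)\<^sup>2 / real b * n k) \<le> (1 - p) * ?r"
    using r p_range by (intro mult_left_mono) auto
  also have "\<dots> \<le> ?r" using r0 p_range by (intro mult_left_le_one_le) auto
  finally show "expectation (nsq (werr w (Suc i)))
      \<le> (1 - p) * expectation (nsq (werr w i)) + ?r"
    unfolding 1 by (simp add: distrib_left)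
qed

text \<open>On a reset the estimate jumps by \<open>df - err\<close>, otherwise by a minibatch
  average of \<open>dq\<close>. Hence the local error enters only with weight p.\<close>

lemma inc_second_moment:
  assumes k: "k < K" and e: "sqi (err i k)" and mv: "sqi (mv i k)"
  shows "sqi (inc i k)"
    and "expectation (nsq (inc i k))
      \<le> 4 * Lf\<^sup>2 * expectation (nsq (mv i k)) + 2 * p * expectation (nsq (err i k))"
proof -
  define m where "m = expectation (nsq (mv i k))"
  define R where "R = (\<lambda>j. Sample (Suc i) k j) ` {..<b}"
  let ?B = "past i \<union> R"
  define f1 where "f1 \<omega> = df i k \<omega> - err i k \<omega>" for \<omega>
  define f2 where "f2 \<omega> = (1 / real b) *\<^sub>R (\<Sum>j<b. dq i k (\<xi> (Suc i) k j \<omega>) \<omega>)" for \<omega>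
  have B: "?B \<subseteq> idx" "Coin (Suc i) \<notin> ?B"
    using past_idx k by (auto simp: R_def idx_def past_def batch_size_def)
  have f1: "sqi f1" unfolding f1_def[abs_def] by (intro sqi_diff df_sqi k mv e)
  have fresh: "Sample (Suc i) k j \<in> idx" "Sample (Suc i) k j \<notin> past i" if "j < b" for j
    using that k by (auto simp: idx_def past_def batch_size_def)
  note S = fresh_sqi[of "past i" "Suc i" k _ "dq i k", OF past_idx fresh dq_Fl[OF k] dq_sqi[OF k _ mv]]
  have Sm: "(\<lambda>\<omega>. dq i k (\<xi> (Suc i) k j \<omega>) \<omega>) \<in> borel_measurable (Fl ?B)" if "j < b" for j
    by (rule measurable_Fl_mono[OF S(1)[OF that that] _ B(1)]) (use that in \<open>auto simp: R_def\<close>)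
  have f2: "sqi f2" unfolding f2_def[abs_def] by (intro sqi_scaleR sqi_sum S(2)) auto
  have f1m: "(nsq f1) \<in> borel_measurable (Fl ?B)"
  proof -
    have "f1 \<in> borel_measurable (Fl ?B)"
      unfolding f1_def[abs_def]
      by (intro borel_measurable_diff measurable_Fl_mono[OF df_Fl[OF k] _ B(1)]
          measurable_Fl_mono[OF err_Fl[OF k] _ B(1)]) auto
    then show ?thesis by measurable
  qed
  have f2m: "(nsq f2) \<in> borel_measurable (Fl ?B)"
  proof -
    have "f2 \<in> borel_measurable (Fl ?B)"
      unfolding f2_def[abs_def] using Sm by (intro borel_measurable_scaleR borel_measurable_sum) auto
    then show ?thesis by measurable
  qed
  note C1 = coin_expectation[OF B(1) _ B(2) f1m sqi_integrable[OF f1]]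
    and C2 = coin_expectation[OF B(1) _ B(2) f2m sqi_integrable[OF f2]]
  have eq: "(norm (inc i k \<omega>))\<^sup>2 = (if \<pi> (Suc i) \<omega> then (norm (f1 \<omega>))\<^sup>2 else 0)
      + (if \<pi> (Suc i) \<omega> then 0 else (norm (f2 \<omega>))\<^sup>2)" if "\<omega> \<in> space M" for \<omega>
    using that by (simp add: inc_def gg_Suc[OF k] f1_def f2_def df_def dq_def err_def)
  have int: "integrable M (\<lambda>\<omega>. (if \<pi> (Suc i) \<omega> then (norm (f1 \<omega>))\<^sup>2 else 0)
      + (if \<pi> (Suc i) \<omega> then 0 else (norm (f2 \<omega>))\<^sup>2))"
    using C1(1) C2(2) by (intro Bochner_Integration.integrable_add) auto
  have "integrable M (nsq (inc i k))"
    using int by (subst Bochner_Integration.integrable_cong[OF refl eq])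
  then show "sqi (inc i k)" unfolding sqi_def using inc_M[OF k] by blast
  have "expectation (nsq (inc i k))
      = p * expectation (nsq f1) + (1 - p) * expectation (nsq f2)"
    using C1 C2 by (subst Bochner_Integration.integral_cong[OF refl eq]) auto
  also have "\<dots> \<le> p * (4 * Lf\<^sup>2 * m + 2 * expectation (nsq (err i k))) + (1 - p) * (2 * Lf\<^sup>2 * m)"
  proof (intro add_mono mult_left_mono)
    have "expectation (nsq f1)
        \<le> expectation (\<lambda>\<omega>. 4 * Lf\<^sup>2 * (norm (mv i k \<omega>))\<^sup>2 + 2 * (norm (err i k \<omega>))\<^sup>2)"
    proof (rule integral_mono)
      show "(norm (f1 \<omega>))\<^sup>2 \<le> 4 * Lf\<^sup>2 * (norm (mv i k \<omega>))\<^sup>2 + 2 * (norm (err i k \<omega>))\<^sup>2" for \<omega>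
        using norm_diff_sq_le[of "df i k \<omega>" "err i k \<omega>"] df_le[OF k, of i \<omega>] by (simp add: f1_def)
    qed (use sqi_integrable[OF f1] sqi_integrable[OF mv] sqi_integrable[OF e] in auto)
    then show "expectation (nsq f1) \<le> 4 * Lf\<^sup>2 * m + 2 * expectation (nsq (err i k))"
      using sqi_integrable[OF mv] sqi_integrable[OF e] by (simp add: m_def)
    have "expectation (nsq f2)
        \<le> expectation (\<lambda>\<omega>. (1 / real b) * (\<Sum>j<b. (norm (dq i k (\<xi> (Suc i) k j \<omega>) \<omega>))\<^sup>2))"
      using sqi_integrable[OF f2] unfolding f2_def
      by (intro integral_mono norm_average_sq_le sqi_average_integrable S(2)) auto
    also have "\<dots> = (1 / real b) * (\<Sum>j<b. expectation (\<lambda>\<omega>. (norm (dq i k (\<xi> (Suc i) k j \<omega>) \<omega>))\<^sup>2))"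
      using sqi_integrable[OF S(2)] by simp
    also have "\<dots> = (1 / real b) * (\<Sum>j<b. (1 / real N) * (\<Sum>s<N. expectation (nsq (dq i k (\<zeta> k s)))))"
      using S(3) by (intro arg_cong[where f = "\<lambda>t. (1 / real b) * t"] sum.cong) auto
    also have "\<dots> = (1 / real N) * (\<Sum>s<N. expectation (nsq (dq i k (\<zeta> k s))))"
      using batch_bounds(4) by simp
    also have "\<dots> \<le> 2 * Lf\<^sup>2 * m" unfolding m_def by (rule dq_expectation[OF k mv])
    finally show "expectation (nsq f2) \<le> 2 * Lf\<^sup>2 * m" .
  qed (use p_range in auto)
  also have "\<dots> = 2 * Lf\<^sup>2 * m + p * (2 * Lf\<^sup>2 * m) + 2 * p * expectation (nsq (err i k))"
    by (simp add: algebra_simps)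
  also have "p * (2 * Lf\<^sup>2 * m) \<le> 2 * Lf\<^sup>2 * m"
    using p_range by (intro mult_left_le_one_le) (auto simp: m_def)
  finally show "expectation (nsq (inc i k))
      \<le> 4 * Lf\<^sup>2 * expectation (nsq (mv i k)) + 2 * p * expectation (nsq (err i k))"
    by (simp add: m_def)
qed

end

section \<open>Stationarity\<close>

context page_run
begin

definition ctr :: "nat \<Rightarrow> 'w \<Rightarrow> 'x \<times> 'y" where
  "ctr i \<omega> = block_avg K (\<lambda>k. st i k \<omega>)"

definition gc :: "nat \<Rightarrow> 'w \<Rightarrow> 'x \<times> 'y" where
  "gc i \<omega> = block_avg K (\<lambda>k. gg i k \<omega>)"

definition gJ :: "nat \<Rightarrow> 'w \<Rightarrow> 'x \<times> 'y" where
  "gJ i \<omega> = (gradJx (xc i \<omega>) (yc i \<omega>), gradJy (xc i \<omega>) (yc i \<omega>))"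

definition Ec :: "nat \<Rightarrow> 'w \<Rightarrow> 'x \<times> 'y" where
  "Ec i \<omega> = gJ i \<omega> - gc i \<omega>"

definition dv :: "nat \<Rightarrow> 'w \<Rightarrow> real" where
  "dv i \<omega> = stack_norm_sq K (dev K (\<lambda>k. st i k \<omega>))"

text \<open>The quantity whose sum the potential controls. It carries the two step sizes as weights,
  which differ by the factor 256 \<kappa>^2.\<close>

definition gw :: "nat \<Rightarrow> 'w \<Rightarrow> real" where
  "gw i \<omega> = \<mu>x * (norm (fst (gc i \<omega>)))\<^sup>2 + \<mu>y * (norm (snd (gc i \<omega>)))\<^sup>2"

lemma ctr_eq: "ctr i \<omega> = (xc i \<omega>, yc i \<omega>)"
  by (simp add: ctr_def st_def block_avg_Pair) (simp add: block_avg_def xc_def yc_def)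

lemma gJ_eq: "gJ i \<omega> = block_avg K (\<lambda>k. fg k (ctr i \<omega>))"
  by (simp add: gJ_def ctr_eq block_avg_fg)

lemma ctr_Suc: "\<omega> \<in> space M \<Longrightarrow> ctr (Suc i) \<omega> = ctr i \<omega> + sc (gc i \<omega>)"
  using atc_gt_dynamics.block_avg_Suc[OF dynamics, of \<omega> i] by (simp add: ctr_def gc_def block_avg_sc)

lemma dv_nonneg: "0 \<le> dv i \<omega>"
  by (simp add: dv_def stack_norm_sq_nonneg)

lemma norm_sc_gc: "(norm (sc (gc i \<omega>)))\<^sup>2 \<le> \<mu>y * gw i \<omega>"
proof -
  have "\<mu>x * (\<mu>x * (norm (fst (gc i \<omega>)))\<^sup>2) \<le> \<mu>y * (\<mu>x * (norm (fst (gc i \<omega>)))\<^sup>2)"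
    using step_x_le step_x_pos by (intro mult_right_mono) auto
  moreover have "(norm (sc (gc i \<omega>)))\<^sup>2
      = \<mu>x * (\<mu>x * (norm (fst (gc i \<omega>)))\<^sup>2) + \<mu>y * (\<mu>y * (norm (snd (gc i \<omega>)))\<^sup>2)"
    by (subst norm_prod_sq) (simp add: sc_def power_mult_distrib, simp add: power2_eq_square)
  ultimately show ?thesis by (simp add: gw_def algebra_simps)
qed

lemma descent:
  assumes "\<omega> \<in> space M"
  shows "gw i \<omega> \<le> 8 * (PL.potential (xc i \<omega>) (yc i \<omega>) - PL.potential (xc (Suc i) \<omega>) (yc (Suc i) \<omega>))
    + 8 * \<mu>y * (norm (Ec i \<omega>))\<^sup>2"
proof -
  have "xc (Suc i) \<omega> = xc i \<omega> - \<mu>x *\<^sub>R fst (gc i \<omega>)" "yc (Suc i) \<omega> = yc i \<omega> + \<mu>y *\<^sub>R snd (gc i \<omega>)"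
    using ctr_Suc[OF assms, of i] by (simp_all add: ctr_eq sc_def)
  then have "gw i \<omega> \<le> 8 * (PL.potential (xc i \<omega>) (yc i \<omega>) - PL.potential (xc (Suc i) \<omega>) (yc (Suc i) \<omega>))
      + 8 * (\<mu>x * (norm (fst (Ec i \<omega>)))\<^sup>2 + \<mu>y * (norm (snd (Ec i \<omega>)))\<^sup>2)"
    using PL.descent_step[OF step_y_pos Lf_step_y step_x, of "fst (gc i \<omega>)" "snd (gc i \<omega>)" "xc i \<omega>" "yc i \<omega>"]
    by (simp add: gw_def Ec_def gJ_def)
  moreover have "\<mu>x * (norm (fst (Ec i \<omega>)))\<^sup>2 \<le> \<mu>y * (norm (fst (Ec i \<omega>)))\<^sup>2"
    using step_x_le by (intro mult_right_mono) auto
  ultimately show ?thesis by (simp add: norm_prod_sq algebra_simps)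
qed

lemma descent_sum:
  assumes "\<omega> \<in> space M"
  shows "(\<Sum>i<n. gw i \<omega>) \<le> 8 * (Gp0 \<omega> + Deltac0 \<omega>) + 8 * \<mu>y * (\<Sum>i<n. (norm (Ec i \<omega>))\<^sup>2)"
proof -
  have "(\<Sum>i<n. gw i \<omega>) \<le> 8 * (PL.potential (xc 0 \<omega>) (yc 0 \<omega>) - PL.potential (xc n \<omega>) (yc n \<omega>))
      + 8 * \<mu>y * (\<Sum>i<n. (norm (Ec i \<omega>))\<^sup>2)"
  proof (induction n)
    case (Suc n)
    then show ?case using descent[OF assms, of n] by (simp add: algebra_simps)
  qed simp
  then show ?thesis
    using PL.potential_nonneg[of "xc n \<omega>" "yc n \<omega>"]
    by (simp add: PL.potential_def[of "xc 0 \<omega>"] Gp0_def Deltac0_def)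
qed

text \<open>\<open>Z 0\<close> is the doubly mixed, scaled initial estimate, so its deviation is the
  scaled vector behind \<open>zeta0_sq\<close>; since \<mu>x is at most \<mu>y, the factor \<mu>y^2
  covers both components.\<close>

lemma initial_deviation:
  assumes "\<omega> \<in> space M"
  shows "stack_norm_sq K (dev K (atc_gt_dynamics.Z W (\<lambda>i k. st i k \<omega>) 0)) \<le> \<mu>y\<^sup>2 * (devx0 \<omega> + devy0 \<omega>)"
proof -
  interpret D: atc_gt_dynamics K W lam "\<lambda>i k. st i k \<omega>" "\<lambda>i k. sc (gg i k \<omega>)" "\<lambda>i k. dl i k \<omega>"
    "(x0 \<omega>, y0 \<omega>)" "(u0 \<omega>, v0 \<omega>)" by (rule dynamics[OF assms])
  have avg: "kron_id (averaging_mat K) f k = block_avg K f" if "k < K"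
    for f :: "nat \<Rightarrow> 'v::real_vector" and k
    using that by (simp add: kron_id_def averaging_mat_def block_avg_def scaleR_sum_right)
  have "dev K (D.Z 0) k = sc (atc_gt_A W (\<lambda>l. gx 0 l \<omega>) k - kron_id (averaging_mat K) (\<lambda>l. gx 0 l \<omega>) k,
      atc_gt_A W (\<lambda>l. gy 0 l \<omega>) k - kron_id (averaging_mat K) (\<lambda>l. gy 0 l \<omega>) k)" if k: "k < K" for k
  proof -
    have sc: "kron_id W (\<lambda>l. sc (f l)) = (\<lambda>k. sc (kron_id W f k))" for f :: "nat \<Rightarrow> 'x \<times> 'y"
      by (simp add: fun_eq_iff sc_def kron_id_Pair kron_id_scaleR prod_eq_iff)
        (simp add: kron_id_def fst_sum snd_sum sum_negf scaleR_sum_right mult.commute)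
    have "block_avg K (D.Z 0) = block_avg K (kron_id W (kron_id W (\<lambda>l. sc (gg 0 l \<omega>))))"
      by (intro block_avg_cong D.Z_zero)
    then have "dev K (D.Z 0) k = sc (atc_gt_A W (\<lambda>l. gg 0 l \<omega>) k) - sc (block_avg K (\<lambda>l. gg 0 l \<omega>))"
      by (simp add: dev_def D.Z_zero[OF k] mix.block_avg_kron_id block_avg_sc sc atc_gt_A_def)
    then show ?thesis
      by (simp add: sc_diff[symmetric] gg_def atc_gt_A_Pair block_avg_Pair avg[OF k])
  qed
  then have "stack_norm_sq K (dev K (D.Z 0))
      \<le> (\<Sum>k<K. \<mu>y\<^sup>2 * (norm (atc_gt_A W (\<lambda>l. gx 0 l \<omega>) k - kron_id (averaging_mat K) (\<lambda>l. gx 0 l \<omega>) k,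
        atc_gt_A W (\<lambda>l. gy 0 l \<omega>) k - kron_id (averaging_mat K) (\<lambda>l. gy 0 l \<omega>) k))\<^sup>2)"
    unfolding stack_norm_sq_def by (intro sum_mono) (simp only: norm_sc_le lessThan_iff)
  also have "\<dots> = \<mu>y\<^sup>2 * (devx0 \<omega> + devy0 \<omega>)"
    by (simp add: norm_prod_sq devx0_def devy0_def stack_norm_sq_def sum.distrib
        flip: sum_distrib_left)
  finally show ?thesis .
qed

lemma consensus_Suc:
  assumes "\<omega> \<in> space M"
  shows "(\<Sum>i\<le>Suc n. dv i \<omega>) \<le> \<mu>y\<^sup>2 * (devx0 \<omega> + devy0 \<omega>) / (1 - lam) ^ 3
    + \<mu>y\<^sup>2 * (\<Sum>i<n. \<Sum>k<K. (norm (inc i k \<omega>))\<^sup>2) / (1 - lam) ^ 4"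
proof -
  interpret D: atc_gt_dynamics K W lam "\<lambda>i k. st i k \<omega>" "\<lambda>i k. sc (gg i k \<omega>)" "\<lambda>i k. dl i k \<omega>"
    "(x0 \<omega>, y0 \<omega>)" "(u0 \<omega>, v0 \<omega>)" by (rule dynamics[OF assms])
  have H: "stack_norm_sq K (D.H i) \<le> \<mu>y\<^sup>2 * (\<Sum>k<K. (norm (inc i k \<omega>))\<^sup>2)" for i
    unfolding stack_norm_sq_def D.H_def inc_def sum_distrib_left
    by (intro sum_mono) (simp only: norm_sc_le sc_diff[symmetric])
  have "(\<Sum>i<n. stack_norm_sq K (D.H i)) \<le> \<mu>y\<^sup>2 * (\<Sum>i<n. \<Sum>k<K. (norm (inc i k \<omega>))\<^sup>2)"
    unfolding sum_distrib_left[of _ _ "{..<n}"] by (intro sum_mono H)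
  then have "(\<Sum>i<n. stack_norm_sq K (D.H i)) / (1 - lam) ^ 4
      \<le> \<mu>y\<^sup>2 * (\<Sum>i<n. \<Sum>k<K. (norm (inc i k \<omega>))\<^sup>2) / (1 - lam) ^ 4"
    using lam_less by (intro divide_right_mono) auto
  moreover have "stack_norm_sq K (dev K (D.Z 0)) / (1 - lam) ^ 3
      \<le> \<mu>y\<^sup>2 * (devx0 \<omega> + devy0 \<omega>) / (1 - lam) ^ 3"
    using lam_less initial_deviation[OF assms] by (intro divide_right_mono) auto
  ultimately show ?thesis
    using D.consensus_bound[of n] unfolding dv_def by linarith
qed

text \<open>An agent moves by the step of the centroid plus the change of its own deviation.\<close>

lemma mv_sum_le:
  assumes "\<omega> \<in> space M"
  shows "(\<Sum>k<K. (norm (mv i k \<omega>))\<^sup>2)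
    \<le> 2 * real K * (norm (sc (gc i \<omega>)))\<^sup>2 + 4 * dv i \<omega> + 4 * dv (Suc i) \<omega>"
proof -
  let ?d = "\<lambda>i k. dev K (\<lambda>k. st i k \<omega>) k"
  have "(norm (mv i k \<omega>))\<^sup>2 \<le> 2 * (norm (sc (gc i \<omega>)))\<^sup>2 + 4 * (norm (?d i k))\<^sup>2 + 4 * (norm (?d (Suc i) k))\<^sup>2" for k
  proof -
    have "mv i k \<omega> = sc (gc i \<omega>) + (?d (Suc i) k - ?d i k)"
      using ctr_Suc[OF assms, of i] by (simp add: mv_def dev_def ctr_def)
    then have "(norm (mv i k \<omega>))\<^sup>2 \<le> 2 * (norm (sc (gc i \<omega>)))\<^sup>2 + 2 * (norm (?d (Suc i) k - ?d i k))\<^sup>2"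
      by (simp only: norm_add_sq_le)
    then show ?thesis using norm_diff_sq_le[of "?d (Suc i) k" "?d i k"] by linarith
  qed
  then have "(\<Sum>k<K. (norm (mv i k \<omega>))\<^sup>2)
      \<le> (\<Sum>k<K. 2 * (norm (sc (gc i \<omega>)))\<^sup>2 + 4 * (norm (?d i k))\<^sup>2 + 4 * (norm (?d (Suc i) k))\<^sup>2)"
    by (intro sum_mono)
  then show ?thesis
    by (simp add: sum.distrib dv_def stack_norm_sq_def sum_distrib_left mult_ac)
qed

text \<open>Split at the average of the exact local gradients at the local iterates: one part is a
  consensus error, the other the averaged sampling error.\<close>

lemma Ec_le: "(norm (Ec i \<omega>))\<^sup>2
    \<le> 4 * Lf\<^sup>2 / real K * dv i \<omega> + 2 * (norm (werr (\<lambda>_. 1 / real K) i \<omega>))\<^sup>2"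
proof -
  let ?a = "(1 / real K) *\<^sub>R (\<Sum>k<K. fg k (ctr i \<omega>) - fg k (st i k \<omega>))"
  have "Ec i \<omega> = ?a - werr (\<lambda>_. 1 / real K) i \<omega>"
    by (simp add: Ec_def gJ_eq gc_def block_avg_def werr_def err_def sum_subtractf scaleR_diff_right
        flip: scaleR_sum_right)
  then have 1: "(norm (Ec i \<omega>))\<^sup>2 \<le> 2 * (norm ?a)\<^sup>2 + 2 * (norm (werr (\<lambda>_. 1 / real K) i \<omega>))\<^sup>2"
    by (simp only: norm_diff_sq_le)
  have "(norm ?a)\<^sup>2 \<le> (1 / real K) * (\<Sum>k<K. (norm (fg k (ctr i \<omega>) - fg k (st i k \<omega>)))\<^sup>2)"
    by (rule norm_average_sq_le)
  also have "\<dots> \<le> (1 / real K) * (\<Sum>k<K. 2 * Lf\<^sup>2 * (norm (dev K (\<lambda>k. st i k \<omega>) k))\<^sup>2)"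
    using fg_smooth[of _ "ctr i \<omega>" "st i _ \<omega>"]
    by (intro mult_left_mono sum_mono) (auto simp: dev_def ctr_def norm_minus_commute)
  also have "\<dots> = 2 * Lf\<^sup>2 / real K * dv i \<omega>"
    by (simp add: dv_def stack_norm_sq_def sum_distrib_left)
  finally show ?thesis using 1 by simp
qed

lemma ctr_M: "ctr i \<in> borel_measurable M"
  unfolding ctr_def[abs_def] block_avg_def
  by (intro borel_measurable_scaleR borel_measurable_sum st_M) auto

lemma gc_M: "gc i \<in> borel_measurable M"
  unfolding gc_def[abs_def] block_avg_def
  by (intro borel_measurable_scaleR borel_measurable_sum gg_M) auto

lemma gJ_M: "gJ i \<in> borel_measurable M"
  unfolding gJ_eq[abs_def] block_avg_def
  by (intro borel_measurable_scaleR borel_measurable_sum measurable_compose[OF ctr_M fg_measurable]) auto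

lemma mv_M: "k < K \<Longrightarrow> mv i k \<in> borel_measurable M"
  by (rule measurable_Fl[OF mv_Fl past_idx])

lemma dv_M: "dv i \<in> borel_measurable M"
proof -
  have "(\<lambda>\<omega>. st i k \<omega> - ctr i \<omega>) \<in> borel_measurable M" if "k < K" for k
    using st_M[OF that] ctr_M by (rule borel_measurable_diff)
  then show ?thesis
    unfolding dv_def[abs_def] stack_norm_sq_def dev_def ctr_def[symmetric]
    by (intro borel_measurable_sum borel_measurable_power borel_measurable_norm) auto
qed

lemma werr_indicator: "k < K \<Longrightarrow> werr (\<lambda>j. if j = k then 1 else 0) i = err i k"
  by (simp add: fun_eq_iff werr_def if_distrib[of "\<lambda>t. t *\<^sub>R _"] sum.delta cong: if_cong)

text \<open>The lag in \<open>consensus_bound\<close> matters: increments below n already control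
  deviations up to n + 1, which lets the induction advance.\<close>

lemma dv_integrable:
  assumes inc: "\<And>i k. i < n \<Longrightarrow> k < K \<Longrightarrow> sqi (inc i k)" and i: "i \<le> Suc n"
  shows "integrable M (dv i)"
proof (rule Bochner_Integration.integrable_bound)
  let ?B = "\<lambda>\<omega>. \<mu>y\<^sup>2 * (devx0 \<omega> + devy0 \<omega>) / (1 - lam) ^ 3
    + \<mu>y\<^sup>2 * (\<Sum>i<n. \<Sum>k<K. (norm (inc i k \<omega>))\<^sup>2) / (1 - lam) ^ 4"
  have dev: "integrable M devx0" "integrable M devy0"
    using finite_init by (auto simp: finite_initial_quantities_def)
  show "integrable M ?B"
    using sqi_integrable[OF inc] dev
    by (intro Bochner_Integration.integrable_add integrable_divide integrable_mult_right
        Bochner_Integration.integrable_sum) auto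
  show "AE \<omega> in M. norm (dv i \<omega>) \<le> norm (?B \<omega>)"
  proof (rule AE_I2)
    fix \<omega> assume \<omega>: "\<omega> \<in> space M"
    have "dv i \<omega> \<le> (\<Sum>i\<le>Suc n. dv i \<omega>)"
      using i by (intro member_le_sum) (auto simp: dv_nonneg)
    also have "\<dots> \<le> ?B \<omega>" by (rule consensus_Suc[OF \<omega>])
    finally show "norm (dv i \<omega>) \<le> norm (?B \<omega>)" using dv_nonneg[of i \<omega>] by simp
  qed
qed (rule dv_M)

lemma Ec_sqi:
  assumes "\<And>k. k < K \<Longrightarrow> sqi (err i k)" "integrable M (dv i)"
  shows "sqi (Ec i)"
proof (rule sqi_dominated)
  show "Ec i \<in> borel_measurable M"
    unfolding Ec_def[abs_def] by (intro borel_measurable_diff gJ_M gc_M)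
  show "integrable M (\<lambda>\<omega>. 4 * Lf\<^sup>2 / real K * dv i \<omega> + 2 * (norm (werr (\<lambda>_. 1 / real K) i \<omega>))\<^sup>2)"
    using assms(2) sqi_integrable[OF sqi_werr[OF assms(1)]] by auto
qed (use Ec_le in auto)

text \<open>Both partial gradients at the start are dominated by the initial gaps, through
  \<open>gradJx_sq_le\<close> and \<open>gradJy_sq_le\<close>.\<close>

lemma gJ_zero_sqi: "sqi (gJ 0)"
proof (rule sqi_dominated[OF gJ_M])
  let ?\<kappa> = "Lf / \<nu>"
  show "integrable M (\<lambda>\<omega>. 32 * Lf * ?\<kappa> * Gp0 \<omega> + 8 * Lf * ?\<kappa> * Deltac0 \<omega> + 4 * Lf * Deltac0 \<omega>)"
    using finite_init unfolding finite_initial_quantities_def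
    by (intro Bochner_Integration.integrable_add integrable_mult_right) auto
  show "AE \<omega> in M. (norm (gJ 0 \<omega>))\<^sup>2 \<le> 32 * Lf * ?\<kappa> * Gp0 \<omega> + 8 * Lf * ?\<kappa> * Deltac0 \<omega> + 4 * Lf * Deltac0 \<omega>"
    using PL.gradJx_sq_le[of "xc 0 _" "yc 0 _"] PL.gradJy_sq_le[of "xc 0 _" "yc 0 _"]
    by (intro AE_I2) (auto simp: norm_prod_sq gJ_def Gp0_def Deltac0_def intro!: add_mono)
qed

text \<open>The quantities feed each other in a fixed order: earlier increments give
  \<open>dv (Suc n)\<close>; with \<open>gc n\<close> this gives \<open>mv n\<close>, and with
  \<open>err n\<close> it gives \<open>inc n\<close>, \<open>err (Suc n)\<close> and
  \<open>gc (Suc n)\<close>. At the start \<open>gc 0\<close> is recovered as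
  \<open>gJ 0 - Ec 0\<close>.\<close>

lemma sqi_invariant:
  "(\<forall>k<K. sqi (err n k)) \<and> sqi (gc n) \<and> (\<forall>i<n. \<forall>k<K. sqi (mv i k) \<and> sqi (inc i k))"
proof (induction n)
  case 0
  have e: "sqi (err 0 k)" if "k < K" for k
    using werr_zero(1)[of "\<lambda>j. if j = k then 1 else 0"] by (simp add: werr_indicator[OF that])
  have "integrable M (dv 0)" by (rule dv_integrable[of 0]) auto
  then have "sqi (\<lambda>\<omega>. gJ 0 \<omega> - Ec 0 \<omega>)" by (intro sqi_diff gJ_zero_sqi Ec_sqi e)
  then have "sqi (gc 0)" by (simp add: Ec_def)
  with e show ?case by simp
next
  case (Suc n)
  have d: "integrable M (dv n)" "integrable M (dv (Suc n))"
    using Suc by (auto intro!: dv_integrable[of n])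
  have sg: "integrable M (\<lambda>\<omega>. (norm (sc (gc n \<omega>)))\<^sup>2)"
  proof (rule Bochner_Integration.integrable_bound)
    show "integrable M (\<lambda>\<omega>. \<mu>y\<^sup>2 * (norm (gc n \<omega>))\<^sup>2)"
      using Suc by (intro integrable_mult_right sqi_integrable) auto
    have "sc \<in> borel_measurable borel"
      unfolding sc_def[abs_def] by (intro borel_measurable_continuous_onI continuous_intros)
    from measurable_compose[OF gc_M this]
    show "(\<lambda>\<omega>. (norm (sc (gc n \<omega>)))\<^sup>2) \<in> borel_measurable M" by measurable
  qed (use norm_sc_le in auto)
  have mv: "sqi (mv n k)" if k: "k < K" for k
  proof (rule sqi_dominated[OF mv_M[OF k]])
    show "integrable M (\<lambda>\<omega>. 2 * real K * (norm (sc (gc n \<omega>)))\<^sup>2 + 4 * dv n \<omega> + 4 * dv (Suc n) \<omega>)"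
      using sg d by auto
    show "AE \<omega> in M. (norm (mv n k \<omega>))\<^sup>2 \<le> 2 * real K * (norm (sc (gc n \<omega>)))\<^sup>2 + 4 * dv n \<omega> + 4 * dv (Suc n) \<omega>"
    proof (rule AE_I2)
      fix \<omega> assume \<omega>: "\<omega> \<in> space M"
      have "(norm (mv n k \<omega>))\<^sup>2 \<le> (\<Sum>k<K. (norm (mv n k \<omega>))\<^sup>2)"
        using k by (intro member_le_sum) auto
      then show "(norm (mv n k \<omega>))\<^sup>2 \<le> 2 * real K * (norm (sc (gc n \<omega>)))\<^sup>2 + 4 * dv n \<omega> + 4 * dv (Suc n) \<omega>"
        using mv_sum_le[OF \<omega>, of n] by linarith
    qed
  qed
  have e: "sqi (err n k)" if "k < K" for k using Suc that by auto
  have inc: "sqi (inc n k)" if "k < K" for k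
    by (rule inc_second_moment(1)[OF that e[OF that] mv[OF that]])
  have "sqi (err (Suc n) k)" if "k < K" for k
    using werr_Suc(1)[OF e mv, of "\<lambda>j. if j = k then 1 else 0"] by (simp add: werr_indicator[OF that])
  moreover have "gc (Suc n) = (\<lambda>\<omega>. gc n \<omega> + (1 / real K) *\<^sub>R (\<Sum>k<K. inc n k \<omega>))"
    by (simp add: fun_eq_iff gc_def block_avg_def inc_def sum_subtractf scaleR_diff_right)
  then have "sqi (gc (Suc n))"
    using Suc inc by (simp only:) (intro sqi_add sqi_scaleR sqi_sum; simp)
  ultimately show ?case using Suc mv inc by (auto simp: less_Suc_eq)
qed

lemma err_sqi: "k < K \<Longrightarrow> sqi (err i k)"
  and gc_sqi: "sqi (gc i)"
  and mv_sqi: "k < K \<Longrightarrow> sqi (mv i k)"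
  and inc_sqi: "k < K \<Longrightarrow> sqi (inc i k)"
  using sqi_invariant[of i] sqi_invariant[of "Suc i"] by auto

lemma dv_int: "integrable M (dv i)"
  by (rule dv_integrable[of i]) (auto intro: inc_sqi)

lemma Ec_square_integrable: "sqi (Ec i)"
  by (intro Ec_sqi err_sqi dv_int)

lemma gJ_sqi: "sqi (gJ i)"
proof -
  have "sqi (\<lambda>\<omega>. Ec i \<omega> + gc i \<omega>)" by (intro sqi_add Ec_square_integrable gc_sqi)
  then show ?thesis by (simp add: Ec_def)
qed

end

lemma borel_measurable_fst_snd:
  fixes f :: "'w \<Rightarrow> 'x::euclidean_space \<times> 'y::euclidean_space"
  assumes "f \<in> borel_measurable M"
  shows "(\<lambda>\<omega>. fst (f \<omega>)) \<in> borel_measurable M" "(\<lambda>\<omega>. snd (f \<omega>)) \<in> borel_measurable M"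
proof -
  have "(fst :: 'x \<times> 'y \<Rightarrow> 'x) \<in> borel_measurable borel" "(snd :: 'x \<times> 'y \<Rightarrow> 'y) \<in> borel_measurable borel"
    by (auto intro!: borel_measurable_continuous_onI continuous_on_fst continuous_on_snd continuous_on_id)
  then show "(\<lambda>\<omega>. fst (f \<omega>)) \<in> borel_measurable M" "(\<lambda>\<omega>. snd (f \<omega>)) \<in> borel_measurable M"
    using measurable_compose[OF assms] by blast+
qed

section \<open>Summed second moments and closing of the feedback loops\<close>

context page_run
begin

lemma Gp0_int: "integrable M Gp0" and Deltac0_int: "integrable M Deltac0"
  and devx0_int: "integrable M devx0" and devy0_int: "integrable M devy0"
  using finite_init by (auto simp: finite_initial_quantities_def)

lemma zeta0_eq: "expectation devx0 + expectation devy0 = real K * zeta0_sq"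
  using K_pos' by (simp add: zeta0_sq_def field_simps)

lemma zeta0_nonneg: "0 \<le> zeta0_sq"
  unfolding zeta0_sq_def devx0_def[abs_def] devy0_def[abs_def]
  by (intro add_nonneg_nonneg mult_nonneg_nonneg Bochner_Integration.integral_nonneg stack_norm_sq_nonneg) auto

definition m2 :: "('w \<Rightarrow> 'x \<times> 'y) \<Rightarrow> real" where
  "m2 f = expectation (nsq f)"

lemma m2_nonneg: "0 \<le> m2 f"
  by (simp add: m2_def)

text \<open>The first bound has p divided out, thanks to averaging over agents; the second needs
  only p times the local errors.\<close>

lemma moments:
  fixes n :: nat
  defines "Sm \<equiv> \<Sum>i<n. \<Sum>k<K. m2 (mv i k)"
  shows "(\<Sum>i\<le>n. m2 (werr (\<lambda>_. 1 / real K) i)) \<le> 4 * \<sigma>\<^sup>2 + 4 * Lf\<^sup>2 * Sm / real K"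
    and "(\<Sum>i<n. \<Sum>k<K. m2 (inc i k)) \<le> 8 * Lf\<^sup>2 * Sm + 4 * real K * \<sigma>\<^sup>2"
proof -
  have Sm0: "0 \<le> Sm" by (simp add: Sm_def sum_nonneg m2_nonneg)
  have sweep: "p * (\<Sum>i\<le>n. m2 (werr w i))
      \<le> (\<Sum>k<K. (w k)\<^sup>2) * (2 * \<sigma>\<^sup>2) / real b0 + (\<Sum>i<n. \<Sum>k<K. (w k)\<^sup>2 / real b * (2 * Lf\<^sup>2 * m2 (mv i k)))" for w
  proof -
    have "(1 - (1 - p)) * (\<Sum>i\<le>n. m2 (werr w i))
        \<le> m2 (werr w 0) + (\<Sum>i<n. \<Sum>k<K. (w k)\<^sup>2 / real b * (2 * Lf\<^sup>2 * m2 (mv i k)))"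
      using p_range unfolding m2_def
      by (intro contraction_sum_bound werr_Suc(2) err_sqi mv_sqi) auto
    then show ?thesis using werr_zero(2)[of w] by (simp add: m2_def)
  qed
  let ?a = "\<Sum>i\<le>n. m2 (werr (\<lambda>_. 1 / real K) i)"
  let ?c = "\<lambda>n. 1 / (real K * real n)"
  have avg: "p * ?a \<le> ?c b0 * (2 * \<sigma>\<^sup>2) + ?c b * (2 * Lf\<^sup>2 * Sm / real K)"
    using sweep[of "\<lambda>_. 1 / real K"] K_pos'
    by (simp add: Sm_def sum_distrib_left sum_divide_distrib power_divide power2_eq_square[of "real K"] field_simps)
  \<comment> \<open>The averaged variance factor 1 / (K b) is at most 2 p, so p cancels on both
    sides.\<close>
  have c: "?c b0 \<le> 2 * p" "?c b \<le> 2 * p"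
    using effective_batch batch_bounds K_pos' by (simp_all add: divide_le_eq mult_ac)
  have "p * ?a \<le> 2 * p * (2 * \<sigma>\<^sup>2) + 2 * p * (2 * Lf\<^sup>2 * Sm / real K)"
    using avg c Sm0 by (intro order_trans[OF avg] add_mono mult_right_mono) auto
  also have "\<dots> = p * (4 * \<sigma>\<^sup>2 + 4 * Lf\<^sup>2 * Sm / real K)" by (simp add: algebra_simps)
  finally show "?a \<le> 4 * \<sigma>\<^sup>2 + 4 * Lf\<^sup>2 * Sm / real K"
    using p_range by (simp only: mult_le_cancel_left_pos)
  \<comment> \<open>For a single agent only b at least 1 is used, and the factor p stays on the
    left.\<close>
  have loc: "p * (\<Sum>i\<le>n. m2 (err i k)) \<le> 2 * \<sigma>\<^sup>2 + (\<Sum>i<n. 2 * Lf\<^sup>2 * m2 (mv i k))" if k: "k < K" for k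
  proof -
    have "p * (\<Sum>i\<le>n. m2 (err i k)) \<le> 2 * \<sigma>\<^sup>2 / real b0 + (\<Sum>i<n. (2 * Lf\<^sup>2 * m2 (mv i k)) / real b)"
      using sweep[of "\<lambda>j. if j = k then 1 else 0"] k
      by (simp add: werr_indicator[OF k] if_distrib[of "\<lambda>t. t\<^sup>2"] if_distrib[of "\<lambda>t. t / _"]
          if_distrib[of "\<lambda>t. t * _"] sum.delta cong: if_cong)
    also have "\<dots> \<le> 2 * \<sigma>\<^sup>2 / 1 + (\<Sum>i<n. (2 * Lf\<^sup>2 * m2 (mv i k)) / 1)"
      using batch_bounds by (intro add_mono sum_mono divide_left_mono) (auto simp: m2_nonneg)
    finally show ?thesis by simp
  qed
  have "p * (\<Sum>i\<le>n. \<Sum>k<K. m2 (err i k)) = (\<Sum>k<K. p * (\<Sum>i\<le>n. m2 (err i k)))"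
    by (subst sum.swap) (simp add: sum_distrib_left)
  also have "\<dots> \<le> (\<Sum>k<K. 2 * \<sigma>\<^sup>2 + (\<Sum>i<n. 2 * Lf\<^sup>2 * m2 (mv i k)))"
    by (intro sum_mono loc) auto
  also have "\<dots> = 2 * real K * \<sigma>\<^sup>2 + 2 * Lf\<^sup>2 * Sm"
    unfolding Sm_def by (subst sum.swap) (simp add: sum.distrib sum_distrib_left)
  finally have el: "p * (\<Sum>i\<le>n. \<Sum>k<K. m2 (err i k)) \<le> 2 * real K * \<sigma>\<^sup>2 + 2 * Lf\<^sup>2 * Sm" .
  have "(\<Sum>i<n. \<Sum>k<K. m2 (inc i k)) \<le> (\<Sum>i<n. \<Sum>k<K. 4 * Lf\<^sup>2 * m2 (mv i k) + 2 * p * m2 (err i k))"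
    unfolding m2_def by (intro sum_mono inc_second_moment(2) err_sqi mv_sqi) auto
  also have "\<dots> = 4 * Lf\<^sup>2 * Sm + 2 * (p * (\<Sum>i<n. \<Sum>k<K. m2 (err i k)))"
    by (simp add: Sm_def sum.distrib sum_distrib_left mult_ac)
  also have "p * (\<Sum>i<n. \<Sum>k<K. m2 (err i k)) \<le> p * (\<Sum>i\<le>n. \<Sum>k<K. m2 (err i k))"
    using p_range by (intro mult_left_mono sum_mono2) (auto intro!: sum_nonneg m2_nonneg)
  finally show "(\<Sum>i<n. \<Sum>k<K. m2 (inc i k)) \<le> 8 * Lf\<^sup>2 * Sm + 4 * real K * \<sigma>\<^sup>2"
    using el by linarith
qed

lemma gw_int: "integrable M (gw i)"
proof -
  have "integrable M (\<lambda>\<omega>. \<mu>y * (norm (gc i \<omega>))\<^sup>2)"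
    using gc_sqi[of i] by (intro integrable_mult_right sqi_integrable)
  then show ?thesis
  proof (rule Bochner_Integration.integrable_bound)
    have "(\<lambda>\<omega>. fst (gc i \<omega>)) \<in> borel_measurable M" "(\<lambda>\<omega>. snd (gc i \<omega>)) \<in> borel_measurable M"
      using borel_measurable_fst_snd[OF gc_M] .
    then show "gw i \<in> borel_measurable M" unfolding gw_def[abs_def] by measurable
    show "AE \<omega> in M. norm (gw i \<omega>) \<le> norm (\<mu>y * (norm (gc i \<omega>))\<^sup>2)"
    proof (rule AE_I2)
      fix \<omega>
      have "\<mu>x * (norm (fst (gc i \<omega>)))\<^sup>2 \<le> \<mu>y * (norm (fst (gc i \<omega>)))\<^sup>2"
        using step_x_le by (intro mult_right_mono) auto
      moreover have "0 \<le> gw i \<omega>" using step_x_pos step_y_pos by (simp add: gw_def)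
      ultimately show "norm (gw i \<omega>) \<le> norm (\<mu>y * (norm (gc i \<omega>))\<^sup>2)"
        using step_y_pos by (simp add: gw_def norm_prod_sq distrib_left)
    qed
  qed
qed

lemma gc_le_gw: "\<mu>x * m2 (gc i) \<le> expectation (gw i)"
proof -
  have "\<mu>x * m2 (gc i) = expectation (\<lambda>\<omega>. \<mu>x * (norm (gc i \<omega>))\<^sup>2)" by (simp add: m2_def)
  also have "\<dots> \<le> expectation (gw i)"
  proof (rule integral_mono[OF _ gw_int])
    show "integrable M (\<lambda>\<omega>. \<mu>x * (norm (gc i \<omega>))\<^sup>2)"
      using gc_sqi[of i] by (intro integrable_mult_right sqi_integrable)
    show "\<mu>x * (norm (gc i \<omega>))\<^sup>2 \<le> gw i \<omega>" for \<omega>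
      using mult_right_mono[OF step_x_le, of "(norm (snd (gc i \<omega>)))\<^sup>2"]
      by (simp add: gw_def norm_prod_sq distrib_left)
  qed
  finally show ?thesis .
qed

lemma mv_moment: "(\<Sum>k<K. m2 (mv i k))
    \<le> 2 * real K * (\<mu>y * expectation (gw i)) + 4 * expectation (dv i) + 4 * expectation (dv (Suc i))"
proof -
  have "(\<Sum>k<K. m2 (mv i k)) = expectation (\<lambda>\<omega>. \<Sum>k<K. (norm (mv i k \<omega>))\<^sup>2)"
    unfolding m2_def using sqi_integrable[OF mv_sqi]
    by (intro Bochner_Integration.integral_sum[symmetric]) auto
  also have "\<dots> \<le> expectation (\<lambda>\<omega>. 2 * real K * (\<mu>y * gw i \<omega>) + 4 * dv i \<omega> + 4 * dv (Suc i) \<omega>)"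
  proof (rule integral_mono)
    show "integrable M (\<lambda>\<omega>. \<Sum>k<K. (norm (mv i k \<omega>))\<^sup>2)"
      using sqi_integrable[OF mv_sqi] by (intro Bochner_Integration.integrable_sum) auto
    show "integrable M (\<lambda>\<omega>. 2 * real K * (\<mu>y * gw i \<omega>) + 4 * dv i \<omega> + 4 * dv (Suc i) \<omega>)"
      using gw_int dv_int by auto
    fix \<omega> assume "\<omega> \<in> space M"
    have "2 * real K * (norm (sc (gc i \<omega>)))\<^sup>2 \<le> 2 * real K * (\<mu>y * gw i \<omega>)"
      by (intro mult_left_mono norm_sc_gc) auto
    then show "(\<Sum>k<K. (norm (mv i k \<omega>))\<^sup>2) \<le> 2 * real K * (\<mu>y * gw i \<omega>) + 4 * dv i \<omega> + 4 * dv (Suc i) \<omega>"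
      using mv_sum_le[OF \<open>\<omega> \<in> space M\<close>, of i] by linarith
  qed
  also have "\<dots> = 2 * real K * (\<mu>y * expectation (gw i)) + 4 * expectation (dv i) + 4 * expectation (dv (Suc i))"
    using gw_int dv_int by simp
  finally show ?thesis .
qed

lemma consensus_moment: "(\<Sum>i\<le>n. expectation (dv i))
    \<le> \<mu>y\<^sup>2 * (real K * zeta0_sq) / (1 - lam) ^ 3 + \<mu>y\<^sup>2 * (\<Sum>i<n. \<Sum>k<K. m2 (inc i k)) / (1 - lam) ^ 4"
proof -
  have "(\<Sum>i\<le>n. expectation (dv i)) \<le> (\<Sum>i\<le>Suc n. expectation (dv i))"
    by (simp add: dv_nonneg)
  also have "\<dots> = expectation (\<lambda>\<omega>. \<Sum>i\<le>Suc n. dv i \<omega>)"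
    using dv_int by (intro Bochner_Integration.integral_sum[symmetric]) auto
  also have "\<dots> \<le> expectation (\<lambda>\<omega>. \<mu>y\<^sup>2 * (devx0 \<omega> + devy0 \<omega>) / (1 - lam) ^ 3
      + \<mu>y\<^sup>2 * (\<Sum>i<n. \<Sum>k<K. (norm (inc i k \<omega>))\<^sup>2) / (1 - lam) ^ 4)"
    using dv_int devx0_int devy0_int sqi_integrable[OF inc_sqi]
    by (intro integral_mono consensus_Suc Bochner_Integration.integrable_add integrable_divide
        integrable_mult_right Bochner_Integration.integrable_sum) auto
  also have "\<dots> = \<mu>y\<^sup>2 * (expectation devx0 + expectation devy0) / (1 - lam) ^ 3
      + \<mu>y\<^sup>2 * (\<Sum>i<n. \<Sum>k<K. m2 (inc i k)) / (1 - lam) ^ 4"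
  proof -
    have i1: "integrable M (\<lambda>\<omega>. \<mu>y\<^sup>2 * (devx0 \<omega> + devy0 \<omega>) / (1 - lam) ^ 3)"
      using devx0_int devy0_int by (intro integrable_divide integrable_mult_right Bochner_Integration.integrable_add) auto
    have i2: "integrable M (\<lambda>\<omega>. \<mu>y\<^sup>2 * (\<Sum>i<n. \<Sum>k<K. (norm (inc i k \<omega>))\<^sup>2) / (1 - lam) ^ 4)"
      using sqi_integrable[OF inc_sqi]
      by (intro integrable_divide integrable_mult_right Bochner_Integration.integrable_sum) auto
    have "expectation (\<lambda>\<omega>. \<Sum>i<n. \<Sum>k<K. (norm (inc i k \<omega>))\<^sup>2) = (\<Sum>i<n. \<Sum>k<K. m2 (inc i k))"
      unfolding m2_def using sqi_integrable[OF inc_sqi]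
      by (subst Bochner_Integration.integral_sum) (auto intro!: sum.cong Bochner_Integration.integral_sum)
    then show ?thesis
      using devx0_int devy0_int by (simp add: Bochner_Integration.integral_add[OF i1 i2])
  qed
  finally show ?thesis by (simp add: zeta0_eq)
qed

lemma Ec_moment: "m2 (Ec i) \<le> 4 * Lf\<^sup>2 / real K * expectation (dv i) + 2 * m2 (werr (\<lambda>_. 1 / real K) i)"
proof -
  have w: "sqi (werr (\<lambda>_. 1 / real K) i)" by (intro sqi_werr err_sqi)
  have "m2 (Ec i) \<le> expectation (\<lambda>\<omega>. 4 * Lf\<^sup>2 / real K * dv i \<omega> + 2 * (norm (werr (\<lambda>_. 1 / real K) i \<omega>))\<^sup>2)"
    unfolding m2_def using sqi_integrable[OF w] sqi_integrable[OF Ec_square_integrable] dv_int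
    by (intro integral_mono Ec_le Bochner_Integration.integrable_add integrable_mult_right) auto
  also have "\<dots> = 4 * Lf\<^sup>2 / real K * expectation (dv i) + 2 * m2 (werr (\<lambda>_. 1 / real K) i)"
    unfolding m2_def using sqi_integrable[OF w] dv_int[of i] by (simp add: Bochner_Integration.integral_add)
  finally show ?thesis .
qed

lemma descent_moment: "(\<Sum>i\<le>n. expectation (gw i))
    \<le> 8 * (expectation Gp0 + expectation Deltac0) + 8 * \<mu>y * (\<Sum>i\<le>n. m2 (Ec i))"
proof -
  have E: "integrable M (nsq (Ec i))" for i
    by (rule sqi_integrable[OF Ec_square_integrable])
  have "(\<Sum>i\<le>n. expectation (gw i)) = expectation (\<lambda>\<omega>. \<Sum>i\<le>n. gw i \<omega>)"
    using gw_int by (intro Bochner_Integration.integral_sum[symmetric]) auto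
  also have "\<dots> \<le> expectation (\<lambda>\<omega>. 8 * (Gp0 \<omega> + Deltac0 \<omega>) + 8 * \<mu>y * (\<Sum>i\<le>n. (norm (Ec i \<omega>))\<^sup>2))"
    using gw_int Gp0_int Deltac0_int E descent_sum[of _ "Suc n"]
    by (intro integral_mono) (auto simp: lessThan_Suc_atMost)
  also have "\<dots> = 8 * (expectation Gp0 + expectation Deltac0) + 8 * \<mu>y * (\<Sum>i\<le>n. m2 (Ec i))"
    using Gp0_int Deltac0_int E by (simp add: m2_def Bochner_Integration.integral_add)
  finally show ?thesis .
qed

lemma gJ_moment: "m2 (gJ i) \<le> 2 * m2 (gc i) + 2 * m2 (Ec i)"
proof -
  note [simp] = sqi_integrable[OF gc_sqi[of i]] sqi_integrable[OF Ec_square_integrable[of i]]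
    sqi_integrable[OF gJ_sqi[of i]]
  have "(norm (gJ i \<omega>))\<^sup>2 \<le> 2 * (norm (gc i \<omega>))\<^sup>2 + 2 * (norm (Ec i \<omega>))\<^sup>2" for \<omega>
    using norm_add_sq_le[of "gc i \<omega>" "Ec i \<omega>"] by (simp add: Ec_def)
  then have "m2 (gJ i) \<le> expectation (\<lambda>\<omega>. 2 * (norm (gc i \<omega>))\<^sup>2 + 2 * (norm (Ec i \<omega>))\<^sup>2)"
    unfolding m2_def by (intro integral_mono) auto
  then show ?thesis by (simp add: m2_def)
qed

text \<open>Two loops are closed by absorption: consensus error -> displacement -> estimator
  increments -> consensus error, with gain 64/4096, and centroid steps -> gradient error -> centroid
  steps.\<close>

lemma stationarity_sum: "(\<Sum>i\<le>n. m2 (gJ i))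
    \<le> (48 * (expectation Gp0 + expectation Deltac0) + 50 * \<mu>y * (9 * \<sigma>\<^sup>2 + (1 - lam) * zeta0_sq)) / \<mu>x"
proof -
  define l where "l = 1 - lam"
  have l: "0 < l" using lam_less by (simp add: l_def)
  define d where "d = Lf\<^sup>2 * (\<Sum>i\<le>n. expectation (dv i)) / real K"
  define s where "s = Lf\<^sup>2 * (\<Sum>i<n. \<Sum>k<K. m2 (mv i k)) / real K"
  define h where "h = (\<Sum>i<n. \<Sum>k<K. m2 (inc i k)) / real K"
  define w where "w = (\<Sum>i\<le>n. expectation (gw i))"
  define g where "g = Lf\<^sup>2 * \<mu>y * w"
  define e where "e = (\<Sum>i\<le>n. m2 (Ec i))"
  define z where "z = l * zeta0_sq"
  define a where "a = (\<Sum>i\<le>n. m2 (werr (\<lambda>_. 1 / real K) i))"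
  define \<Phi> where "\<Phi> = expectation Gp0 + expectation Deltac0"
  have gw0: "0 \<le> expectation (gw i)" for i
    using step_x_pos step_y_pos by (intro Bochner_Integration.integral_nonneg) (simp add: gw_def)
  have w0: "0 \<le> w" by (simp add: w_def sum_nonneg gw0)
  have z0: "0 \<le> z" using l zeta0_nonneg by (simp add: z_def)
  have dv0: "0 \<le> expectation (dv i)" for i by (simp add: dv_nonneg)

  have "(\<Sum>i<n. \<Sum>k<K. m2 (mv i k)) \<le> (\<Sum>i<n. 2 * real K * (\<mu>y * expectation (gw i))
      + 4 * expectation (dv i) + 4 * expectation (dv (Suc i)))"
    by (intro sum_mono mv_moment)
  also have "\<dots> = 2 * real K * (\<mu>y * (\<Sum>i<n. expectation (gw i)))
      + 4 * (\<Sum>i<n. expectation (dv i)) + 4 * (\<Sum>i<n. expectation (dv (Suc i)))"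
    by (simp add: sum.distrib sum_distrib_left)
  also have "\<dots> \<le> 2 * real K * (\<mu>y * w)
      + 4 * (\<Sum>i\<le>n. expectation (dv i)) + 4 * (\<Sum>i\<le>n. expectation (dv i))"
  proof (intro add_mono mult_left_mono)
    show "(\<Sum>i<n. expectation (gw i)) \<le> w"
      unfolding w_def by (rule sum_mono2) (auto simp: gw0)
    show "(\<Sum>i<n. expectation (dv i)) \<le> (\<Sum>i\<le>n. expectation (dv i))"
      by (rule sum_mono2) (auto simp: dv_nonneg)
    \<comment> \<open>The shifted sum runs over 1, ..., n and so lacks only the nonnegative term at
      0.\<close>
    show "(\<Sum>i<n. expectation (dv (Suc i))) \<le> (\<Sum>i\<le>n. expectation (dv i))"
      using sum.lessThan_Suc_shift[of "\<lambda>i. expectation (dv i)" n] dv0[of 0]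
      by (simp only: lessThan_Suc_atMost)
  qed (use step_y_pos in auto)
  finally have Sm: "(\<Sum>i<n. \<Sum>k<K. m2 (mv i k)) \<le> 2 * real K * (\<mu>y * w) + 8 * (\<Sum>i\<le>n. expectation (dv i))"
    by simp
  have s: "s \<le> 2 * g + 8 * d"
  proof -
    have "s \<le> Lf\<^sup>2 * (2 * real K * (\<mu>y * w) + 8 * (\<Sum>i\<le>n. expectation (dv i))) / real K"
      unfolding s_def by (intro divide_right_mono mult_left_mono Sm) auto
    also have "\<dots> = 2 * g + 8 * d" using K_pos' by (simp add: g_def d_def field_simps)
    finally show ?thesis .
  qed
  have a: "a \<le> 4 * \<sigma>\<^sup>2 + 4 * s"
    using moments(1)[of n] by (simp add: a_def s_def)
  have h: "h \<le> 8 * s + 4 * \<sigma>\<^sup>2"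
  proof -
    have "h \<le> (8 * Lf\<^sup>2 * (\<Sum>i<n. \<Sum>k<K. m2 (mv i k)) + 4 * real K * \<sigma>\<^sup>2) / real K"
      unfolding h_def by (intro divide_right_mono moments(2)) auto
    also have "\<dots> = 8 * s + 4 * \<sigma>\<^sup>2" using K_pos' by (simp add: s_def add_divide_distrib)
    finally show ?thesis .
  qed
  \<comment> \<open>Here the step size of order (1 - lam)^2 cancels the fourth power of the gap in
    the consensus bound.\<close>
  have \<mu>: "Lf\<^sup>2 * \<mu>y\<^sup>2 = l ^ 4 / 4096"
  proof -
    have "4096 * (Lf\<^sup>2 * \<mu>y\<^sup>2) = (64 * Lf * \<mu>y)\<^sup>2" by (simp add: power_mult_distrib)
    also have "\<dots> = l ^ 4" unfolding step_y l_def[symmetric] by (simp flip: power_mult)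
    finally show ?thesis by simp
  qed
  have d: "d \<le> (z + h) / 4096"
  proof -
    have "d \<le> Lf\<^sup>2 * (\<mu>y\<^sup>2 * (real K * zeta0_sq) / l ^ 3 + \<mu>y\<^sup>2 * (\<Sum>i<n. \<Sum>k<K. m2 (inc i k)) / l ^ 4) / real K"
      unfolding d_def l_def by (intro divide_right_mono mult_left_mono consensus_moment) auto
    also have "\<dots> = (Lf\<^sup>2 * \<mu>y\<^sup>2) * zeta0_sq / l ^ 3 + (Lf\<^sup>2 * \<mu>y\<^sup>2) * h / l ^ 4"
      using K_pos' by (simp add: h_def field_simps)
    also have "\<dots> = (z + h) / 4096"
      unfolding \<mu> using l by (simp add: z_def field_simps power4_eq_xxxx power3_eq_cube)
    finally show ?thesis .
  qed
  have e: "e \<le> 4 * d + 2 * a"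
  proof -
    have "e \<le> (\<Sum>i\<le>n. 4 * Lf\<^sup>2 / real K * expectation (dv i) + 2 * m2 (werr (\<lambda>_. 1 / real K) i))"
      unfolding e_def by (intro sum_mono Ec_moment)
    also have "\<dots> = 4 * d + 2 * a"
      by (simp add: d_def a_def sum.distrib sum_distrib_left sum_divide_distrib mult.assoc)
    finally show ?thesis .
  qed
  have g0: "0 \<le> g" using w0 step_y_pos by (simp add: g_def)
  \<comment> \<open>The first loop: inserting s in h and h in d leaves 64 d on the right, absorbed
    in 4096 d.\<close>
  have e': "e \<le> 9 * \<sigma>\<^sup>2 + z + 17 * g"
  proof -
    have "4096 * d \<le> z + h" using d by simp
    then have "4032 * d \<le> z + 16 * g + 4 * \<sigma>\<^sup>2" using h s by linarith
    moreover have "e \<le> 68 * d + 8 * \<sigma>\<^sup>2 + 16 * g" using e a s by linarith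
    ultimately show ?thesis using g0 z0 zero_le_power2[of \<sigma>] by linarith
  qed
  have l1: "l ^ 4 \<le> 1" using l mix.spectral_gap(1) by (intro power_le_one) (auto simp: l_def)
  \<comment> \<open>The second loop: g is L^2 \<mu>y w, so \<mu>y g is at most w / 4096, and the
    feedback is absorbed in w below.\<close>
  have gw: "34 * (\<mu>y * g) \<le> w / 16"
  proof -
    have "\<mu>y * g = (Lf\<^sup>2 * \<mu>y\<^sup>2) * w" by (simp add: g_def power2_eq_square)
    also have "\<dots> \<le> 1 / 4096 * w" unfolding \<mu> using l1 w0 by (intro mult_right_mono) auto
    finally show ?thesis using w0 by simp
  qed
  define q where "q = \<mu>y * (9 * \<sigma>\<^sup>2 + z)"
  have \<mu>e: "\<mu>y * e \<le> q + 17 * (\<mu>y * g)"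
    using mult_left_mono[OF e' less_imp_le[OF step_y_pos]] by (simp add: q_def algebra_simps)
  have "w \<le> 8 * \<Phi> + 8 * (\<mu>y * e)"
    using descent_moment[of n] by (simp add: w_def \<Phi>_def e_def)
  then have w: "w \<le> 16 * \<Phi> + 16 * q"
    using \<mu>e gw w0 by linarith
  have e0: "0 \<le> e" by (simp add: e_def sum_nonneg m2_nonneg)
  have \<mu>xe: "\<mu>x * e \<le> \<mu>y * e" using step_x_le e0 by (intro mult_right_mono)
  have "\<mu>x * (\<Sum>i\<le>n. m2 (gJ i)) \<le> \<mu>x * (\<Sum>i\<le>n. 2 * m2 (gc i) + 2 * m2 (Ec i))"
    using step_x_pos by (intro mult_left_mono sum_mono gJ_moment) auto
  also have "\<dots> = 2 * (\<Sum>i\<le>n. \<mu>x * m2 (gc i)) + 2 * (\<mu>x * e)"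
    by (simp add: e_def sum.distrib sum_distrib_left algebra_simps)
  finally have "\<mu>x * (\<Sum>i\<le>n. m2 (gJ i)) \<le> 2 * (\<Sum>i\<le>n. \<mu>x * m2 (gc i)) + 2 * (\<mu>x * e)" .
  moreover have "(\<Sum>i\<le>n. \<mu>x * m2 (gc i)) \<le> w" unfolding w_def by (intro sum_mono gc_le_gw)
  ultimately have "\<mu>x * (\<Sum>i\<le>n. m2 (gJ i)) \<le> 3 * w + 2 * q"
    using \<mu>xe \<mu>e gw w0 by linarith
  then have "\<mu>x * (\<Sum>i\<le>n. m2 (gJ i)) \<le> 48 * \<Phi> + 50 * q" using w by linarith
  then show ?thesis
    using step_x_pos by (simp add: pos_le_divide_eq q_def \<Phi>_def z_def l_def mult_ac)
qed

section \<open>Averaged bound, sample count and complexities\<close>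

lemma square_integrable_gradients_holds: "square_integrable_gradients"
  and stationarity_average_eq: "stationarity_average T = (1 / real T) * (\<Sum>i<T. m2 (gJ i))"
proof -
  have M: "(\<lambda>\<omega>. fst (gJ i \<omega>)) \<in> borel_measurable M" "(\<lambda>\<omega>. snd (gJ i \<omega>)) \<in> borel_measurable M" for i
    using borel_measurable_fst_snd[OF gJ_M] .
  have I: "integrable M (\<lambda>\<omega>. (norm (fst (gJ i \<omega>)))\<^sup>2)" "integrable M (\<lambda>\<omega>. (norm (snd (gJ i \<omega>)))\<^sup>2)" for i
    by (rule Bochner_Integration.integrable_bound[OF sqi_integrable[OF gJ_sqi[of i]]];
        use M[of i] in \<open>auto simp: norm_prod_sq\<close>)+
  show "square_integrable_gradients"
    using I by (simp add: square_integrable_gradients_def gJ_def)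
  have "m2 (gJ i) = expectation (\<lambda>\<omega>. (norm (gradJx (xc i \<omega>) (yc i \<omega>)))\<^sup>2)
      + expectation (\<lambda>\<omega>. (norm (gradJy (xc i \<omega>) (yc i \<omega>)))\<^sup>2)" for i
    using I[of i] by (simp add: m2_def norm_prod_sq gJ_def)
  then show "stationarity_average T = (1 / real T) * (\<Sum>i<T. m2 (gJ i))"
    by (simp add: stationarity_average_def)
qed

text \<open>Dividing by \<mu>x costs 16384 L \<kappa>^2 / (1 - lam)^2 for the initial gaps, but only
  \<mu>y / \<mu>x = 256 \<kappa>^2 for the noise terms, whose weight \<mu>y cancels the spectral
  gap; 12800 = 50 * 256.\<close>

lemma stationarity_bound:
  assumes "1 \<le> T"
  shows "stationarity_average T \<le> (48 * 16384 * Lf * (Lf / \<nu>)\<^sup>2 / (1 - lam)\<^sup>2 * (expectation Gp0 + expectation Deltac0)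
    + 12800 * (Lf / \<nu>)\<^sup>2 * (9 * \<sigma>\<^sup>2 + (1 - lam) * zeta0_sq)) / real T"
proof -
  define q where "q = (Lf / \<nu>)\<^sup>2"
  define \<Phi> where "\<Phi> = expectation Gp0 + expectation Deltac0"
  define r where "r = 9 * \<sigma>\<^sup>2 + (1 - lam) * zeta0_sq"
  obtain n where n: "T = Suc n" using assms by (cases T) auto
  have l: "0 < (1 - lam)\<^sup>2" using lam_less by simp
  have 1: "\<mu>y / \<mu>x = 256 * q"
    using step_x step_x_pos by (simp add: q_def field_simps flip: step_x)
  have "1 / \<mu>x = (\<mu>y / \<mu>x) * (1 / \<mu>y)" using step_y_pos by simp
  also have "1 / \<mu>y = 64 * Lf / (1 - lam)\<^sup>2"
    unfolding step_y[symmetric] using Lf_pos step_y_pos by simp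
  finally have 2: "1 / \<mu>x = 16384 * Lf * q / (1 - lam)\<^sup>2" unfolding 1 by simp
  have "(\<Sum>i\<le>n. m2 (gJ i)) \<le> (48 * \<Phi> + 50 * \<mu>y * r) / \<mu>x"
    using stationarity_sum[of n] by (simp add: \<Phi>_def r_def)
  also have "\<dots> = 48 * (1 / \<mu>x) * \<Phi> + 50 * (\<mu>y / \<mu>x) * r" by (simp add: add_divide_distrib)
  also have "\<dots> = 48 * 16384 * Lf * q / (1 - lam)\<^sup>2 * \<Phi> + 12800 * q * r" unfolding 1 2 by simp
  finally have "(\<Sum>i<T. m2 (gJ i)) / real T
      \<le> (48 * 16384 * Lf * q / (1 - lam)\<^sup>2 * \<Phi> + 12800 * q * r) / real T"
    unfolding n lessThan_Suc_atMost by (intro divide_right_mono) auto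
  then show ?thesis by (simp add: stationarity_average_eq q_def \<Phi>_def r_def)
qed

lemma Gp0_nonneg: "0 \<le> expectation Gp0" and Deltac0_nonneg: "0 \<le> expectation Deltac0"
  using PL.Pstar_le PL.J_le_P by (auto simp: Gp0_def Deltac0_def intro!: Bochner_Integration.integral_nonneg)

lemma coin_batch_expectation:
  assumes "1 \<le> i"
  shows "integrable M (\<lambda>\<omega>. if \<pi> i \<omega> then real N else real b)"
    and "expectation (\<lambda>\<omega>. if \<pi> i \<omega> then real N else real b) = p * real N + (1 - p) * real b"
proof -
  have eq: "(\<lambda>\<omega>. if \<pi> i \<omega> then real N else real b)
      = (\<lambda>\<omega>. (if \<pi> i \<omega> then real N else 0) + (if \<pi> i \<omega> then 0 else real b))" by auto
  have A: "{} \<subseteq> idx" "Coin i \<notin> {}" by auto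
  note C = coin_expectation[OF A(1) assms A(2), of "\<lambda>_. c" for c, OF borel_measurable_const integrable_const]
  show "integrable M (\<lambda>\<omega>. if \<pi> i \<omega> then real N else real b)"
    unfolding eq by (intro Bochner_Integration.integrable_add C)
  show "expectation (\<lambda>\<omega>. if \<pi> i \<omega> then real N else real b) = p * real N + (1 - p) * real b"
    unfolding eq using C by (simp add: Bochner_Integration.integral_add prob_space)
qed

lemma sample_complexity_eq:
  "sample_complexity T = real b0 + real T * (p * real N + (1 - p) * real b)"
proof -
  have "(\<lambda>\<omega>. real (samples_used T \<omega>)) = (\<lambda>\<omega>. real b0 + (\<Sum>i=1..T. if \<pi> i \<omega> then real N else real b))"
    by (simp add: samples_used_def if_distrib[of real] cong: if_cong)
  moreover have "expectation (\<lambda>\<omega>. \<Sum>i=1..T. if \<pi> i \<omega> then real N else real b)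
      = (\<Sum>i=1..T. p * real N + (1 - p) * real b)"
    by (subst Bochner_Integration.integral_sum) (auto simp: coin_batch_expectation)
  moreover have "integrable M (\<lambda>\<omega>. \<Sum>i=1..T. if \<pi> i \<omega> then real N else real b)"
    by (intro Bochner_Integration.integrable_sum coin_batch_expectation) auto
  ultimately show ?thesis
    by (simp add: sample_complexity_def Bochner_Integration.integral_add prob_space)
qed

text \<open>Resets cost p N = sqrt (N / K) per round on average, the same order as a minibatch. The
  5 consists of 1 for resets, 2 for the rounded minibatch and 2 for the initial batch, the last
  spread over at least one round.\<close>

lemma sample_complexity_le:
  assumes "1 \<le> T"
  shows "sample_complexity T \<le> 5 * real T * (sqrt (real N) / sqrt (real K))"
proof -
  define r where "r = sqrt (real N / real K)"
  have r: "0 \<le> r" by (simp add: r_def)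
  have "p * real N = r"
    using K_pos' N_pos' by (simp add: r_def prob_reset real_sqrt_divide real_sqrt_mult field_simps)
  moreover have "(1 - p) * real b \<le> 1 * (2 * r)"
    using batch_bounds p_range unfolding r_def by (intro mult_mono) auto
  ultimately have "real T * (p * real N + (1 - p) * real b) \<le> real T * (3 * r)"
    by (intro mult_left_mono) auto
  moreover have "real b0 \<le> 2 * r" using batch_bounds by (simp add: r_def)
  moreover have "1 * r \<le> real T * r" using assms r by (intro mult_right_mono) auto
  ultimately have "sample_complexity T \<le> 5 * real T * r" unfolding sample_complexity_eq by linarith
  then show ?thesis by (simp add: r_def real_sqrt_divide)
qed

definition rate :: real where
  "rate = (Lf / \<nu>)\<^sup>2 / (1 - lam)\<^sup>2"

lemma gap_le: "0 < 1 - lam" "1 - lam \<le> 1" "(1 - lam)\<^sup>2 \<le> 1"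
  using lam_less mix.spectral_gap(1) by (auto intro!: power_le_one)

lemma rate_ge: "(Lf / \<nu>)\<^sup>2 \<le> rate" "1 \<le> rate"
proof -
  have "(Lf / \<nu>)\<^sup>2 / 1 \<le> rate"
    unfolding rate_def using gap_le by (intro divide_left_mono) auto
  then show "(Lf / \<nu>)\<^sup>2 \<le> rate" by simp
  then show "1 \<le> rate" using one_le_power[OF PL.\<kappa>_ge, of 2] by linarith
qed

text \<open>One bound \<open>\<Gamma>\<close> stands for all quantities that the complexity
  statement treats as constants: 96 = 2 * 48 counts the two gaps, and 128000 = 10 * 12800 combines 9
  noise terms with the deviation.\<close>

lemma stationarity_rate:
  assumes T: "1 \<le> T" and \<Gamma>: "expectation Gp0 \<le> \<Gamma>" "expectation Deltac0 \<le> \<Gamma>" "\<sigma>\<^sup>2 \<le> \<Gamma>" "zeta0_sq \<le> \<Gamma>"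
  shows "stationarity_average T \<le> (96 * 16384 * Lf + 128000) * \<Gamma> * rate / real T"
proof -
  let ?\<Phi> = "expectation Gp0 + expectation Deltac0"
  let ?r = "9 * \<sigma>\<^sup>2 + (1 - lam) * zeta0_sq"
  have \<Gamma>0: "0 \<le> \<Gamma>" using Gp0_nonneg \<Gamma>(1) by linarith
  have "(1 - lam) * zeta0_sq \<le> 1 * \<Gamma>"
    using gap_le zeta0_nonneg \<Gamma> by (intro mult_mono) auto
  then have "?r \<le> 10 * \<Gamma>" using \<Gamma> by linarith
  then have "(Lf / \<nu>)\<^sup>2 * ?r \<le> rate * (10 * \<Gamma>)"
    using rate_ge zeta0_nonneg gap_le by (intro mult_mono) auto
  moreover have "48 * 16384 * Lf * rate * ?\<Phi> \<le> 48 * 16384 * Lf * rate * (2 * \<Gamma>)"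
    using \<Gamma> Lf_pos rate_ge by (intro mult_left_mono) auto
  ultimately have "48 * 16384 * Lf * rate * ?\<Phi> + 12800 * ((Lf / \<nu>)\<^sup>2 * ?r)
      \<le> 48 * 16384 * Lf * rate * (2 * \<Gamma>) + 12800 * (rate * (10 * \<Gamma>))"
    by linarith
  also have "\<dots> = (96 * 16384 * Lf + 128000) * \<Gamma> * rate" by (simp add: algebra_simps)
  finally have "(48 * 16384 * Lf * rate * ?\<Phi> + 12800 * ((Lf / \<nu>)\<^sup>2 * ?r)) / real T
      \<le> (96 * 16384 * Lf + 128000) * \<Gamma> * rate / real T"
    by (intro divide_right_mono) auto
  then show ?thesis using stationarity_bound[OF T] by (simp add: rate_def mult.assoc)
qed

text \<open>The bound of \<open>stationarity_rate\<close> decreases in the number of rounds, so the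
  accuracy persists for every later horizon.\<close>

lemma complexity:
  fixes \<epsilon> \<Gamma> :: real
  assumes \<Gamma>: "expectation Gp0 \<le> \<Gamma>" "expectation Deltac0 \<le> \<Gamma>" "\<sigma>\<^sup>2 \<le> \<Gamma>" "zeta0_sq \<le> \<Gamma>"
    and \<epsilon>: "0 < \<epsilon>" "\<epsilon> \<le> 1"
  defines "B \<equiv> (96 * 16384 * Lf + 128000) * \<Gamma> + 2"
  obtains T where "1 \<le> T" "\<And>T'. T \<le> T' \<Longrightarrow> stationarity_average T' \<le> \<epsilon>\<^sup>2"
    "real T \<le> B * (rate / \<epsilon>\<^sup>2)"
    "sample_complexity T \<le> 5 * B * (rate / \<epsilon>\<^sup>2) * (sqrt (real N) / sqrt (real K))"
proof -
  define A where "A = (96 * 16384 * Lf + 128000) * \<Gamma> * rate / \<epsilon>\<^sup>2"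
  have \<Gamma>0: "0 \<le> \<Gamma>" using Gp0_nonneg \<Gamma>(1) by linarith
  have A0: "0 \<le> A" using \<Gamma>0 Lf_pos rate_ge by (simp add: A_def)
  have \<epsilon>2: "0 < \<epsilon>\<^sup>2" "\<epsilon>\<^sup>2 \<le> 1" using \<epsilon> by (auto intro: power_le_one)
  \<comment> \<open>The summand 1 keeps \<open>T\<close> positive even when \<open>A\<close> is
    0.\<close>
  define T where "T = nat \<lceil>A\<rceil> + 1"
  have T: "1 \<le> T" "A \<le> real T" "real T \<le> A + 2"
    using A0 unfolding T_def by linarith+
  have avg: "stationarity_average T' \<le> \<epsilon>\<^sup>2" if "T \<le> T'" for T'
  proof -
    have T': "1 \<le> T'" "A \<le> real T'" using that T by (auto intro: order_trans)
    have "stationarity_average T' \<le> A * \<epsilon>\<^sup>2 / real T'"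
      using stationarity_rate[OF T'(1) \<Gamma>] \<epsilon>2 by (simp add: A_def)
    also have "\<dots> \<le> real T' * \<epsilon>\<^sup>2 / real T'"
      using T' \<epsilon>2 by (intro divide_right_mono mult_right_mono) auto
    finally show ?thesis using T' by simp
  qed
  \<comment> \<open>The rounding loss of at most 2 rounds is absorbed in the rate; this is the 2 in
    \<open>B\<close>.\<close>
  have "1 / 1 \<le> rate / \<epsilon>\<^sup>2" using rate_ge \<epsilon>2 by (intro frac_le) auto
  moreover have "B * (rate / \<epsilon>\<^sup>2) = A + 2 * (rate / \<epsilon>\<^sup>2)" by (simp add: A_def B_def algebra_simps add_divide_distrib)
  ultimately have TB: "real T \<le> B * (rate / \<epsilon>\<^sup>2)" using T by linarith
  have "sample_complexity T \<le> 5 * real T * (sqrt (real N) / sqrt (real K))"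
    by (rule sample_complexity_le[OF T(1)])
  also have "\<dots> \<le> 5 * (B * (rate / \<epsilon>\<^sup>2)) * (sqrt (real N) / sqrt (real K))"
    using TB by (intro mult_right_mono mult_left_mono) auto
  finally have "sample_complexity T \<le> 5 * B * (rate / \<epsilon>\<^sup>2) * (sqrt (real N) / sqrt (real K))"
    by (simp only: mult.assoc)
  with T(1) avg TB that show thesis by blast
qed

text \<open>\<open>stationarity_bound\<close> regrouped. 115200 = 9 * 12800 is the noise
  coefficient, and nonnegativity of all terms allows one common constant.\<close>

lemma average_bound:
  assumes T: "1 \<le> T"
  shows "stationarity_average T \<le> (48 * 16384 * Lf + 115200) *
    ((Lf / \<nu>)\<^sup>2 * expectation Gp0 / (real T * (1 - lam)\<^sup>2)
      + (Lf / \<nu>)\<^sup>2 * expectation Deltac0 / (real T * (1 - lam)\<^sup>2)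
      + (Lf / \<nu>)\<^sup>2 * zeta0_sq * (1 - lam) / real T
      + (Lf / \<nu>)\<^sup>2 * \<sigma>\<^sup>2 / real T
      + (Lf / \<nu>)\<^sup>2 * lam ^ 4 * sqrt (real K) * \<sigma>\<^sup>2 / (sqrt (real N) * real T)
      + (Lf / \<nu>)\<^sup>2 * lam ^ 4 * (1 - lam)\<^sup>2 * sqrt (real K) * zeta0_sq / (sqrt (real N) * real T))"
proof -
  define q where "q = (Lf / \<nu>)\<^sup>2"
  define a where "a = q * expectation Gp0 / (real T * (1 - lam)\<^sup>2)
    + q * expectation Deltac0 / (real T * (1 - lam)\<^sup>2)"
  define z where "z = q * zeta0_sq * (1 - lam) / real T"
  define s where "s = q * \<sigma>\<^sup>2 / real T"
  define r where "r = q * lam ^ 4 * sqrt (real K) * \<sigma>\<^sup>2 / (sqrt (real N) * real T)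
    + q * lam ^ 4 * (1 - lam)\<^sup>2 * sqrt (real K) * zeta0_sq / (sqrt (real N) * real T)"
  have nonneg: "0 \<le> a" "0 \<le> z" "0 \<le> s" "0 \<le> r"
    using Gp0_nonneg Deltac0_nonneg zeta0_nonneg lam_less by (simp_all add: a_def z_def s_def r_def q_def)
  have "stationarity_average T \<le> 48 * 16384 * Lf * a + 115200 * s + 12800 * z"
    using stationarity_bound[OF T]
    by (simp add: a_def z_def s_def q_def[symmetric] add_divide_distrib distrib_left mult_ac)
  also have "\<dots> \<le> (48 * 16384 * Lf + 115200) * (a + z + s + r)"
  proof -
    have "0 \<le> 48 * 16384 * Lf * (z + s + r)" using Lf_pos nonneg by simp
    then show ?thesis using nonneg by (simp add: distrib_left distrib_right)
  qed
  finally show ?thesis by (simp add: a_def z_def s_def r_def q_def add.assoc)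
qed

lemma complexity_bound:
  fixes \<epsilon> \<Gamma> :: real
  assumes \<Gamma>: "expectation Gp0 \<le> \<Gamma>" "expectation Deltac0 \<le> \<Gamma>" "\<sigma>\<^sup>2 \<le> \<Gamma>" "zeta0_sq \<le> \<Gamma>"
    and \<epsilon>: "0 < \<epsilon>" "\<epsilon> \<le> 1"
  defines "D \<equiv> 5 * ((96 * 16384 * Lf + 128000) * \<Gamma> + 2)"
  shows "\<exists>T\<ge>1. (\<forall>T'\<ge>T. stationarity_average T' \<le> \<epsilon>\<^sup>2) \<and>
    real T \<le> D * ((Lf / \<nu>)\<^sup>2 / (\<epsilon>\<^sup>2 * (1 - lam)\<^sup>2) + (Lf / \<nu>)\<^sup>2 / \<epsilon>\<^sup>2 + (Lf / \<nu>)\<^sup>2 / \<epsilon>\<^sup>2 * (1 - lam)) \<and>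
    real T \<le> D * ((Lf / \<nu>)\<^sup>2 / (\<epsilon>\<^sup>2 * (1 - lam)\<^sup>2)) \<and>
    sample_complexity T \<le> D * ((Lf / \<nu>)\<^sup>2 * sqrt (real N) / (\<epsilon>\<^sup>2 * sqrt (real K) * (1 - lam)\<^sup>2))"
proof -
  define q where "q = (Lf / \<nu>)\<^sup>2"
  define B where "B = (96 * 16384 * Lf + 128000) * \<Gamma> + 2"
  obtain T where T: "1 \<le> T" "\<And>T'. T \<le> T' \<Longrightarrow> stationarity_average T' \<le> \<epsilon>\<^sup>2"
    "real T \<le> B * (rate / \<epsilon>\<^sup>2)"
    "sample_complexity T \<le> 5 * B * (rate / \<epsilon>\<^sup>2) * (sqrt (real N) / sqrt (real K))"
    unfolding B_def by (rule complexity[OF \<Gamma> \<epsilon>]) blast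
  define H where "H = q / (\<epsilon>\<^sup>2 * (1 - lam)\<^sup>2)"
  have H: "rate / \<epsilon>\<^sup>2 = H" by (simp add: rate_def H_def q_def mult.commute)
  have "0 \<le> \<Gamma>" using Gp0_nonneg \<Gamma>(1) by linarith
  then have B0: "0 \<le> B" using Lf_pos by (simp add: B_def)
  have q0: "0 \<le> q" by (simp add: q_def)
  then have H0: "0 \<le> H" by (simp add: H_def)
  have BH: "real T \<le> 5 * B * H" using T(3) mult_nonneg_nonneg[OF B0 H0] unfolding H by linarith
  have "5 * B * H \<le> 5 * B * (H + q / \<epsilon>\<^sup>2 + q / \<epsilon>\<^sup>2 * (1 - lam))"
    using B0 lam_less q0 by (intro mult_left_mono) auto
  with BH have "real T \<le> 5 * B * (H + q / \<epsilon>\<^sup>2 + q / \<epsilon>\<^sup>2 * (1 - lam))" by linarith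
  moreover have "sample_complexity T \<le> 5 * B * (q * sqrt (real N) / (\<epsilon>\<^sup>2 * sqrt (real K) * (1 - lam)\<^sup>2))"
    using T(4) unfolding H by (simp add: H_def mult_ac)
  ultimately show ?thesis
    using T(1,2) BH unfolding D_def q_def[symmetric] B_def[symmetric] H_def[symmetric] by blast
qed

end

theorem corollary6:
  fixes Lf :: real
  assumes "0 < Lf"
  shows "\<exists>cx>0. \<exists>cy>0. \<exists>C>0. \<exists>D :: real \<Rightarrow> real.
    \<forall>\<nu> \<kappa>. 0 < \<nu> \<and> \<nu> \<le> Lf \<and> \<kappa> = Lf / \<nu> \<longrightarrow>
    (\<exists>lam0<1. \<forall>K lam \<sigma>. 2 \<le> K \<and> lam0 \<le> lam \<and> lam < 1 \<and> 0 \<le> \<sigma> \<longrightarrow>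
    (\<exists>N0. \<forall>N\<ge>N0.
      \<forall>(Q :: nat \<Rightarrow> 'x::euclidean_space \<Rightarrow> 'y::euclidean_space \<Rightarrow> 'z \<Rightarrow> real) \<zeta> (M :: 'w measure)
        W b0 b p \<mu>x \<mu>y x0 u0 y0 v0 \<xi> \<pi> X U gx Y V gy.
      page_atc_gt K N Q \<zeta> M W lam Lf \<nu> \<sigma> b0 b p \<mu>x \<mu>y x0 u0 y0 v0 \<xi> \<pi> X U gx Y V gy \<and>
      \<mu>x = cx * ((1 - lam)\<^sup>2 / \<kappa>\<^sup>2) \<and> \<mu>y = cy * (1 - lam)\<^sup>2 \<and>
      page_atc_gt.finite_initial_quantities K N Q \<zeta> M W X gx Y gy \<longrightarrow>
      (let EG = prob_space.expectation M (page_atc_gt.Gp0 K N Q \<zeta> X);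
           E\<Delta> = prob_space.expectation M (page_atc_gt.Deltac0 K N Q \<zeta> X Y);
           \<zeta>0sq = page_atc_gt.zeta0_sq K M W gx gy;
           avg = page_atc_gt.stationarity_average K N Q \<zeta> M X Y
       in
        page_atc_gt.square_integrable_gradients K N Q \<zeta> M X Y \<and>
        (\<forall>T\<ge>1. avg T \<le> C *
           (\<kappa>\<^sup>2 * EG / (real T * (1 - lam)\<^sup>2)
            + \<kappa>\<^sup>2 * E\<Delta> / (real T * (1 - lam)\<^sup>2)
            + \<kappa>\<^sup>2 * \<zeta>0sq * (1 - lam) / real T
            + \<kappa>\<^sup>2 * \<sigma>\<^sup>2 / real T
            + \<kappa>\<^sup>2 * lam ^ 4 * sqrt (real K) * \<sigma>\<^sup>2 / (sqrt (real N) * real T)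
            + \<kappa>\<^sup>2 * lam ^ 4 * (1 - lam)\<^sup>2 * sqrt (real K) * \<zeta>0sq / (sqrt (real N) * real T))) \<and>
        (\<forall>\<Gamma> \<epsilon>. EG \<le> \<Gamma> \<and> E\<Delta> \<le> \<Gamma> \<and> \<sigma>\<^sup>2 \<le> \<Gamma> \<and> \<zeta>0sq \<le> \<Gamma> \<and> 0 < \<epsilon> \<and> \<epsilon> \<le> 1 \<longrightarrow>
          (\<exists>T\<ge>1.
            (\<forall>T'\<ge>T. avg T' \<le> \<epsilon>\<^sup>2) \<and>
            real T \<le> D \<Gamma> * (\<kappa>\<^sup>2 / (\<epsilon>\<^sup>2 * (1 - lam)\<^sup>2) + \<kappa>\<^sup>2 / \<epsilon>\<^sup>2 + \<kappa>\<^sup>2 / \<epsilon>\<^sup>2 * (1 - lam)) \<and>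
            real T \<le> D \<Gamma> * (\<kappa>\<^sup>2 / (\<epsilon>\<^sup>2 * (1 - lam)\<^sup>2)) \<and>
            page_atc_gt.sample_complexity N M b0 b \<pi> T
              \<le> D \<Gamma> * (\<kappa>\<^sup>2 * sqrt (real N) / (\<epsilon>\<^sup>2 * sqrt (real K) * (1 - lam)\<^sup>2)))))))"
  \<comment> \<open>The step constants solve the equations of \<open>page_run\<close>: cy = 1 / (64
    Lf) and cx = cy / 256. All witnesses up to \<open>D\<close> depend on \<open>Lf\<close>
    alone.\<close>
  apply (rule exI[of _ "1 / (16384 * Lf)"], rule conjI, use assms in simp)
  apply (rule exI[of _ "1 / (64 * Lf)"], rule conjI, use assms in simp)
  apply (rule exI[of _ "48 * 16384 * Lf + 115200"], rule conjI, use assms in simp)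
  apply (rule exI[of _ "\<lambda>\<Gamma>. 5 * ((96 * 16384 * Lf + 128000) * \<Gamma> + 2)"], intro allI impI)
  apply (rule exI[of _ 0], rule conjI, simp, intro allI impI)
  subgoal premises h for \<nu> \<kappa> K lam \<sigma>
    \<comment> \<open>N at least K ensures that the prescribed batch sqrt (N / K) is at least 1, so
      that rounding cannot empty it.\<close>
    apply (rule exI[of _ K], intro allI impI)
    subgoal premises r for N Q \<zeta> M W b0 b p \<mu>x \<mu>y x0 u0 y0 v0 \<xi> \<pi> X U gx Y V gy
    proof -
      have \<kappa>: "\<kappa> = Lf / \<nu>" using h by simp
      interpret R: page_run K N Q \<zeta> M W lam Lf \<nu> \<sigma> b0 b p \<mu>x \<mu>y x0 u0 y0 v0 \<xi> \<pi> X U gx Y V gy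
      proof (intro page_run.intro page_run_axioms.intro)
        show "64 * Lf * \<mu>y = (1 - lam)\<^sup>2" "256 * (Lf / \<nu>)\<^sup>2 * \<mu>x = \<mu>y"
          using assms h r by (simp_all add: \<kappa>)
      qed (use assms h r in auto)
      show ?thesis
        unfolding Let_def \<kappa>
        using R.square_integrable_gradients_holds R.average_bound R.complexity_bound by blast
    qed
    done
  done

end
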